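(* Let $E$ be a finite set, let $P,Q\subseteq\mathbb{R}^E$ be generalized permutohedra, and let $p,q\colon 2^E\to\mathbb{R}$ be the corresponding submodular set functions. Then the following are equivalent. (1) (compliant functions) For all $X\subseteq Y\subseteq E$: $q(Y)-q(X)\le p(Y)-p(X)$. (2) (containment of bases) For every $\sigma\in\mathrm{Sym}(E)$, the vertices $x_\sigma$ of $P$ and $y_\sigma$ of $Q$ satisfy $x_\sigma\ge y_\sigma$ coordinatewise. (3) (submodular polyhedron containment) For all $X\subseteq E$: $S(q_{/X})\subseteq S(p_{/X})$. (4) (top and bottom) The polyhedron $R=G(p,q^\#)$ is a generalized polymatroid with $P=R^\uparrow$ and $Q=R^\downarrow$. (5) (deletion-contraction) There exist a finite set $X$ and a generalized permutohedron $R\subseteq\mathbb{R}^{\widetilde E}$ with $\widetilde E=E\sqcup X$ such that $P=R\setminus X$ is the deletion and $Q=R/X$ is the contraction of $R$. (Moreover, $X$ can be picked to be a singleton.) (6) (exchange property) For all $x\in Q$, $y\in P$ and $i\in\mathrm{supp}^+(x-y)$, there exist $j\in\mathrm{supp}^-(x-y)$ and a positive number $\rho_0$ such that $x-\rho(e_i-e_j)\in Q$ and $y+\rho(e_i-e_j)\in P$ for all $\rho\in[0,\rho_0]$. (7) (edge directions) The polyhedron $\big(B(p)+\mathbb{R}^E_{\le0}\big)\cap\big(B(q)+\mathbb{R}^E_{\ge0}\big)$ has only edge directions $e_i-e_j$ and $e_i$. (8) (induction) There exist a finite set $\widetilde E$ and generalized permutohedra $\Gamma\subseteq\mathbb{R}^E\times\mathbb{R}^{\widetilde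 E}$ and $W\subseteq\mathbb{R}^{\widetilde E}$ such that $P=\pi_E(\Gamma)^\uparrow$ and $Q=\mathrm{ind}_\Gamma(W)$. (9) ($\mathcal{R}$-ordered linking permutohedra) There exist linking permutohedra $\Gamma,\Delta\subseteq\mathbb{R}^E\times\mathbb{R}^E$ such that $P$ and $Q$ are the top layers of the left sets of $\Gamma$ and $\Delta$ respectively, and $\Gamma\preceq_{\mathcal R}\Delta$, where $\preceq_{\mathcal R}$ is Green's right preorder on the monoid of linking permutohedra on $E$.
   Context: Notation: $x(A)=\sum_{i\in A}x_i$; $e_i$ unit vectors; $\mathrm{supp}^+(x-y)=\{i:x_i>y_i\}$, $\mathrm{supp}^-(x-y)=\mathrm{supp}^+(y-x)$. A submodular set function is $p\colon2^E\to\mathbb{R}$ with $p(A\cup B)+p(A\cap B)\le p(A)+p(B)$ for all $A,B\subseteq E$, normalized by $p(\emptyset)=0$; $q$ is supermodular if $-q$ is submodular. Base polyhedron: $B(p)=\{x\in\mathbb{R}^E:x(A)\le p(A)\ \forall A,\ x(E)=p(E)\}$; submodular polyhedron: $S(p)=\{x:x(A)\le p(A)\ \forall A\}$. A (bounded) generalized permutohedron is a polytope of the form $P=B(p)$ for a submodular $p$; the correspondence is bijective with $p(A)=\max_{x\in P}x(A)$. For $\sigma\in\mathrm{Sym}(E)$ (with $E=\{1,\dots,n\}$), the vertex $x_\sigma$ of $P$ is the unique maximizer over $P$ of $\sum_ic_ix_i$ for any $c$ with $c_{\sigma(1)}>\dots>c_{\sigma(n)}$. Contraction: $p_{/X}\colon2^{E\setminus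 X}\to\mathbb{R}$, $p_{/X}(A)=p(A\cup X)-p(X)$. Dual: $q^\#(A)=q(E)-q(E\setminus A)$ (supermodular). $G(p,q')=\{x\in\mathbb{R}^E:q'(A)\le x(A)\le p(A)\ \forall A\subseteq E\}$. A generalized polymatroid is a polyhedron $G(p,q')$ with $p$ submodular, $q'$ supermodular, and $p(A)-q'(B)\ge p(A\setminus B)-q'(B\setminus A)$ for all $A,B\subseteq E$. For a generalized polymatroid $R$ (e.g. a coordinate projection of a generalized permutohedron), the top layer $R^\uparrow$ and the bottom layer $R^\downarrow$ are the faces on which $x(E)$ is maximal, respectively minimal. For $R\subseteq\mathbb{R}^{E\sqcup X}$ a generalized permutohedron and $\pi_E$ the coordinate projection to $\mathbb{R}^E$: deletion $R\setminus X=\pi_E(R)^\uparrow$, contraction $R/X=\pi_E(R)^\downarrow$. Induction: for $\Gamma\subseteq\mathbb{R}^E\times\mathbb{R}^{\widetilde E}$ and $W\subseteq\mathbb{R}^{\widetilde E}$, $\mathrm{ind}_\Gamma(W)=\{x\in\mathbb{R}^E:\exists y\in W,\ (x,-y)\in\Gamma\}$. Monoid of linking permutohedra on $E$: the elements (linking permutohedra) are the possibly unbounded generalized permutohedra $\Gamma\subseteq\mathbb{R}^E\times\mathbb{R}^E$ (facets of a generalized permutohedron may be moved to infinity, i.e. base polyhedra of submodular functions with values in $\mathbb{R}\cup\{\infty\}$), with product $\Gamma*\Delta=\{(x,-z):\exists y\in\mathbb{R}^E,\ (x,-y)\in\Gamma,\ (y,-z)\in\Delta\}$ and identity $\{(x,-x):x\in\mathbb{R}^E\}$.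 The left set of $\Gamma$ is its projection to the first factor. Green's right preorder: $\Gamma\preceq_{\mathcal R}\Delta$ iff there is a linking permutohedron $X$ with $\Gamma*X=\Delta$.
   Formalization: Condition (7) additionally requires that the polyhedron contain both P and Q; without this (7) does not imply (1), e.g. E={1,2}, p=1 on nonempty sets, q(A)=|A|/2, where the polyhedron is a single point and has no edges. *)

theory Defs
  imports "HOL-Analysis.Analysis"
begin

text \<open>
  The space of real vectors indexed by a finite set \<open>I\<close> is the set of functions
  \<open>'i \<Rightarrow> real\<close> vanishing outside \<open>I\<close>. This lets the index set be existentially
  quantified: a disjoint union of index sets is \<open>I <+> J\<close>, the pair \<open>(x, y)\<close> is
  \<open>case_sum x y\<close>, and "some finite set" is, up to relabelling, a finite set of naturals.
  Set functions on \<open>I\<close> are functions on \<open>'i set\<close>; only their values on subsets of \<open>I\<close> matter.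
\<close>

definition coord_space :: "'i set \<Rightarrow> ('i \<Rightarrow> real) set" where
  "coord_space I = {x. \<forall>i. i \<notin> I \<longrightarrow> x i = 0}"

definition unit_vec :: "'i \<Rightarrow> 'i \<Rightarrow> real" where
  "unit_vec i = (\<lambda>k. if k = i then 1 else 0)"

definition supp_plus :: "('i \<Rightarrow> real) \<Rightarrow> ('i \<Rightarrow> real) \<Rightarrow> 'i set" where
  "supp_plus x y = {i. x i > y i}"

definition supp_minus :: "('i \<Rightarrow> real) \<Rightarrow> ('i \<Rightarrow> real) \<Rightarrow> 'i set" where
  "supp_minus x y = supp_plus y x"


text \<open>The codomain is polymorphic so as to cover both \<open>real\<close> and \<open>ereal\<close>.\<close>

definition submodular_on :: "'i set \<Rightarrow> ('i set \<Rightarrow> 'b::{plus,ord,zero}) \<Rightarrow> bool" where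
  "submodular_on I p \<longleftrightarrow>
     p {} = 0 \<and> (\<forall>A B. A \<subseteq> I \<longrightarrow> B \<subseteq> I \<longrightarrow> p (A \<union> B) + p (A \<inter> B) \<le> p A + p B)"

definition supermodular_on :: "'i set \<Rightarrow> ('i set \<Rightarrow> real) \<Rightarrow> bool" where
  "supermodular_on I q \<longleftrightarrow> submodular_on I (\<lambda>A. - q A)"

definition submodular_polyhedron :: "'i set \<Rightarrow> ('i set \<Rightarrow> real) \<Rightarrow> ('i \<Rightarrow> real) set" where
  "submodular_polyhedron I p = {x \<in> coord_space I. \<forall>A\<subseteq>I. sum x A \<le> p A}"

definition base_polyhedron :: "'i set \<Rightarrow> ('i set \<Rightarrow> real) \<Rightarrow> ('i \<Rightarrow> real) set" where
  "base_polyhedron I p = {x \<in> coord_space I. (\<forall>A\<subseteq>I. sum x A \<le> p A) \<and> sum x I = p I}"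

definition gen_permutohedron :: "'i set \<Rightarrow> ('i \<Rightarrow> real) set \<Rightarrow> bool" where
  "gen_permutohedron I P \<longleftrightarrow> (\<exists>p. submodular_on I p \<and> P = base_polyhedron I p)"

text \<open>
  Possibly unbounded generalized permutohedra: the submodular function takes values in
  \<open>\<real> \<union> {\<infinity>}\<close>. Its value at the ground set must be finite, since it defines the
  hyperplane \<open>x(I) = f(I)\<close>, which is not one of the facets that can be moved to infinity.
\<close>

definition ext_base_polyhedron :: "'i set \<Rightarrow> ('i set \<Rightarrow> ereal) \<Rightarrow> ('i \<Rightarrow> real) set" where
  "ext_base_polyhedron I f =
     {x \<in> coord_space I. (\<forall>A\<subseteq>I. ereal (sum x A) \<le> f A) \<and> ereal (sum x I) = f I}"

definition ext_gen_permutohedron :: "'i set \<Rightarrow> ('i \<Rightarrow> real) set \<Rightarrow> bool" where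
  "ext_gen_permutohedron I P \<longleftrightarrow>
     (\<exists>f :: 'i set \<Rightarrow> ereal. submodular_on I f \<and> (\<forall>A\<subseteq>I. f A \<noteq> -\<infinity>) \<and> f I \<noteq> \<infinity> \<and>
        P = ext_base_polyhedron I f)"

text \<open>
  The numbering of the ground set by \<open>{1..n}\<close> followed by the permutation \<open>\<sigma>\<close> is a
  bijection \<open>\<sigma>\<close> from \<open>{1..card I}\<close> onto \<open>I\<close>.
\<close>

definition perm_vertex :: "'i set \<Rightarrow> ('i \<Rightarrow> real) set \<Rightarrow> (nat \<Rightarrow> 'i) \<Rightarrow> 'i \<Rightarrow> real" where
  "perm_vertex I P \<sigma> = (THE x. \<forall>c :: 'i \<Rightarrow> real.
     (\<forall>k\<in>{1..card I}. \<forall>l\<in>{1..card I}. k < l \<longrightarrow> c (\<sigma> k) > c (\<sigma> l)) \<longrightarrow>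
     x \<in> P \<and> (\<forall>y\<in>P. y \<noteq> x \<longrightarrow> (\<Sum>i\<in>I. c i * y i) < (\<Sum>i\<in>I. c i * x i)))"

text \<open>The contraction of a set function on \<open>I\<close> is a set function on \<open>I - X\<close>.\<close>

definition contract_fun :: "('i set \<Rightarrow> real) \<Rightarrow> 'i set \<Rightarrow> 'i set \<Rightarrow> real" where
  "contract_fun p X = (\<lambda>A. p (A \<union> X) - p X)"

definition dual_fun :: "'i set \<Rightarrow> ('i set \<Rightarrow> real) \<Rightarrow> 'i set \<Rightarrow> real" where
  "dual_fun I q = (\<lambda>A. q I - q (I - A))"

definition G_polyhedron ::
    "'i set \<Rightarrow> ('i set \<Rightarrow> real) \<Rightarrow> ('i set \<Rightarrow> real) \<Rightarrow> ('i \<Rightarrow> real) set" where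
  "G_polyhedron I p q' = {x \<in> coord_space I. \<forall>A\<subseteq>I. q' A \<le> sum x A \<and> sum x A \<le> p A}"

definition gen_polymatroid :: "'i set \<Rightarrow> ('i \<Rightarrow> real) set \<Rightarrow> bool" where
  "gen_polymatroid I R \<longleftrightarrow>
     (\<exists>p q'. submodular_on I p \<and> supermodular_on I q' \<and>
        (\<forall>A B. A \<subseteq> I \<longrightarrow> B \<subseteq> I \<longrightarrow> p A - q' B \<ge> p (A - B) - q' (B - A)) \<and>
        R = G_polyhedron I p q')"

definition top_layer :: "'i set \<Rightarrow> ('i \<Rightarrow> real) set \<Rightarrow> ('i \<Rightarrow> real) set" where
  "top_layer I R = {x \<in> R. \<forall>y\<in>R. sum y I \<le> sum x I}"

definition bottom_layer :: "'i set \<Rightarrow> ('i \<Rightarrow> real) set \<Rightarrow> ('i \<Rightarrow> real) set" where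
  "bottom_layer I R = {x \<in> R. \<forall>y\<in>R. sum x I \<le> sum y I}"


definition proj_left :: "('i + 'j \<Rightarrow> real) set \<Rightarrow> ('i \<Rightarrow> real) set" where
  "proj_left R = (\<lambda>x i. x (Inl i)) ` R"

text \<open>Deletion and contraction of the second summand of the ground set \<open>I <+> X\<close>.\<close>

definition deletion :: "'i set \<Rightarrow> ('i + 'j \<Rightarrow> real) set \<Rightarrow> ('i \<Rightarrow> real) set" where
  "deletion I R = top_layer I (proj_left R)"

definition contraction :: "'i set \<Rightarrow> ('i + 'j \<Rightarrow> real) set \<Rightarrow> ('i \<Rightarrow> real) set" where
  "contraction I R = bottom_layer I (proj_left R)"

definition pair_neg :: "('i \<Rightarrow> real) \<Rightarrow> ('j \<Rightarrow> real) \<Rightarrow> 'i + 'j \<Rightarrow> real" where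
  "pair_neg x y = case_sum x (\<lambda>j. - y j)"

definition induction_by ::
    "'i set \<Rightarrow> ('i + 'j \<Rightarrow> real) set \<Rightarrow> ('j \<Rightarrow> real) set \<Rightarrow> ('i \<Rightarrow> real) set" where
  "induction_by I \<Gamma> W = {x \<in> coord_space I. \<exists>y\<in>W. pair_neg x y \<in> \<Gamma>}"

definition linking_permutohedron :: "'i set \<Rightarrow> ('i + 'i \<Rightarrow> real) set \<Rightarrow> bool" where
  "linking_permutohedron I \<Gamma> \<longleftrightarrow> ext_gen_permutohedron (I <+> I) \<Gamma>"

definition link_mult ::
    "'i set \<Rightarrow> ('i + 'i \<Rightarrow> real) set \<Rightarrow> ('i + 'i \<Rightarrow> real) set \<Rightarrow> ('i + 'i \<Rightarrow> real) set" where
  "link_mult I \<Gamma> \<Delta> =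
     {pair_neg x z | x z. x \<in> coord_space I \<and> z \<in> coord_space I \<and>
        (\<exists>y\<in>coord_space I. pair_neg x y \<in> \<Gamma> \<and> pair_neg y z \<in> \<Delta>)}"

definition green_R ::
    "'i set \<Rightarrow> ('i + 'i \<Rightarrow> real) set \<Rightarrow> ('i + 'i \<Rightarrow> real) set \<Rightarrow> bool" where
  "green_R I \<Gamma> \<Delta> \<longleftrightarrow> (\<exists>X. linking_permutohedron I X \<and> link_mult I \<Gamma> X = \<Delta>)"

definition add_nonpos :: "'i set \<Rightarrow> ('i \<Rightarrow> real) set \<Rightarrow> ('i \<Rightarrow> real) set" where
  "add_nonpos I P = {\<lambda>i. x i + u i | x u. x \<in> P \<and> u \<in> coord_space I \<and> (\<forall>i. u i \<le> 0)}"

definition add_nonneg :: "'i set \<Rightarrow> ('i \<Rightarrow> real) set \<Rightarrow> ('i \<Rightarrow> real) set" where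
  "add_nonneg I P = {\<lambda>i. x i + u i | x u. x \<in> P \<and> u \<in> coord_space I \<and> (\<forall>i. u i \<ge> 0)}"

text \<open>
  Edges are taken in the Euclidean space \<open>real ^ 'e\<close>. Since an edge \<open>F\<close> has affine
  dimension 1, containment of its differences in the line spanned by a nonzero \<open>d\<close> says
  that \<open>d\<close> is its direction (up to scaling and sign).
\<close>

definition has_direction :: "(real ^ 'e::finite) set \<Rightarrow> real ^ 'e \<Rightarrow> bool" where
  "has_direction F d \<longleftrightarrow> d \<noteq> 0 \<and> (\<forall>a\<in>F. \<forall>b\<in>F. b - a \<in> span {d})"

definition polymatroidal_edges :: "'e::finite set \<Rightarrow> ('e \<Rightarrow> real) set \<Rightarrow> bool" where
  "polymatroidal_edges I M \<longleftrightarrow>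
     (\<forall>F. F edge_of (vec_lambda ` M) \<longrightarrow>
        (\<exists>i\<in>I. \<exists>j\<in>I. i \<noteq> j \<and> has_direction F (axis i 1 - axis j 1)) \<or>
        (\<exists>i\<in>I. has_direction F (axis i 1)))"


definition all_equivalent :: "bool list \<Rightarrow> bool" where
  "all_equivalent Cs \<longleftrightarrow> (\<forall>a\<in>set Cs. \<forall>b\<in>set Cs. a \<longleftrightarrow> b)"

end

theory Submission
  imports Defs
begin

text \<open>
  Every condition is compared with compliance, \<open>q Y - q X \<le> p Y - p X\<close> for \<open>X \<subseteq> Y \<subseteq> E\<close>.

  Existence of points comes from the discrete sandwich theorem \<open>submodular_sandwich\<close>: a
  supermodular function below a submodular one can be separated from it by a modular function,
  that is, by a vector. Taking a chain of sets as the supermodular side gives a base which is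
  tight on the chain (\<open>base_polyhedron_tight_on_chain\<close>). Hence the base polyhedron determines
  its function, the contracted functions are determined by their submodular polyhedra, and the
  vertex of \<open>\<sigma>\<close> has \<open>\<sigma> k\<close>-th coordinate \<open>p (\<sigma> ` {1..k}) - p (\<sigma> ` {1..k - 1})\<close>. As every pair
  \<open>X \<subseteq> Y\<close> consists of two prefixes of some \<open>\<sigma>\<close>, containment of bases is compliance.

  For the exchange property, let \<open>T\<close> be the least \<open>y\<close>-tight set containing \<open>i\<close> and \<open>S\<close> the
  greatest \<open>x\<close>-tight set avoiding \<open>i\<close>. The admissible \<open>j\<close> are those of \<open>T - S\<close>, and compliance
  gives \<open>x (T - S) \<le> y (T - S)\<close>, so some \<open>j\<close> there has \<open>x j < y j\<close>. Conversely, at the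
  vertices of an enumeration with a prefix \<open>A\<close> ending in \<open>i\<close>, tightness of \<open>A\<close> and \<open>A - {i}\<close>
  leaves no room for any \<open>j \<noteq> i\<close>.

  The cross inequality of a generalized polymatroid, for \<open>p\<close> and the dual of \<open>q\<close>, is compliance after
  complementing one set. A compliant pair is moreover the pair of deletion and contraction of a
  single submodular function on \<open>E\<close> with one extra point (\<open>lift_fun\<close>), whose base polyhedron
  projects onto \<open>G_polyhedron E p (dual_fun E q)\<close>; it also serves as the witness for induction
  and for the linking permutohedra.

  In the other direction, induction and multiplication of linking permutohedra are both
  compositions, and the bounds that define a composition are the partial minima
  \<open>\<lambda>A C. min\<^sub>B g A B + h B C\<close> (\<open>base_of_compose_bounds\<close>). Thus \<open>q A = g A B + h B\<close> for some \<open>B\<close>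
  while \<open>p A = g A {}\<close>, and submodularity of \<open>g\<close> gives compliance.

  Finally, the polyhedron of the edge condition is \<open>G_polyhedron E p (dual_fun E q)\<close>. If \<open>p\<close> and
  \<open>q\<close> are compliant, it is a projection of a base polyhedron, and exchanging between two
  points of an edge exhibits the direction of this edge. Conversely, no direction \<open>e\<^sub>i - e\<^sub>j\<close> or \<open>e\<^sub>i\<close>
  can move \<open>x X\<close> and \<open>x (E - Y)\<close> the same way when \<open>X \<subseteq> Y\<close>. Hence a maximizer of
  \<open>x X - x (E - Y)\<close> maximizes \<open>x X\<close> and minimizes \<open>x (E - Y)\<close> over the whole polytope, and the
  remaining inequalities at this one point read \<open>q Y - q X \<le> p Y - p X\<close>.
\<close>

section \<open>Submodular systems of upper bounds and the sandwich theorem\<close>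

text \<open>
  A pair \<open>(A, r)\<close> stands for the constraint \<open>x(A) \<le> r\<close>. Allowing no constraint, or several, on a
  set makes infinite values harmless and turns partial minimization of a submodular
  function into taking the image of a set of pairs.
\<close>

definition submodular_bounds :: "'i set \<Rightarrow> ('i set \<times> real) set \<Rightarrow> bool" where
  "submodular_bounds I U \<longleftrightarrow> finite U \<and> ({}, 0) \<in> U \<and> (\<forall>A r. (A, r) \<in> U \<longrightarrow> A \<subseteq> I) \<and>
     (\<forall>A r B s. (A, r) \<in> U \<longrightarrow> (B, s) \<in> U \<longrightarrow>
        (\<exists>r' s'. (A \<union> B, r') \<in> U \<and> (A \<inter> B, s') \<in> U \<and> r' + s' \<le> r + s))"

lemma submodular_boundsD:
  assumes "submodular_bounds I U"
  shows "finite U" "({}, 0) \<in> U" "(A, r) \<in> U \<Longrightarrow> A \<subseteq> I"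
    "(A, r) \<in> U \<Longrightarrow> (B, s) \<in> U \<Longrightarrow>
      \<exists>r' s'. (A \<union> B, r') \<in> U \<and> (A \<inter> B, s') \<in> U \<and> r' + s' \<le> r + s"
  using assms unfolding submodular_bounds_def by blast+

text \<open>
  This covers the operations by which coordinates are eliminated: \<open>\<phi>\<close> forgets a part of the
  ground set and \<open>w\<close> shifts the bounds by the values already chosen there.
\<close>

lemma submodular_bounds_image:
  assumes U: "submodular_bounds I U" and fin: "finite I"
    and hom: "\<phi> {} = {}" "\<And>A B. \<phi> (A \<union> B) = \<phi> A \<union> \<phi> B" "\<And>A B. \<phi> (A \<inter> B) = \<phi> A \<inter> \<phi> B"
    and dom: "\<And>A. A \<subseteq> I \<Longrightarrow> \<phi> A \<subseteq> J"
  shows "submodular_bounds J ((\<lambda>(A, r). (\<phi> A, r + sum w A)) ` U)" (is "submodular_bounds J ?V")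
  unfolding submodular_bounds_def
proof (intro conjI allI impI)
  show "finite ?V" using submodular_boundsD(1)[OF U] by simp
  show "({}, 0) \<in> ?V"
    using submodular_boundsD(2)[OF U] hom(1) by (auto intro!: rev_image_eqI[of "({}, 0)"])
  show "A \<subseteq> J" if "(A, r) \<in> ?V" for A r
    using that submodular_boundsD(3)[OF U] dom by (clarsimp simp: image_iff) blast
  fix A r B s assume "(A, r) \<in> ?V" "(B, s) \<in> ?V"
  then obtain A0 r0 B0 s0 where 0: "(A0, r0) \<in> U" "A = \<phi> A0" "r = r0 + sum w A0"
    "(B0, s0) \<in> U" "B = \<phi> B0" "s = s0 + sum w B0" by auto
  then obtain r' s' where 1: "(A0 \<union> B0, r') \<in> U" "(A0 \<inter> B0, s') \<in> U" "r' + s' \<le> r0 + s0"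
    using submodular_boundsD(4)[OF U] by blast
  have "finite A0" "finite B0"
    using 0 submodular_boundsD(3)[OF U] fin by (meson finite_subset)+
  then have "sum w (A0 \<union> B0) + sum w (A0 \<inter> B0) = sum w A0 + sum w B0"
    by (rule sum.union_inter)
  moreover have "(A \<union> B, r' + sum w (A0 \<union> B0)) \<in> ?V"
    using image_eqI[OF _ 1(1), of _ "\<lambda>(A, r). (\<phi> A, r + sum w A)"] 0 hom(2) by simp
  moreover have "(A \<inter> B, s' + sum w (A0 \<inter> B0)) \<in> ?V"
    using image_eqI[OF _ 1(2), of _ "\<lambda>(A, r). (\<phi> A, r + sum w A)"] 0 hom(3) by simp
  moreover have "(r' + sum w (A0 \<union> B0)) + (s' + sum w (A0 \<inter> B0)) \<le> r + s"
    using calculation(1) 0 1(3) by linarith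
  ultimately show "\<exists>r' s'. (A \<union> B, r') \<in> ?V \<and> (A \<inter> B, s') \<in> ?V \<and> r' + s' \<le> r + s"
    by blast
qed

lemma finite_sets_separated:
  fixes L U :: "real set"
  assumes "finite L" "finite U" "\<And>l u. l \<in> L \<Longrightarrow> u \<in> U \<Longrightarrow> l \<le> u"
  obtains c where "\<And>l. l \<in> L \<Longrightarrow> l \<le> c" "\<And>u. u \<in> U \<Longrightarrow> c \<le> u"
proof (cases "L = {}")
  case True
  show ?thesis
  proof (cases "U = {}")
    case True then show ?thesis using \<open>L = {}\<close> that by auto
  next
    case False then show ?thesis using \<open>L = {}\<close> that[of "Min U"] assms by auto
  qed
next
  case False
  then show ?thesis using that[of "Max L"] assms by auto
qed

text \<open>
  Both systems are submodular: the second bounds \<open>- x(A)\<close> from above and so represents a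
  supermodular lower bound. The proof eliminates one element \<open>e\<close> of the ground set after choosing
  \<open>x e\<close>. A value is admissible if the two remaining systems are still compatible, which confines
  it to an interval; submodularity, applied to a pair of constraints giving a lower and an
  upper end, shows that the interval is nonempty.
\<close>

theorem submodular_sandwich:
  assumes "finite I" "submodular_bounds I U" "submodular_bounds I L"
    and "\<And>A r s. (A, r) \<in> U \<Longrightarrow> (A, s) \<in> L \<Longrightarrow> 0 \<le> r + s"
  shows "\<exists>x\<in>coord_space I. (\<forall>A r. (A, r) \<in> U \<longrightarrow> sum x A \<le> r) \<and>
                            (\<forall>A s. (A, s) \<in> L \<longrightarrow> - s \<le> sum x A)"
  using assms
proof (induction I arbitrary: U L rule: finite_induct)
  case empty
  have "0 \<le> r" if "(A, r) \<in> U" for A r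
    using submodular_boundsD(3)[OF empty.prems(1) that] submodular_boundsD(2)[OF empty.prems(2)]
      empty.prems(3)[of A r 0] that by auto
  moreover have "0 \<le> s" if "(A, s) \<in> L" for A s
    using submodular_boundsD(3)[OF empty.prems(2) that] submodular_boundsD(2)[OF empty.prems(1)]
      empty.prems(3)[of A 0 s] that by auto
  ultimately show ?case
    using submodular_boundsD(3)[OF empty.prems(1)] submodular_boundsD(3)[OF empty.prems(2)]
    by (intro bexI[of _ "\<lambda>_. 0"]) (auto simp: coord_space_def)
next
  case (insert e I)
  note U = submodular_boundsD[OF insert.prems(1)] and L = submodular_boundsD[OF insert.prems(2)]
  \<comment> \<open>constraints on \<open>x e\<close> by which the systems remain compatible once \<open>e\<close> is removed\<close>
  define lower where
    "lower = {- (r + s) | A r s. (A, r) \<in> U \<and> (insert e A, s) \<in> L \<and> e \<notin> A}"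
  define upper where
    "upper = {r + s | B r s. (insert e B, r) \<in> U \<and> (B, s) \<in> L \<and> e \<notin> B}"
  have fst: "finite (snd ` U)" "finite (snd ` L)" using U(1) L(1) by simp_all
  have fin_sums: "finite {f r s | r s. r \<in> snd ` U \<and> s \<in> snd ` L}" for f :: "real \<Rightarrow> real \<Rightarrow> real"
    using fst by (intro finite_image_set2) simp_all
  have fin: "finite lower"
    by (rule finite_subset[OF _ fin_sums[of "\<lambda>r s. - (r + s)"]]) (force simp: lower_def)
  have fin': "finite upper"
    by (rule finite_subset[OF _ fin_sums[of "\<lambda>r s. r + s"]]) (force simp: upper_def)
  have cross: "l \<le> u" if l: "l \<in> lower" and u: "u \<in> upper" for l u
  proof -
    obtain A r s where 1: "(A, r) \<in> U" "(insert e A, s) \<in> L" "e \<notin> A" "l = - (r + s)"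
      using l unfolding lower_def by blast
    obtain B r2 s2 where 2: "(insert e B, r2) \<in> U" "(B, s2) \<in> L" "e \<notin> B" "u = r2 + s2"
      using u unfolding upper_def by blast
    have sets: "insert e A \<inter> B = A \<inter> B" "A \<inter> insert e B = A \<inter> B"
      "A \<union> insert e B = insert e (A \<union> B)" "insert e A \<union> B = insert e (A \<union> B)"
      using 1(3) 2(3) by auto
    obtain r' r2' where 3: "(insert e (A \<union> B), r') \<in> U" "(A \<inter> B, r2') \<in> U" "r' + r2' \<le> r + r2"
      using U(4)[OF 1(1) 2(1)] unfolding sets by blast
    obtain s' s2' where 4: "(insert e (A \<union> B), s') \<in> L" "(A \<inter> B, s2') \<in> L" "s' + s2' \<le> s + s2"
      using L(4)[OF 1(2) 2(2)] unfolding sets by blast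
    show ?thesis
      using insert.prems(3)[OF 3(1) 4(1)] insert.prems(3)[OF 3(2) 4(2)] 1(4) 2(4) 3(3) 4(3)
      by linarith
  qed
  obtain c where c: "\<And>l. l \<in> lower \<Longrightarrow> l \<le> c" "\<And>u. u \<in> upper \<Longrightarrow> c \<le> u"
    using finite_sets_separated[OF fin fin' cross] by blast
  define w where "w = (\<lambda>k. if k = e then c else 0)"
  have sum_w: "sum w A = (if e \<in> A then c else 0)" if "A \<subseteq> insert e I" for A
    using finite_subset[OF that] insert.hyps(1) unfolding w_def by (simp add: sum.delta')
  define U' where "U' = (\<lambda>(A, r). (A \<inter> I, r + sum (\<lambda>k. - w k) A)) ` U"
  define L' where "L' = (\<lambda>(A, s). (A \<inter> I, s + sum w A)) ` L"
  have U': "submodular_bounds I U'" unfolding U'_def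
    by (rule submodular_bounds_image[OF insert.prems(1)]) (use insert.hyps(1) in auto)
  have L': "submodular_bounds I L'" unfolding L'_def
    by (rule submodular_bounds_image[OF insert.prems(2)]) (use insert.hyps(1) in auto)
  have compat: "0 \<le> r + s" if "(A, r) \<in> U'" "(A, s) \<in> L'" for A r s
  proof -
    obtain A1 r1 where 1: "(A1, r1) \<in> U" "A = A1 \<inter> I" "r = r1 - sum w A1"
      using \<open>(A, r) \<in> U'\<close> unfolding U'_def by (auto simp: sum_negf)
    obtain A2 s2 where 2: "(A2, s2) \<in> L" "A = A2 \<inter> I" "s = s2 + sum w A2"
      using \<open>(A, s) \<in> L'\<close> unfolding L'_def by auto
    note sub = U(3)[OF 1(1)] L(3)[OF 2(1)]
    consider "A1 = A2" | "e \<notin> A1" "A2 = insert e A1" | "e \<notin> A2" "A1 = insert e A2"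
      using sub 1(2) 2(2) insert.hyps(2) by blast
    then show ?thesis
    proof cases
      case 1
      then show ?thesis using \<open>(A1, r1) \<in> U\<close> 2 insert.prems(3) \<open>r = _\<close> by auto
    next
      case 2
      then have "- (r1 + s2) \<in> lower"
        unfolding lower_def using \<open>(A1, r1) \<in> U\<close> \<open>(A2, s2) \<in> L\<close> by blast
      from c(1)[OF this] show ?thesis
        using 2 sum_w[OF sub(1)] sum_w[OF sub(2)] \<open>r = _\<close> \<open>s = _\<close> by auto
    next
      case 3
      then have "r1 + s2 \<in> upper"
        unfolding upper_def using \<open>(A1, r1) \<in> U\<close> \<open>(A2, s2) \<in> L\<close> by blast
      from c(2)[OF this] show ?thesis
        using 3 sum_w[OF sub(1)] sum_w[OF sub(2)] \<open>r = _\<close> \<open>s = _\<close> by auto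
    qed
  qed
  obtain u where u: "u \<in> coord_space I" "\<And>A r. (A, r) \<in> U' \<Longrightarrow> sum u A \<le> r"
    "\<And>A s. (A, s) \<in> L' \<Longrightarrow> - s \<le> sum u A"
    using insert.IH[OF U' L'] compat by blast
  define x where "x = (\<lambda>k. u k + w k)"
  have x: "sum x A = sum u (A \<inter> I) + sum w A" if "A \<subseteq> insert e I" for A
  proof -
    have "sum u A = sum u (A \<inter> I)"
      using u(1) insert.hyps(1) finite_subset[OF that]
      by (intro sum.mono_neutral_right) (auto simp: coord_space_def)
    then show ?thesis unfolding x_def by (simp add: sum.distrib)
  qed
  show ?case
  proof (intro bexI[of _ x] conjI allI impI)
    show "x \<in> coord_space (insert e I)"
      using u(1) unfolding x_def w_def coord_space_def by auto
    show "sum x A \<le> r" if "(A, r) \<in> U" for A r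
    proof -
      have "(A \<inter> I, r + sum (\<lambda>k. - w k) A) \<in> U'" unfolding U'_def using that by force
      from u(2)[OF this] show ?thesis using x[OF U(3)[OF that]] by (simp add: sum_negf)
    qed
    show "- s \<le> sum x A" if "(A, s) \<in> L" for A s
    proof -
      have "(A \<inter> I, s + sum w A) \<in> L'" unfolding L'_def using that by force
      from u(3)[OF this] show ?thesis using x[OF L(3)[OF that]] by simp
    qed
  qed
qed


text \<open>
  The total \<open>t\<close> is a separate parameter because a system may contain several bounds on \<open>I\<close>.
\<close>

definition base_of :: "'i set \<Rightarrow> ('i set \<times> real) set \<Rightarrow> real \<Rightarrow> ('i \<Rightarrow> real) set" where
  "base_of I U t = {x \<in> coord_space I. (\<forall>A r. (A, r) \<in> U \<longrightarrow> sum x A \<le> r) \<and> sum x I = t}"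

definition bounds_of :: "'i set \<Rightarrow> ('i set \<Rightarrow> ereal) \<Rightarrow> ('i set \<times> real) set" where
  "bounds_of I f = {(A, r). A \<subseteq> I \<and> f A = ereal r}"

lemma submodular_bounds_chain:
  assumes "finite L" "({}, 0) \<in> L" "\<And>A r. (A, r) \<in> L \<Longrightarrow> A \<subseteq> I"
    and "\<And>A r B s. (A, r) \<in> L \<Longrightarrow> (B, s) \<in> L \<Longrightarrow> A \<subseteq> B \<or> B \<subseteq> A"
  shows "submodular_bounds I L"
  unfolding submodular_bounds_def
proof (intro conjI allI impI assms)
  fix A r B s assume L: "(A, r) \<in> L" "(B, s) \<in> L"
  show "\<exists>r' s'. (A \<union> B, r') \<in> L \<and> (A \<inter> B, s') \<in> L \<and> r' + s' \<le> r + s"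
  proof (cases "A \<subseteq> B")
    case True
    then have "A \<union> B = B" "A \<inter> B = A" by auto
    with L show ?thesis by (intro exI[of _ s] exI[of _ r]) simp
  next
    case False
    then have "A \<union> B = A" "A \<inter> B = B" using assms(4)[OF L] by auto
    with L show ?thesis by (intro exI[of _ r] exI[of _ s]) simp
  qed
qed

lemma submodular_bounds_of:
  assumes "finite I" "submodular_on I f" "\<forall>A\<subseteq>I. f A \<noteq> -\<infinity>"
  shows "submodular_bounds I (bounds_of I f)"
  unfolding submodular_bounds_def
proof (intro conjI allI impI)
  have "bounds_of I f \<subseteq> (\<lambda>A. (A, real_of_ereal (f A))) ` Pow I"
    unfolding bounds_of_def by auto
  then show "finite (bounds_of I f)"
    using assms(1) by (meson finite_Pow_iff finite_imageI finite_subset)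
  show "({}, 0) \<in> bounds_of I f"
    using assms(2) unfolding bounds_of_def submodular_on_def by (simp add: zero_ereal_def)
  show "A \<subseteq> I" if "(A, r) \<in> bounds_of I f" for A r
    using that unfolding bounds_of_def by auto
  fix A r B s assume "(A, r) \<in> bounds_of I f" "(B, s) \<in> bounds_of I f"
  then have A: "A \<subseteq> I" "f A = ereal r" and B: "B \<subseteq> I" "f B = ereal s"
    unfolding bounds_of_def by auto
  have le: "f (A \<union> B) + f (A \<inter> B) \<le> ereal (r + s)"
    using assms(2) A B unfolding submodular_on_def by (metis plus_ereal.simps(1))
  have "f (A \<union> B) \<noteq> -\<infinity>" "f (A \<inter> B) \<noteq> -\<infinity>"
    using assms(3) A B by (auto simp: le_infI1)
  with le obtain r' s' where "f (A \<union> B) = ereal r'" "f (A \<inter> B) = ereal s'"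
    by (cases "f (A \<union> B)"; cases "f (A \<inter> B)") auto
  with le show "\<exists>r' s'. (A \<union> B, r') \<in> bounds_of I f \<and> (A \<inter> B, s') \<in> bounds_of I f \<and> r' + s' \<le> r + s"
    using A B unfolding bounds_of_def by auto
qed

lemma ext_base_polyhedron_eq_base_of:
  assumes "\<forall>A\<subseteq>I. f A \<noteq> -\<infinity>" "f I = ereal t"
  shows "ext_base_polyhedron I f = base_of I (bounds_of I f) t"
proof -
  have "(\<forall>A\<subseteq>I. ereal (sum x A) \<le> f A) \<longleftrightarrow> (\<forall>A r. (A, r) \<in> bounds_of I f \<longrightarrow> sum x A \<le> r)" for x
  proof
    assume "\<forall>A r. (A, r) \<in> bounds_of I f \<longrightarrow> sum x A \<le> r"
    then have "ereal (sum x A) \<le> f A" if "A \<subseteq> I" for A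
      using that assms(1) unfolding bounds_of_def by (cases "f A") auto
    then show "\<forall>A\<subseteq>I. ereal (sum x A) \<le> f A" by blast
  qed (auto simp: bounds_of_def)
  then show ?thesis using assms(2) unfolding ext_base_polyhedron_def base_of_def by auto
qed

lemma submodular_on_ereal:
  assumes "submodular_on I p"
  shows "submodular_on I (\<lambda>A. ereal (p A))"
  using assms unfolding submodular_on_def by (simp add: zero_ereal_def)

lemma base_polyhedron_eq_base_of:
  "base_polyhedron I p = base_of I (bounds_of I (\<lambda>A. ereal (p A))) (p I)"
  unfolding base_polyhedron_def base_of_def bounds_of_def by auto

lemma base_polyhedron_eq_ext_base_polyhedron:
  "base_polyhedron I p = ext_base_polyhedron I (\<lambda>A. ereal (p A))"
  unfolding base_polyhedron_def ext_base_polyhedron_def by auto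

lemma gen_permutohedron_imp_ext:
  assumes "gen_permutohedron I P"
  shows "ext_gen_permutohedron I P"
proof -
  obtain p where p: "submodular_on I p" "P = base_polyhedron I p"
    using assms unfolding gen_permutohedron_def by auto
  show ?thesis unfolding ext_gen_permutohedron_def
    using submodular_on_ereal[OF p(1)] p(2) base_polyhedron_eq_ext_base_polyhedron[of I p]
    by (intro exI[of _ "\<lambda>A. ereal (p A)"]) auto
qed

text \<open>
  A bound \<open>x(I) \<ge> t\<close> among the lower bounds forces \<open>x(I) = t\<close>, so the sandwich theorem produces
  bases.
\<close>

lemma base_of_above:
  assumes "finite I" "submodular_bounds I U" "submodular_bounds I L"
    and "\<And>A r s. (A, r) \<in> U \<Longrightarrow> (A, s) \<in> L \<Longrightarrow> 0 \<le> r + s"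
    and "(I, t) \<in> U" "(I, - t) \<in> L"
  shows "\<exists>x\<in>base_of I U t. \<forall>A s. (A, s) \<in> L \<longrightarrow> - s \<le> sum x A"
proof -
  obtain x where x: "x \<in> coord_space I" "\<forall>A r. (A, r) \<in> U \<longrightarrow> sum x A \<le> r"
    "\<forall>A s. (A, s) \<in> L \<longrightarrow> - s \<le> sum x A"
    using submodular_sandwich[OF assms(1-3)] assms(4) by blast
  have "sum x I = t" using x(2,3) assms(5,6) by force
  with x show ?thesis unfolding base_of_def by blast
qed

text \<open>
  The values of \<open>p\<close> on a chain are also a supermodular system, since the union and the
  intersection of two members are again these members.
\<close>

lemma base_polyhedron_tight_on_chain:
  assumes "finite I" "submodular_on I p"
    and sub: "\<And>A. A \<in> \<C> \<Longrightarrow> A \<subseteq> I" and chain: "\<And>A B. A \<in> \<C> \<Longrightarrow> B \<in> \<C> \<Longrightarrow> A \<subseteq> B \<or> B \<subseteq> A"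
  shows "\<exists>x\<in>base_polyhedron I p. \<forall>A\<in>\<C>. sum x A = p A"
proof -
  let ?U = "bounds_of I (\<lambda>A. ereal (p A))"
  define L where "L = (\<lambda>A. (A, - p A)) ` insert {} (insert I \<C>)"
  have p0: "p {} = 0" using assms(2) unfolding submodular_on_def by simp
  have "\<C> \<subseteq> Pow I" using sub by blast
  then have "finite \<C>" using assms(1) by (simp add: finite_subset)
  have nested: "A \<subseteq> B \<or> B \<subseteq> A" if "A \<in> insert {} (insert I \<C>)" "B \<in> insert {} (insert I \<C>)" for A B
    using that sub[of A] sub[of B] chain[of A B] by auto
  have L: "submodular_bounds I L"
  proof (rule submodular_bounds_chain)
    show "finite L" unfolding L_def using \<open>finite \<C>\<close> by simp
    show "({}, 0) \<in> L" unfolding L_def using p0 by simp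
    show "A \<subseteq> I" if "(A, r) \<in> L" for A r using that sub unfolding L_def by auto
    show "A \<subseteq> B \<or> B \<subseteq> A" if "(A, r) \<in> L" "(B, s) \<in> L" for A r B s
    proof (rule nested)
      show "A \<in> insert {} (insert I \<C>)" "B \<in> insert {} (insert I \<C>)"
        using that unfolding L_def by auto
    qed
  qed
  have "\<exists>x\<in>base_of I ?U (p I). \<forall>A s. (A, s) \<in> L \<longrightarrow> - s \<le> sum x A"
  proof (rule base_of_above[OF assms(1) _ L])
    show "submodular_bounds I ?U"
      using submodular_bounds_of[OF assms(1) submodular_on_ereal[OF assms(2)]] by simp
    show "0 \<le> r + s" if "(A, r) \<in> ?U" "(A, s) \<in> L" for A r s
      using that unfolding bounds_of_def L_def by auto
  qed (auto simp: bounds_of_def L_def)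
  then obtain x where x: "x \<in> base_polyhedron I p" "\<forall>A s. (A, s) \<in> L \<longrightarrow> - s \<le> sum x A"
    unfolding base_polyhedron_eq_base_of by blast
  have "sum x A = p A" if "A \<in> \<C>" for A
  proof -
    have "- (- p A) \<le> sum x A" using x(2) that unfolding L_def by blast
    moreover have "sum x A \<le> p A" using x(1) sub[OF that] unfolding base_polyhedron_def by auto
    ultimately show ?thesis by simp
  qed
  with x(1) show ?thesis by blast
qed

corollary base_polyhedron_nonempty:
  assumes "finite I" "submodular_on I p"
  shows "\<exists>x. x \<in> base_polyhedron I p"
  using base_polyhedron_tight_on_chain[OF assms, of "{}"] by blast

corollary base_polyhedron_attains:
  assumes "finite I" "submodular_on I p" "A \<subseteq> I"
  shows "\<exists>x\<in>base_polyhedron I p. sum x A = p A"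
  using base_polyhedron_tight_on_chain[OF assms(1,2), of "{A}"] assms(3) by auto

lemma base_polyhedronD:
  assumes "x \<in> base_polyhedron I p"
  shows "x \<in> coord_space I" "A \<subseteq> I \<Longrightarrow> sum x A \<le> p A" "sum x I = p I"
  using assms unfolding base_polyhedron_def by auto

lemma base_polyhedronI:
  assumes "x \<in> coord_space I" "\<And>A. A \<subseteq> I \<Longrightarrow> sum x A \<le> p A" "sum x I = p I"
  shows "x \<in> base_polyhedron I p"
  using assms unfolding base_polyhedron_def by auto

lemma submodular_onD:
  assumes "submodular_on I p"
  shows "p {} = 0" "A \<subseteq> I \<Longrightarrow> B \<subseteq> I \<Longrightarrow> p (A \<union> B) + p (A \<inter> B) \<le> p A + p B"
  using assms unfolding submodular_on_def by auto

corollary base_polyhedron_le: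
  assumes "finite I" "submodular_on I p" "base_polyhedron I p \<subseteq> base_polyhedron I q" "A \<subseteq> I"
  shows "p A \<le> q A"
proof -
  obtain x where "x \<in> base_polyhedron I p" "sum x A = p A"
    using base_polyhedron_attains[OF assms(1,2,4)] by blast
  then show ?thesis using base_polyhedronD(2)[of x I q A] assms(3,4) by auto
qed

corollary base_polyhedron_inject:
  assumes "finite I" "submodular_on I p" "submodular_on I q"
    and "base_polyhedron I p = base_polyhedron I q" "A \<subseteq> I"
  shows "p A = q A"
  using base_polyhedron_le[of I p q A] base_polyhedron_le[of I q p A] assms by auto

section \<open>Vertices and compliance\<close>

lemma abel_summation:
  fixes f D :: "nat \<Rightarrow> real"
  assumes "D 0 = 0"
  shows "(\<Sum>k = 1..m. f k * (D k - D (k - 1))) = f m * D m + (\<Sum>k = 1..<m. (f k - f (Suc k)) * D k)"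
proof (induction m)
  case 0
  then show ?case using assms by simp
next
  case (Suc m)
  show ?case
  proof (cases "m = 0")
    case True then show ?thesis using assms by simp
  next
    case False
    then have "(\<Sum>k = 1..<Suc m. (f k - f (Suc k)) * D k)
        = (\<Sum>k = 1..<m. (f k - f (Suc k)) * D k) + (f m - f (Suc m)) * D m"
      by simp
    then show ?thesis using Suc.IH by (simp add: algebra_simps)
  qed
qed

lemma prefix_Suc:
  fixes \<sigma> :: "nat \<Rightarrow> 'i"
  assumes "bij_betw \<sigma> {1..n} I" "k \<in> {1..n}"
  shows "\<sigma> ` {1..k} = insert (\<sigma> k) (\<sigma> ` {1..k - 1})" "\<sigma> k \<notin> \<sigma> ` {1..k - 1}"
proof -
  have "{1..k} = insert k {1..k - 1}" using assms(2) by auto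
  then show "\<sigma> ` {1..k} = insert (\<sigma> k) (\<sigma> ` {1..k - 1})" by auto
  have "inj_on \<sigma> {1..n}" using assms(1) by (simp add: bij_betw_def)
  then show "\<sigma> k \<notin> \<sigma> ` {1..k - 1}"
    using assms(2) by (auto dest!: inj_onD)
qed

text \<open>
  By Abel summation the difference of the two objective values is a sum of gaps of \<open>c\<close>
  times slacks of \<open>y\<close> on the prefixes, and \<open>y\<close> differs from \<open>x\<close> only if some slack is positive.
\<close>

lemma tight_on_prefixes_unique_max:
  assumes "finite I" and \<sigma>: "bij_betw \<sigma> {1..card I} I"
    and x: "x \<in> base_polyhedron I p"
    and tight: "\<And>k. k \<le> card I \<Longrightarrow> sum x (\<sigma> ` {1..k}) = p (\<sigma> ` {1..k})"
    and dec: "\<And>k l. k \<in> {1..card I} \<Longrightarrow> l \<in> {1..card I} \<Longrightarrow> k < l \<Longrightarrow> c (\<sigma> k) > (c (\<sigma> l) :: real)"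
    and y: "y \<in> base_polyhedron I p" "y \<noteq> x"
  shows "(\<Sum>i\<in>I. c i * y i) < (\<Sum>i\<in>I. c i * x i)"
proof -
  let ?n = "card I"
  have im: "\<sigma> ` {1..?n} = I" using \<sigma> by (auto simp: bij_betw_def)
  have sub: "\<sigma> ` {1..k} \<subseteq> I" if "k \<le> ?n" for k using that im by force
  define D where "D k = sum x (\<sigma> ` {1..k}) - sum y (\<sigma> ` {1..k})" for k
  have D0: "D 0 = 0" unfolding D_def by simp
  have Dn: "D ?n = 0" unfolding D_def im using x y(1) by (simp add: base_polyhedronD)
  have nonneg: "0 \<le> D k" if "k \<le> ?n" for k
    using tight[OF that] base_polyhedronD(2)[OF y(1) sub[OF that]] unfolding D_def by simp
  have step: "x (\<sigma> k) - y (\<sigma> k) = D k - D (k - 1)" if "k \<in> {1..?n}" for k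
    using prefix_Suc[OF \<sigma> that] unfolding D_def by simp
  have "(\<Sum>i\<in>I. c i * x i) - (\<Sum>i\<in>I. c i * y i) = (\<Sum>i\<in>I. c i * (x i - y i))"
    by (simp add: sum_subtractf right_diff_distrib)
  also have "\<dots> = (\<Sum>k = 1..?n. c (\<sigma> k) * (x (\<sigma> k) - y (\<sigma> k)))"
    using sum.reindex_bij_betw[OF \<sigma>, of "\<lambda>i. c i * (x i - y i)"] by simp
  also have "\<dots> = (\<Sum>k = 1..?n. c (\<sigma> k) * (D k - D (k - 1)))"
    using step by (intro sum.cong) auto
  also have "\<dots> = (\<Sum>k = 1..<?n. (c (\<sigma> k) - c (\<sigma> (Suc k))) * D k)"
    using abel_summation[where D = D and f = "\<lambda>k. c (\<sigma> k)" and m = ?n, OF D0] Dn by simp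
  also have "\<dots> > 0"
  proof -
    have "\<exists>k\<in>{1..<?n}. D k \<noteq> 0"
    proof (rule ccontr)
      assume "\<not> ?thesis"
      then have inner: "D k = 0" if "k \<in> {1..<?n}" for k using that by simp
      have D: "D k = 0" if "k \<le> ?n" for k
      proof (cases "k \<in> {1..<?n}")
        case True
        then show ?thesis by (rule inner)
      next
        case False
        then have "k = 0 \<or> k = ?n" using that by (simp add: not_less) arith
        then show ?thesis using D0 Dn by (elim disjE) simp_all
      qed
      have "x i = y i" if "i \<in> I" for i
      proof -
        obtain k where "k \<in> {1..?n}" "i = \<sigma> k" using \<open>i \<in> I\<close> im by blast
        then show ?thesis using step[of k] D[of k] D[of "k - 1"] by auto
      qed
      moreover have "x i = y i" if "i \<notin> I" for i
        using that x y(1) by (auto simp: base_polyhedron_def coord_space_def)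
      ultimately have "y = x" by (intro ext) metis
      then show False using y(2) by simp
    qed
    then obtain k where k: "k \<in> {1..<?n}" "D k \<noteq> 0" by blast
    have gap: "c (\<sigma> l) - c (\<sigma> (Suc l)) > 0" if "l \<in> {1..<?n}" for l
      using dec[of l "Suc l"] that by simp
    show ?thesis
    proof (rule sum_pos2[OF _ k(1)])
      show "0 < (c (\<sigma> k) - c (\<sigma> (Suc k))) * D k"
        using gap[OF k(1)] nonneg[of k] k by simp
      show "0 \<le> (c (\<sigma> l) - c (\<sigma> (Suc l))) * D l" if "l \<in> {1..<?n}" for l
        using gap[OF that] nonneg[of l] that by simp
    qed simp
  qed
  finally show ?thesis by simp
qed

lemma perm_vertex_tight:
  assumes fin: "finite I" and p: "submodular_on I p" and \<sigma>: "bij_betw \<sigma> {1..card I} I"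
  shows "perm_vertex I (base_polyhedron I p) \<sigma> \<in> base_polyhedron I p" (is ?in)
    and "k \<le> card I \<Longrightarrow>
      sum (perm_vertex I (base_polyhedron I p) \<sigma>) (\<sigma> ` {1..k}) = p (\<sigma> ` {1..k})"
proof -
  let ?n = "card I" and ?P = "base_polyhedron I p"
  have inj: "inj_on \<sigma> {1..?n}" and im: "\<sigma> ` {1..?n} = I" using \<sigma> by (auto simp: bij_betw_def)
  define \<C> where "\<C> = (\<lambda>k. \<sigma> ` {1..k}) ` {..?n}"
  have "\<exists>x\<in>?P. \<forall>A\<in>\<C>. sum x A = p A"
  proof (rule base_polyhedron_tight_on_chain[OF fin p, of \<C>])
    show "A \<subseteq> I" if "A \<in> \<C>" for A using that im unfolding \<C>_def by force
    show "A \<subseteq> B \<or> B \<subseteq> A" if AB: "A \<in> \<C>" "B \<in> \<C>" for A B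
    proof -
      obtain k l where "A = \<sigma> ` {1..k}" "B = \<sigma> ` {1..l}" using AB unfolding \<C>_def by auto
      then show ?thesis using linear[of k l] by (auto intro!: image_mono)
    qed
  qed
  then obtain x where x: "x \<in> ?P" "\<And>A. A \<in> \<C> \<Longrightarrow> sum x A = p A" by blast
  have tight: "sum x (\<sigma> ` {1..k}) = p (\<sigma> ` {1..k})" if "k \<le> ?n" for k
    using x(2) that unfolding \<C>_def by auto
  let ?dec = "\<lambda>c :: 'a \<Rightarrow> real. \<forall>k\<in>{1..?n}. \<forall>l\<in>{1..?n}. k < l \<longrightarrow> c (\<sigma> k) > c (\<sigma> l)"
  let ?max = "\<lambda>x. \<forall>c. ?dec c \<longrightarrow> x \<in> ?P \<and> (\<forall>y\<in>?P. y \<noteq> x \<longrightarrow> (\<Sum>i\<in>I. c i * y i) < (\<Sum>i\<in>I. c i * x i))"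
  have "?max x"
    using x(1) tight_on_prefixes_unique_max[OF fin \<sigma> x(1) tight] by auto
  moreover have "z = x" if z: "?max z" for z
  proof -
    define c where "c i = - real (the_inv_into {1..?n} \<sigma> i)" for i
    have "?dec c" unfolding c_def using the_inv_into_f_f[OF inj] by simp
    then have "z \<in> ?P" "\<forall>y\<in>?P. y \<noteq> z \<longrightarrow> (\<Sum>i\<in>I. c i * y i) < (\<Sum>i\<in>I. c i * z i)"
      "\<forall>y\<in>?P. y \<noteq> x \<longrightarrow> (\<Sum>i\<in>I. c i * y i) < (\<Sum>i\<in>I. c i * x i)"
      using z \<open>?max x\<close> by blast+
    then show ?thesis using x(1) by (metis order_less_asym)
  qed
  ultimately have "perm_vertex I ?P \<sigma> = x" unfolding perm_vertex_def by (rule the_equality)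
  then show ?in "k \<le> card I \<Longrightarrow> sum (perm_vertex I ?P \<sigma>) (\<sigma> ` {1..k}) = p (\<sigma> ` {1..k})"
    using x(1) tight by auto
qed

lemma perm_vertex_coordinate:
  assumes "finite I" "submodular_on I p" and \<sigma>: "bij_betw \<sigma> {1..card I} I" and k: "k \<in> {1..card I}"
  shows "perm_vertex I (base_polyhedron I p) \<sigma> (\<sigma> k) = p (\<sigma> ` {1..k}) - p (\<sigma> ` {1..k - 1})"
proof -
  have "k \<le> card I" "k - 1 \<le> card I" using k by auto
  then show ?thesis
    using perm_vertex_tight(2)[OF assms(1-3), of k] perm_vertex_tight(2)[OF assms(1-3), of "k - 1"]
      prefix_Suc[OF \<sigma> k] by simp
qed

lemma exists_enumeration_through:
  assumes "finite I" "X \<subseteq> Y" "Y \<subseteq> I"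
  obtains \<sigma> :: "nat \<Rightarrow> 'i" where "bij_betw \<sigma> {1..card I} I"
    "\<sigma> ` {1..card X} = X" "\<sigma> ` {1..card Y} = Y"
proof -
  have fin: "finite X" "finite (Y - X)" "finite (I - Y)" using assms by (auto intro: finite_subset)
  obtain xs where xs: "set xs = X" "distinct xs" using finite_distinct_list[OF fin(1)] by blast
  obtain ys where ys: "set ys = Y - X" "distinct ys" using finite_distinct_list[OF fin(2)] by blast
  obtain zs where zs: "set zs = I - Y" "distinct zs" using finite_distinct_list[OF fin(3)] by blast
  define l where "l = xs @ ys @ zs"
  define \<sigma> where "\<sigma> k = l ! (k - 1)" for k
  have l: "distinct l" "set l = I" "length l = card I"
  proof -
    show "distinct l" "set l = I" unfolding l_def using xs ys zs assms by auto
    then show "length l = card I" using distinct_card by fastforce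
  qed
  have prefix: "\<sigma> ` {1..k} = set (take k l)" if "k \<le> length l" for k
  proof -
    have "\<sigma> ` {1..k} = (!) l ` {0..<k}"
      unfolding \<sigma>_def image_Suc_atLeastLessThan[symmetric, of 0 k]
      by (force simp: image_iff Bex_def gr0_conv_Suc Suc_le_eq)
    then show ?thesis using nth_image[OF that] by simp
  qed
  have lens: "length xs = card X" "length (xs @ ys) = card Y"
    using distinct_card[of xs] distinct_card[of "xs @ ys"] xs ys assms(2)
    by (auto simp: Un_absorb1 Un_Diff_cancel)
  have "take (card X) l = xs" "take (card Y) l = xs @ ys"
    unfolding l_def lens[symmetric] by simp_all
  moreover have "card X \<le> length l" "card Y \<le> length l"
    unfolding l_def lens[symmetric] by simp_all
  ultimately have "\<sigma> ` {1..card X} = X" "\<sigma> ` {1..card Y} = Y"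
    using prefix xs ys assms(2) by auto
  moreover have "\<sigma> ` {1..card I} = I" using prefix[of "card I"] l by simp
  then have "bij_betw \<sigma> {1..card I} I"
    by (simp add: bij_betw_def eq_card_imp_inj_on)
  ultimately show ?thesis using that by blast
qed

definition compliant :: "'i set \<Rightarrow> ('i set \<Rightarrow> real) \<Rightarrow> ('i set \<Rightarrow> real) \<Rightarrow> bool" where
  "compliant I p q \<longleftrightarrow> (\<forall>X Y. X \<subseteq> Y \<longrightarrow> Y \<subseteq> I \<longrightarrow> q Y - q X \<le> p Y - p X)"

lemma compliantD:
  assumes "compliant I p q" "X \<subseteq> Y" "Y \<subseteq> I"
  shows "q Y - q X \<le> p Y - p X"
  using assms unfolding compliant_def by blast

text \<open>
  The increments of \<open>p\<close> along \<open>X \<subseteq> Y\<close> are sums of coordinates over \<open>Y - X\<close> of a vertex whose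
  enumeration runs through both \<open>X\<close> and \<open>Y\<close>.
\<close>

lemma compliant_iff_vertices:
  assumes "finite I" "submodular_on I p" "submodular_on I q"
  shows "compliant I p q \<longleftrightarrow> (\<forall>\<sigma>. bij_betw \<sigma> {1..card I} I \<longrightarrow>
    (\<forall>i\<in>I. perm_vertex I (base_polyhedron I p) \<sigma> i \<ge> perm_vertex I (base_polyhedron I q) \<sigma> i))"
    (is "_ \<longleftrightarrow> (\<forall>\<sigma>. _ \<longrightarrow> (\<forall>i\<in>I. ?x \<sigma> i \<ge> ?y \<sigma> i))")
proof (intro iffI allI impI ballI)
  fix \<sigma> i assume c: "compliant I p q" and \<sigma>: "bij_betw \<sigma> {1..card I} I" and "i \<in> I"
  then obtain k where k: "k \<in> {1..card I}" "i = \<sigma> k" by (metis bij_betw_def imageE)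
  have "\<sigma> ` {1..k - 1} \<subseteq> \<sigma> ` {1..k}" "\<sigma> ` {1..k} \<subseteq> I"
    using k(1) \<sigma> by (auto simp: bij_betw_def)
  from compliantD[OF c this] show "?x \<sigma> i \<ge> ?y \<sigma> i"
    using perm_vertex_coordinate[OF assms(1,2) \<sigma> k(1)] perm_vertex_coordinate[OF assms(1,3) \<sigma> k(1)]
    by (simp add: k(2))
next
  assume v: "\<forall>\<sigma>. bij_betw \<sigma> {1..card I} I \<longrightarrow> (\<forall>i\<in>I. ?x \<sigma> i \<ge> ?y \<sigma> i)"
  show "compliant I p q" unfolding compliant_def
  proof (intro allI impI)
    fix X Y assume XY: "X \<subseteq> Y" "Y \<subseteq> I"
    obtain \<sigma> where \<sigma>: "bij_betw \<sigma> {1..card I} I" "\<sigma> ` {1..card X} = X" "\<sigma> ` {1..card Y} = Y"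
      by (rule exists_enumeration_through[OF assms(1) XY])
    have card: "card X \<le> card I" "card Y \<le> card I" "finite Y"
      using XY assms(1) by (auto intro: card_mono finite_subset)
    have diff: "sum f Y - sum f X = sum f (Y - X)" for f :: "'a \<Rightarrow> real"
      by (rule sum_diff[OF card(3) XY(1), symmetric])
    have "q Y - q X = sum (?y \<sigma>) (Y - X)"
      using perm_vertex_tight(2)[OF assms(1,3) \<sigma>(1) card(1)]
        perm_vertex_tight(2)[OF assms(1,3) \<sigma>(1) card(2)] unfolding \<sigma>(2,3) by (simp flip: diff)
    also have "\<dots> \<le> sum (?x \<sigma>) (Y - X)"
      using v \<sigma>(1) XY by (intro sum_mono) auto
    also have "\<dots> = p Y - p X"
      using perm_vertex_tight(2)[OF assms(1,2) \<sigma>(1) card(1)]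
        perm_vertex_tight(2)[OF assms(1,2) \<sigma>(1) card(2)] unfolding \<sigma>(2,3) by (simp flip: diff)
    finally show "q Y - q X \<le> p Y - p X" .
  qed
qed

section \<open>The exchange property and contractions\<close>

lemma tight_sets_lattice:
  assumes "finite I" "submodular_on I p" and x: "x \<in> base_polyhedron I p"
    and "A \<subseteq> I" "B \<subseteq> I" "sum x A = p A" "sum x B = p B"
  shows "sum x (A \<union> B) = p (A \<union> B)" "sum x (A \<inter> B) = p (A \<inter> B)"
proof -
  have "finite A" "finite B" using assms by (auto intro: finite_subset)
  then have "sum x (A \<union> B) + sum x (A \<inter> B) = sum x A + sum x B" by (rule sum.union_inter)
  moreover have "sum x (A \<union> B) \<le> p (A \<union> B)" "sum x (A \<inter> B) \<le> p (A \<inter> B)"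
    using assms(4,5) by (auto intro!: base_polyhedronD(2)[OF x])
  moreover have "p (A \<union> B) + p (A \<inter> B) \<le> p A + p B"
    using assms(2,4,5) by (rule submodular_onD)
  ultimately show "sum x (A \<union> B) = p (A \<union> B)" "sum x (A \<inter> B) = p (A \<inter> B)"
    using assms(6,7) by linarith+
qed

lemma sum_unit_vec: "finite A \<Longrightarrow> sum (unit_vec i) A = (if i \<in> A then 1 else 0)"
  unfolding unit_vec_def by simp

lemma sum_exchange:
  assumes "finite A"
  shows "(\<Sum>k\<in>A. x k - \<rho> * (unit_vec i k - unit_vec j k)) =
    sum x A - \<rho> * ((if i \<in> A then 1 else 0) - (if j \<in> A then 1 else 0))"
  using assms by (simp add: sum_subtractf sum_unit_vec flip: sum_distrib_left)

lemma finite_family_min: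
  fixes w :: "'i set \<Rightarrow> real"
  assumes "finite F" "\<And>A. A \<in> F \<Longrightarrow> 0 < w A"
  shows "\<exists>\<epsilon>>0. \<forall>A\<in>F. \<epsilon> \<le> w A"
  using assms by (intro exI[of _ "Min (insert 1 (w ` F))"]) auto

text \<open>
  Sets that are not tight have a common positive slack, so only tight sets can obstruct a
  small step.
\<close>

lemma exchange_feasible:
  assumes "finite I" and x: "x \<in> base_polyhedron I p" and ij: "i \<in> I" "j \<in> I"
    and tight: "\<And>A. A \<subseteq> I \<Longrightarrow> j \<in> A \<Longrightarrow> sum x A = p A \<Longrightarrow> i \<in> A"
  shows "\<exists>\<rho>0>0. \<forall>\<rho>\<in>{0..\<rho>0}. (\<lambda>k. x k - \<rho> * (unit_vec i k - unit_vec j k)) \<in> base_polyhedron I p"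
proof -
  let ?F = "{A. A \<subseteq> I \<and> sum x A \<noteq> p A}"
  have "finite ?F" using assms(1) by (auto intro: finite_subset[of _ "Pow I"])
  moreover have "0 < p A - sum x A" if "A \<in> ?F" for A
    using that base_polyhedronD(2)[OF x, of A] by auto
  ultimately have "\<exists>\<epsilon>>0. \<forall>A\<in>?F. \<epsilon> \<le> p A - sum x A" by (rule finite_family_min)
  then obtain \<epsilon> where \<epsilon>: "0 < \<epsilon>" "\<And>A. A \<in> ?F \<Longrightarrow> \<epsilon> \<le> p A - sum x A" by blast
  have "(\<lambda>k. x k - \<rho> * (unit_vec i k - unit_vec j k)) \<in> base_polyhedron I p"
    if \<rho>: "\<rho> \<in> {0..\<epsilon>}" for \<rho>
  proof (rule base_polyhedronI)
    show "(\<lambda>k. x k - \<rho> * (unit_vec i k - unit_vec j k)) \<in> coord_space I"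
      using base_polyhedronD(1)[OF x] ij unfolding coord_space_def unit_vec_def by auto
    show "(\<Sum>k\<in>I. x k - \<rho> * (unit_vec i k - unit_vec j k)) = p I"
      using sum_exchange[OF assms(1)] ij base_polyhedronD(3)[OF x] by simp
    fix A assume A: "A \<subseteq> I"
    show "(\<Sum>k\<in>A. x k - \<rho> * (unit_vec i k - unit_vec j k)) \<le> p A"
    proof (cases "sum x A = p A")
      case True
      then show ?thesis
        using sum_exchange[OF finite_subset[OF A assms(1)]] tight[OF A] \<rho> by auto
    next
      case False
      then show ?thesis
        using sum_exchange[OF finite_subset[OF A assms(1)]] \<epsilon>(2)[of A] A \<rho> by auto
    qed
  qed
  with \<epsilon>(1) show ?thesis by blast
qed

text \<open>
  An element \<open>j\<close> is admissible for \<open>x\<close> if it lies outside the greatest \<open>x\<close>-tight set \<open>S\<close>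
  avoiding \<open>i\<close>, and for \<open>y\<close> if it lies in the least \<open>y\<close>-tight set \<open>T\<close> containing \<open>i\<close>. These sets
  exist because tight sets form a lattice. If \<open>x j \<ge> y j\<close> held on all of \<open>T - S\<close>, the strict
  inequality at \<open>i\<close> would contradict compliance along \<open>S \<subseteq> S \<union> T\<close>.
\<close>

lemma compliant_imp_exchange:
  assumes fin: "finite I" and p: "submodular_on I p" and q: "submodular_on I q"
    and c: "compliant I p q"
    and x: "x \<in> base_polyhedron I q" and y: "y \<in> base_polyhedron I p" and i: "i \<in> supp_plus x y"
  shows "\<exists>j\<in>supp_minus x y. \<exists>\<rho>0>0. \<forall>\<rho>\<in>{0..\<rho>0}.
      (\<lambda>k. x k - \<rho> * (unit_vec i k - unit_vec j k)) \<in> base_polyhedron I q \<and>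
      (\<lambda>k. y k + \<rho> * (unit_vec i k - unit_vec j k)) \<in> base_polyhedron I p"
proof -
  have outside: "x k = 0" "y k = 0" if "k \<notin> I" for k
    using that base_polyhedronD(1)[OF x] base_polyhedronD(1)[OF y] by (auto simp: coord_space_def)
  have iI: "i \<in> I" using i outside unfolding supp_plus_def by force
  define TY where "TY = {A. A \<subseteq> I \<and> i \<in> A \<and> sum y A = p A}"
  define TX where "TX = {A. A \<subseteq> I \<and> i \<notin> A \<and> sum x A = q A}"
  have fins: "finite TY" "finite TX"
    using fin unfolding TY_def TX_def by (auto intro: finite_subset[of _ "Pow I"])
  have "I \<in> TY" using iI base_polyhedronD(3)[OF y] unfolding TY_def by simp
  then obtain T where T: "T \<in> TY" "\<And>A. A \<in> TY \<Longrightarrow> A \<subseteq> T \<Longrightarrow> T = A"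
    using finite_has_minimal[OF fins(1)] by blast
  have "{} \<in> TX" using submodular_onD(1)[OF q] unfolding TX_def by simp
  then obtain S where S: "S \<in> TX" "\<And>A. A \<in> TX \<Longrightarrow> S \<subseteq> A \<Longrightarrow> S = A"
    using finite_has_maximal[OF fins(2)] by blast
  have T_least: "T \<subseteq> A" if "A \<in> TY" for A
    using T(2)[of "T \<inter> A"] T(1) that tight_sets_lattice(2)[OF fin p y, of T A]
    unfolding TY_def by auto
  have S_greatest: "A \<subseteq> S" if "A \<in> TX" for A
    using S(2)[of "S \<union> A"] S(1) that tight_sets_lattice(1)[OF fin q x, of S A]
    unfolding TX_def by auto
  have sub: "S \<subseteq> I" "T \<subseteq> I" "i \<in> T" "i \<notin> S" using S(1) T(1) unfolding TX_def TY_def by auto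
  have finST: "finite S" "finite T" using sub fin by (auto intro: finite_subset)
  have "\<exists>j\<in>T - S. x j < y j"
  proof (rule ccontr)
    assume "\<not> ?thesis"
    then have "\<And>j. j \<in> T - S \<Longrightarrow> y j \<le> x j" by force
    moreover have "y i < x i" using i unfolding supp_plus_def by simp
    ultimately have less: "sum y (T - S) < sum x (T - S)"
      using sub finST by (intro sum_strict_mono_ex1) auto
    have "sum x (T - S) = sum x (S \<union> T) - sum x S"
      using sum.union_disjoint[of S "T - S" x] finST by simp
    also have "\<dots> \<le> q (S \<union> T) - q S"
      using S(1) sub base_polyhedronD(2)[OF x, of "S \<union> T"] unfolding TX_def by auto
    also have "\<dots> \<le> p (S \<union> T) - p S" using sub by (intro compliantD[OF c]) auto
    also have "\<dots> \<le> p T - p (S \<inter> T)" using submodular_onD(2)[OF p sub(1,2)] by simp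
    also have "\<dots> \<le> sum y T - sum y (S \<inter> T)"
      using T(1) sub base_polyhedronD(2)[OF y, of "S \<inter> T"] unfolding TY_def by auto
    also have "\<dots> = sum y (T - S)"
      using sum.Int_Diff[OF finST(2), of y S] by (simp add: Int_commute)
    finally show False using less by simp
  qed
  then obtain j where j: "j \<in> T" "j \<notin> S" "x j < y j" by blast
  have jI: "j \<in> I" using j sub by blast
  have "\<exists>\<rho>0>0. \<forall>\<rho>\<in>{0..\<rho>0}. (\<lambda>k. x k - \<rho> * (unit_vec i k - unit_vec j k)) \<in> base_polyhedron I q"
  proof (rule exchange_feasible[OF fin x iI jI])
    show "i \<in> A" if "A \<subseteq> I" "j \<in> A" "sum x A = q A" for A
      using that S_greatest[of A] j unfolding TX_def by auto
  qed
  then obtain \<rho>x where \<rho>x: "\<rho>x > 0"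
    "\<And>\<rho>. \<rho> \<in> {0..\<rho>x} \<Longrightarrow> (\<lambda>k. x k - \<rho> * (unit_vec i k - unit_vec j k)) \<in> base_polyhedron I q" by blast
  have "\<exists>\<rho>0>0. \<forall>\<rho>\<in>{0..\<rho>0}. (\<lambda>k. y k - \<rho> * (unit_vec j k - unit_vec i k)) \<in> base_polyhedron I p"
  proof (rule exchange_feasible[OF fin y jI iI])
    show "j \<in> A" if "A \<subseteq> I" "i \<in> A" "sum y A = p A" for A
      using that T_least[of A] j unfolding TY_def by auto
  qed
  then obtain \<rho>y where \<rho>y: "\<rho>y > 0"
    "\<And>\<rho>. \<rho> \<in> {0..\<rho>y} \<Longrightarrow> (\<lambda>k. y k - \<rho> * (unit_vec j k - unit_vec i k)) \<in> base_polyhedron I p" by blast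
  have flip: "y k + \<rho> * (unit_vec i k - unit_vec j k) = y k - \<rho> * (unit_vec j k - unit_vec i k)" for k \<rho>
    by (simp add: algebra_simps)
  show ?thesis
  proof (intro bexI exI conjI ballI)
    show "j \<in> supp_minus x y" using j(3) unfolding supp_minus_def supp_plus_def by simp
    show "0 < min \<rho>x \<rho>y" using \<rho>x(1) \<rho>y(1) by simp
    fix \<rho> assume "\<rho> \<in> {0..min \<rho>x \<rho>y}"
    then show "(\<lambda>k. x k - \<rho> * (unit_vec i k - unit_vec j k)) \<in> base_polyhedron I q"
      "(\<lambda>k. y k + \<rho> * (unit_vec i k - unit_vec j k)) \<in> base_polyhedron I p"
      using \<rho>x(2) \<rho>y(2) unfolding flip by auto
  qed
qed

text \<open>
  For the vertices of an enumeration, a violation at \<open>i = \<sigma> k\<close> would allow an exchange with some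
  \<open>j\<close>. Tightness of the prefix before \<open>i\<close> at the vertex for \<open>q\<close> excludes \<open>j\<close> from this prefix, and
  tightness of the prefix up to \<open>i\<close> at the vertex for \<open>p\<close> forces \<open>j\<close> into it; only \<open>j = i\<close> is left.
\<close>

lemma exchange_imp_compliant:
  assumes fin: "finite I" and p: "submodular_on I p" and q: "submodular_on I q"
    and ex: "\<forall>x\<in>base_polyhedron I q. \<forall>y\<in>base_polyhedron I p. \<forall>i\<in>supp_plus x y.
      \<exists>j\<in>supp_minus x y. \<exists>\<rho>0>0. \<forall>\<rho>\<in>{0..\<rho>0}.
      (\<lambda>k. x k - \<rho> * (unit_vec i k - unit_vec j k)) \<in> base_polyhedron I q \<and>
      (\<lambda>k. y k + \<rho> * (unit_vec i k - unit_vec j k)) \<in> base_polyhedron I p"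
  shows "compliant I p q"
proof -
  let ?x = "perm_vertex I (base_polyhedron I q)" and ?y = "perm_vertex I (base_polyhedron I p)"
  have "?y \<sigma> i \<ge> ?x \<sigma> i" if \<sigma>: "bij_betw \<sigma> {1..card I} I" and i: "i \<in> I" for \<sigma> i
  proof (rule ccontr)
    assume less: "\<not> ?thesis"
    then have "i \<in> supp_plus (?x \<sigma>) (?y \<sigma>)" unfolding supp_plus_def by simp
    from ex[rule_format, OF perm_vertex_tight(1)[OF fin q \<sigma>] perm_vertex_tight(1)[OF fin p \<sigma>] this]
    obtain j \<rho> where j: "j \<in> supp_minus (?x \<sigma>) (?y \<sigma>)" and "\<rho> > 0"
      and "\<forall>\<rho>'\<in>{0..\<rho>}. (\<lambda>k. ?x \<sigma> k - \<rho>' * (unit_vec i k - unit_vec j k)) \<in> base_polyhedron I q \<and>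
        (\<lambda>k. ?y \<sigma> k + \<rho>' * (unit_vec i k - unit_vec j k)) \<in> base_polyhedron I p"
      by blast
    then have x': "(\<lambda>k. ?x \<sigma> k - \<rho> * (unit_vec i k - unit_vec j k)) \<in> base_polyhedron I q"
      and y': "(\<lambda>k. ?y \<sigma> k + \<rho> * (unit_vec i k - unit_vec j k)) \<in> base_polyhedron I p"
      by auto
    obtain k where k: "k \<in> {1..card I}" "i = \<sigma> k" using i \<sigma> by (metis bij_betw_def imageE)
    let ?S = "\<sigma> ` {1..k}" and ?S' = "\<sigma> ` {1..k - 1}"
    have S: "?S = insert i ?S'" "i \<notin> ?S'" using prefix_Suc[OF \<sigma> k(1)] k(2) by auto
    have sub: "?S \<subseteq> I" using \<sigma> k by (auto simp: bij_betw_def)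
    have le: "k \<le> card I" "k - 1 \<le> card I" using k by auto
    have "j \<notin> ?S'"
      using base_polyhedronD(2)[OF x', of ?S'] sub S perm_vertex_tight(2)[OF fin q \<sigma> le(2)] \<open>\<rho> > 0\<close>
      by (auto simp: sum_exchange split: if_splits)
    moreover have "j \<in> ?S"
    proof (rule ccontr)
      assume "j \<notin> ?S"
      moreover have "i \<in> ?S" using S by simp
      ultimately have "(\<Sum>k\<in>?S. ?y \<sigma> k - (- \<rho>) * (unit_vec i k - unit_vec j k)) = sum (?y \<sigma>) ?S + \<rho>"
        using sum_exchange[of ?S "?y \<sigma>" "- \<rho>" i j] by simp
      then show False
        using base_polyhedronD(2)[OF y' sub] perm_vertex_tight(2)[OF fin p \<sigma> le(1)] \<open>\<rho> > 0\<close> by simp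
    qed
    ultimately have "j = i" using S(1) by auto
    then show False using j less unfolding supp_minus_def supp_plus_def by simp
  qed
  then show ?thesis using compliant_iff_vertices[OF fin p q] by blast
qed

lemma submodular_on_contract_fun:
  assumes "submodular_on I q" "X \<subseteq> I"
  shows "submodular_on (I - X) (contract_fun q X)"
  unfolding submodular_on_def contract_fun_def
proof (intro conjI allI impI)
  fix A B assume AB: "A \<subseteq> I - X" "B \<subseteq> I - X"
  have "q ((A \<union> X) \<union> (B \<union> X)) + q ((A \<union> X) \<inter> (B \<union> X)) \<le> q (A \<union> X) + q (B \<union> X)"
    using AB assms(2) by (intro submodular_onD(2)[OF assms(1)]) auto
  moreover have "(A \<union> X) \<union> (B \<union> X) = A \<union> B \<union> X" "(A \<union> X) \<inter> (B \<union> X) = A \<inter> B \<union> X" by auto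
  ultimately show "q (A \<union> B \<union> X) - q X + (q (A \<inter> B \<union> X) - q X)
      \<le> q (A \<union> X) - q X + (q (B \<union> X) - q X)" by simp
qed simp

text \<open>
  Containment of submodular polyhedra is an inequality between the functions because every
  bound of a contraction is attained.
\<close>

lemma compliant_iff_submodular_polyhedra:
  assumes fin: "finite I" and q: "submodular_on I q"
  shows "compliant I p q \<longleftrightarrow> (\<forall>X\<subseteq>I. submodular_polyhedron (I - X) (contract_fun q X)
           \<subseteq> submodular_polyhedron (I - X) (contract_fun p X))"
proof (intro iffI allI impI)
  fix X assume c: "compliant I p q" and X: "X \<subseteq> I"
  have "contract_fun q X A \<le> contract_fun p X A" if "A \<subseteq> I - X" for A
    using that X unfolding contract_fun_def by (intro compliantD[OF c]) auto
  then show "submodular_polyhedron (I - X) (contract_fun q X)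
           \<subseteq> submodular_polyhedron (I - X) (contract_fun p X)"
    unfolding submodular_polyhedron_def by (auto intro: order_trans)
next
  assume S: "\<forall>X\<subseteq>I. submodular_polyhedron (I - X) (contract_fun q X)
           \<subseteq> submodular_polyhedron (I - X) (contract_fun p X)"
  show "compliant I p q" unfolding compliant_def
  proof (intro allI impI)
    fix X Y assume XY: "X \<subseteq> Y" "Y \<subseteq> I"
    then have X: "X \<subseteq> I" and A: "Y - X \<subseteq> I - X" by auto
    obtain z where z: "z \<in> base_polyhedron (I - X) (contract_fun q X)"
      "sum z (Y - X) = contract_fun q X (Y - X)"
      using base_polyhedron_attains[OF _ submodular_on_contract_fun[OF q X] A] fin by auto
    have "z \<in> submodular_polyhedron (I - X) (contract_fun q X)"
      using base_polyhedronD[OF z(1)] unfolding submodular_polyhedron_def by simp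
    then have "z \<in> submodular_polyhedron (I - X) (contract_fun p X)" using S X by blast
    then have "sum z (Y - X) \<le> contract_fun p X (Y - X)"
      using A unfolding submodular_polyhedron_def by simp
    then show "q Y - q X \<le> p Y - p X"
      using z(2) XY unfolding contract_fun_def by (simp add: Un_absorb2)
  qed
qed

section \<open>Generalized polymatroids and their layers\<close>

lemma sum_complement:
  fixes x :: "'i \<Rightarrow> real"
  assumes "finite I" "A \<subseteq> I"
  shows "sum x (I - A) = sum x I - sum x A"
  using sum_diff[OF assms] .

lemma dual_fun_dual_fun:
  assumes "q {} = 0" "A \<subseteq> I"
  shows "dual_fun I (dual_fun I q) A = q A"
  using assms by (simp add: dual_fun_def double_diff)

lemma submodular_on_dual_fun:
  assumes "supermodular_on I q"
  shows "submodular_on I (dual_fun I q)"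
proof -
  have q: "submodular_on I (\<lambda>A. - q A)" using assms unfolding supermodular_on_def .
  show ?thesis unfolding submodular_on_def dual_fun_def
  proof (intro conjI allI impI)
    fix A B assume "A \<subseteq> I" "B \<subseteq> I"
    then show "q I - q (I - (A \<union> B)) + (q I - q (I - A \<inter> B)) \<le> q I - q (I - A) + (q I - q (I - B))"
      using submodular_onD(2)[OF q, of "I - A" "I - B"] by (simp add: Diff_Un Diff_Int)
  qed simp
qed

lemma supermodular_on_dual_fun:
  assumes "submodular_on I q"
  shows "supermodular_on I (dual_fun I q)"
  unfolding supermodular_on_def submodular_on_def dual_fun_def
proof (intro conjI allI impI)
  fix A B assume "A \<subseteq> I" "B \<subseteq> I"
  then show "- (q I - q (I - (A \<union> B))) + - (q I - q (I - A \<inter> B))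
      \<le> - (q I - q (I - A)) + - (q I - q (I - B))"
    using submodular_onD(2)[OF assms, of "I - A" "I - B"] by (simp add: Diff_Un Diff_Int)
qed simp

text \<open>
  The cross inequality at \<open>(I, A)\<close> and at \<open>(A, I)\<close> is what places both base polyhedra inside
  \<open>G_polyhedron I p q\<close>; the bounds on \<open>x(I)\<close> then make them the extreme layers.
\<close>

lemma paramodular_layers:
  assumes fin: "finite I" and p: "submodular_on I p" and q: "supermodular_on I q"
    and cross: "\<And>A B. A \<subseteq> I \<Longrightarrow> B \<subseteq> I \<Longrightarrow> p A - q B \<ge> p (A - B) - q (B - A)"
  shows "top_layer I (G_polyhedron I p q) = base_polyhedron I p"
    and "bottom_layer I (G_polyhedron I p q) = base_polyhedron I (dual_fun I q)"
proof -
  let ?G = "G_polyhedron I p q"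
  have q0: "q {} = 0" using q unfolding supermodular_on_def submodular_on_def by simp
  have p0: "p {} = 0" using submodular_onD(1)[OF p] .
  have d: "submodular_on I (dual_fun I q)" using submodular_on_dual_fun[OF q] .
  have GD: "q A \<le> sum x A" "sum x A \<le> p A" if "x \<in> ?G" "A \<subseteq> I" for x A
    using that unfolding G_polyhedron_def by auto
  have top: "base_polyhedron I p \<subseteq> ?G"
  proof
    fix x assume x: "x \<in> base_polyhedron I p"
    have "q A \<le> sum x A" if A: "A \<subseteq> I" for A
      using base_polyhedronD(2)[OF x, of "I - A"] base_polyhedronD(3)[OF x]
        cross[of I A] sum_complement[OF fin A, of x] A q0
      by (simp add: Diff_eq_empty_iff[THEN iffD2])
    then show "x \<in> ?G" using base_polyhedronD[OF x] unfolding G_polyhedron_def by auto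
  qed
  have bot: "base_polyhedron I (dual_fun I q) \<subseteq> ?G"
  proof
    fix x assume x: "x \<in> base_polyhedron I (dual_fun I q)"
    have xI: "sum x I = q I" using base_polyhedronD(3)[OF x] q0 by (simp add: dual_fun_def)
    have "q A \<le> sum x A" if A: "A \<subseteq> I" for A
      using base_polyhedronD(2)[OF x, of "I - A"] sum_complement[OF fin A, of x] xI A
      by (simp add: dual_fun_def double_diff)
    moreover have "sum x A \<le> p A" if A: "A \<subseteq> I" for A
      using base_polyhedronD(2)[OF x A] cross[of A I] A p0
      by (simp add: dual_fun_def Diff_eq_empty_iff[THEN iffD2])
    ultimately show "x \<in> ?G" using base_polyhedronD(1)[OF x] unfolding G_polyhedron_def by auto
  qed
  obtain b where b: "b \<in> base_polyhedron I p" using base_polyhedron_nonempty[OF fin p] by blast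
  obtain b' where b': "b' \<in> base_polyhedron I (dual_fun I q)"
    using base_polyhedron_nonempty[OF fin d] by blast
  have dI: "dual_fun I q I = q I" using q0 by (simp add: dual_fun_def)
  show "top_layer I ?G = base_polyhedron I p"
  proof (intro equalityI subsetI)
    fix x assume "x \<in> top_layer I ?G"
    then have "x \<in> ?G" "sum b I \<le> sum x I" using top b unfolding top_layer_def by auto
    then show "x \<in> base_polyhedron I p"
      using GD(2)[of x] base_polyhedronD(3)[OF b] by (intro base_polyhedronI) (auto simp: G_polyhedron_def intro: antisym)
  next
    fix x assume x: "x \<in> base_polyhedron I p"
    then show "x \<in> top_layer I ?G"
      using top GD(2) base_polyhedronD(3)[OF x] unfolding top_layer_def by auto
  qed
  show "bottom_layer I ?G = base_polyhedron I (dual_fun I q)"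
  proof (intro equalityI subsetI)
    fix x assume "x \<in> bottom_layer I ?G"
    then have x: "x \<in> ?G" "sum x I \<le> sum b' I" using bot b' unfolding bottom_layer_def by auto
    have xI: "sum x I = q I"
      using x(2) GD(1)[OF x(1), of I] base_polyhedronD(3)[OF b'] dI by simp
    have "sum x A \<le> dual_fun I q A" if A: "A \<subseteq> I" for A
      using GD(1)[OF x(1), of "I - A"] sum_complement[OF fin A, of x] xI by (simp add: dual_fun_def)
    then show "x \<in> base_polyhedron I (dual_fun I q)"
      using x(1) xI dI by (intro base_polyhedronI) (auto simp: G_polyhedron_def)
  next
    fix x assume x: "x \<in> base_polyhedron I (dual_fun I q)"
    then show "x \<in> bottom_layer I ?G"
      using bot GD(1) base_polyhedronD(3)[OF x] dI unfolding bottom_layer_def by auto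
  qed
qed

text \<open>
  With \<open>X = I - B\<close>, the dual increment over \<open>A \<inter> B\<close> is an increment of \<open>q\<close> from \<open>X\<close> to
  \<open>X \<union> A\<close>; submodularity of \<open>p\<close> compares the increment of \<open>p\<close> there with the one ending in \<open>A\<close>.
\<close>

lemma paramodular_iff_compliant:
  assumes "submodular_on I p"
  shows "(\<forall>A B. A \<subseteq> I \<longrightarrow> B \<subseteq> I \<longrightarrow> p A - dual_fun I q B \<ge> p (A - B) - dual_fun I q (B - A))
    \<longleftrightarrow> compliant I p q"
proof (intro iffI allI impI)
  assume cross: "\<forall>A B. A \<subseteq> I \<longrightarrow> B \<subseteq> I \<longrightarrow> p A - dual_fun I q B \<ge> p (A - B) - dual_fun I q (B - A)"
  show "compliant I p q" unfolding compliant_def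
  proof (intro allI impI)
    fix X Y assume XY: "X \<subseteq> Y" "Y \<subseteq> I"
    have "I - (I - X) = X" "I - ((I - X) - Y) = Y" "Y - (I - X) = X" using XY by auto
    then show "q Y - q X \<le> p Y - p X"
      using cross[rule_format, of Y "I - X"] XY by (simp add: dual_fun_def)
  qed
next
  fix A B assume c: "compliant I p q" and AB: "A \<subseteq> I" "B \<subseteq> I"
  have "q ((I - B) \<union> A) - q (I - B) \<le> p ((I - B) \<union> A) - p (I - B)"
    using AB by (intro compliantD[OF c]) auto
  also have "\<dots> \<le> p A - p ((I - B) \<inter> A)"
    using submodular_onD(2)[OF assms, of "I - B" A] AB by simp
  finally have "q ((I - B) \<union> A) - q (I - B) \<le> p A - p ((I - B) \<inter> A)" .
  moreover have "(I - B) \<union> A = I - (B - A)" "(I - B) \<inter> A = A - B" using AB by auto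
  ultimately show "p A - dual_fun I q B \<ge> p (A - B) - dual_fun I q (B - A)"
    by (simp add: dual_fun_def)
qed

lemma base_polyhedron_cong:
  assumes "\<And>A. A \<subseteq> I \<Longrightarrow> p A = q A"
  shows "base_polyhedron I p = base_polyhedron I q"
  using assms unfolding base_polyhedron_def by auto

lemma compliant_layers:
  assumes fin: "finite I" and p: "submodular_on I p" and q: "submodular_on I q"
    and c: "compliant I p q"
  shows "top_layer I (G_polyhedron I p (dual_fun I q)) = base_polyhedron I p"
    and "bottom_layer I (G_polyhedron I p (dual_fun I q)) = base_polyhedron I q"
proof -
  note cross = c[folded paramodular_iff_compliant[OF p], rule_format]
  note layers = paramodular_layers[OF fin p supermodular_on_dual_fun[OF q] cross]
  show "top_layer I (G_polyhedron I p (dual_fun I q)) = base_polyhedron I p"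
    using layers(1) by simp
  have "base_polyhedron I (dual_fun I (dual_fun I q)) = base_polyhedron I q"
    using dual_fun_dual_fun submodular_onD(1)[OF q] by (intro base_polyhedron_cong) auto
  then show "bottom_layer I (G_polyhedron I p (dual_fun I q)) = base_polyhedron I q"
    using layers(2) by simp
qed

text \<open>
  A generalized polymatroid may be presented by other functions than the given ones, but its
  two layers determine them.
\<close>

lemma compliant_iff_gen_polymatroid:
  assumes fin: "finite I" and p: "submodular_on I p" and q: "submodular_on I q"
  shows "compliant I p q \<longleftrightarrow> gen_polymatroid I (G_polyhedron I p (dual_fun I q)) \<and>
    base_polyhedron I p = top_layer I (G_polyhedron I p (dual_fun I q)) \<and>
    base_polyhedron I q = bottom_layer I (G_polyhedron I p (dual_fun I q))"
    (is "_ \<longleftrightarrow> gen_polymatroid I ?G \<and> ?T \<and> ?B")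
proof (intro iffI conjI)
  assume c: "compliant I p q"
  show "gen_polymatroid I ?G" unfolding gen_polymatroid_def
    using p supermodular_on_dual_fun[OF q] c[folded paramodular_iff_compliant[OF p]] by blast
  show ?T ?B using compliant_layers[OF fin p q c] by simp_all
next
  assume R: "gen_polymatroid I ?G \<and> ?T \<and> ?B"
  then obtain p' q' where p': "submodular_on I p'" and q': "supermodular_on I q'"
    and cross: "\<And>A B. A \<subseteq> I \<Longrightarrow> B \<subseteq> I \<Longrightarrow> p' A - q' B \<ge> p' (A - B) - q' (B - A)"
    and G: "?G = G_polyhedron I p' q'"
    unfolding gen_polymatroid_def by blast
  note layers = paramodular_layers[OF fin p' q' cross]
  have "base_polyhedron I p = base_polyhedron I p'" using R G layers(1) by simp
  then have pp': "p A = p' A" if "A \<subseteq> I" for A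
    using base_polyhedron_inject[OF fin p p'] that by blast
  have "base_polyhedron I q = base_polyhedron I (dual_fun I q')" using R G layers(2) by simp
  then have "q A = dual_fun I q' A" if "A \<subseteq> I" for A
    using base_polyhedron_inject[OF fin q submodular_on_dual_fun[OF q']] that by blast
  then have "dual_fun I q A = dual_fun I (dual_fun I q') A" if "A \<subseteq> I" for A
    using that unfolding dual_fun_def[of I q] dual_fun_def[of I "dual_fun I q'"] by simp
  moreover have "q' {} = 0" using q' unfolding supermodular_on_def submodular_on_def by simp
  ultimately have qq': "dual_fun I q A = q' A" if "A \<subseteq> I" for A
    using that dual_fun_dual_fun[of q' A I] by simp
  have "p A - dual_fun I q B \<ge> p (A - B) - dual_fun I q (B - A)" if "A \<subseteq> I" "B \<subseteq> I" for A B
  proof -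
    have "A - B \<subseteq> I" "B - A \<subseteq> I" using that by auto
    then show ?thesis using cross[OF that] pp' qq' that by simp
  qed
  then show "compliant I p q" using paramodular_iff_compliant[OF p] by blast
qed

section \<open>Top and bottom layers of projections\<close>

lemma Plus_vimage: "(Inl -` S) <+> (Inr -` S) = S"
proof (rule set_eqI)
  show "x \<in> (Inl -` S) <+> (Inr -` S) \<longleftrightarrow> x \<in> S" for x by (cases x) auto
qed

lemma Plus_Un: "(A <+> B) \<union> (A' <+> B') = (A \<union> A') <+> (B \<union> B')"
  and Plus_Int: "(A <+> B) \<inter> (A' <+> B') = (A \<inter> A') <+> (B \<inter> B')"
  and Plus_subset_iff: "A <+> B \<subseteq> A' <+> B' \<longleftrightarrow> A \<subseteq> A' \<and> B \<subseteq> B'"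
  and vimage_Plus: "Inl -` (A <+> B) = A" "Inr -` (A <+> B) = B"
  by auto

lemma sum_Plus_real:
  fixes v :: "'i + 'j \<Rightarrow> real"
  assumes "finite A" "finite B"
  shows "sum v (A <+> B) = (\<Sum>i\<in>A. v (Inl i)) + (\<Sum>j\<in>B. v (Inr j))"
  using sum.Plus[OF assms, of v] by (simp add: comp_def)

lemma sum_pair_neg:
  assumes "finite A" "finite B"
  shows "sum (pair_neg x y) (A <+> B) = sum x A - sum y B"
  using sum_Plus_real[OF assms, of "pair_neg x y"] unfolding pair_neg_def by (simp add: sum_negf)

lemma pair_neg_coord_space:
  "pair_neg x y \<in> coord_space (I <+> J) \<longleftrightarrow> x \<in> coord_space I \<and> y \<in> coord_space J"
proof
  assume v: "pair_neg x y \<in> coord_space (I <+> J)"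
  have "x i = 0" if "i \<notin> I" for i
    using v[unfolded coord_space_def, THEN CollectD, rule_format, of "Inl i"] that
    by (auto simp: pair_neg_def)
  moreover have "y j = 0" if "j \<notin> J" for j
    using v[unfolded coord_space_def, THEN CollectD, rule_format, of "Inr j"] that
    by (auto simp: pair_neg_def)
  ultimately show "x \<in> coord_space I \<and> y \<in> coord_space J" unfolding coord_space_def by blast
next
  assume xy: "x \<in> coord_space I \<and> y \<in> coord_space J"
  have "pair_neg x y s = 0" if "s \<notin> I <+> J" for s
    using xy that by (cases s) (auto simp: pair_neg_def coord_space_def)
  then show "pair_neg x y \<in> coord_space (I <+> J)" unfolding coord_space_def by blast
qed

lemma pair_neg_surj: "v = pair_neg (\<lambda>i. v (Inl i)) (\<lambda>j. - v (Inr j))"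
proof
  show "v s = pair_neg (\<lambda>i. v (Inl i)) (\<lambda>j. - v (Inr j)) s" for s
    by (cases s) (simp_all add: pair_neg_def)
qed

lemma proj_left_pair_neg: "x \<in> proj_left R \<longleftrightarrow> (\<exists>y. pair_neg x y \<in> R)"
proof
  assume "x \<in> proj_left R"
  then obtain v where v: "v \<in> R" "x = (\<lambda>i. v (Inl i))" unfolding proj_left_def by blast
  then show "\<exists>y. pair_neg x y \<in> R" using pair_neg_surj[of v] by metis
next
  assume "\<exists>y. pair_neg x y \<in> R"
  then obtain y where y: "pair_neg x y \<in> R" by blast
  show "x \<in> proj_left R" unfolding proj_left_def
    by (rule image_eqI[OF _ y]) (simp add: pair_neg_def)
qed

lemma base_ofD:
  assumes "v \<in> base_of I U t"
  shows "v \<in> coord_space I" "(A, r) \<in> U \<Longrightarrow> sum v A \<le> r" "sum v I = t"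
  using assms unfolding base_of_def by auto

lemma finite_real_gap:
  fixes R :: "real set"
  assumes "finite R" "\<forall>r\<in>R. a < r"
  shows "\<exists>m>a. \<forall>r\<in>R. m \<le> r"
  using assms by (intro exI[of _ "Min (insert (a + 1) R)"]) auto

text \<open>
  The top layer of a projection is described by the least bounds on the subsets of \<open>I\<close>. If no bound on \<open>A\<close> were as small as \<open>q A\<close>, the chain \<open>{} \<subseteq> A \<subseteq> I \<subseteq> I <+> J\<close>
  would yield a point of the top layer exceeding \<open>q A\<close> on \<open>A\<close>. The presence of a point in the top
  layer is also what makes the bound on \<open>I\<close> finite.
\<close>

lemma top_layer_proj_left_bounds:
  assumes I: "finite I" and J: "finite J" and V: "submodular_bounds (I <+> J) V" and t: "(I <+> J, t) \<in> V"
    and q: "submodular_on I q"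
    and top: "top_layer I (proj_left (base_of (I <+> J) V t)) = base_polyhedron I q" and A: "A \<subseteq> I"
  shows "(A <+> {}, r) \<in> V \<Longrightarrow> q A \<le> r" and "\<exists>r\<le>q A. (A <+> {}, r) \<in> V"
proof -
  let ?R = "base_of (I <+> J) V t"
  have finA: "finite A" using A I by (rule finite_subset)
  show le: "q A \<le> r" if "(A <+> {}, r) \<in> V" for A r
  proof -
    have "A <+> {} \<subseteq> I <+> J" using submodular_boundsD(3)[OF V that] .
    then have A: "A \<subseteq> I" by (simp add: Plus_subset_iff)
    obtain x where x: "x \<in> base_polyhedron I q" "sum x A = q A"
      using base_polyhedron_attains[OF I q A] by blast
    then have "x \<in> proj_left ?R" using top unfolding top_layer_def by blast
    then obtain y where "pair_neg x y \<in> ?R" unfolding proj_left_pair_neg by blast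
    from base_ofD(2)[OF this that] show ?thesis
      using sum_pair_neg[OF finite_subset[OF A I] finite.emptyI, of x y] x(2) by simp
  qed
  obtain x0 where x0: "x0 \<in> base_polyhedron I q" using base_polyhedron_nonempty[OF I q] by blast
  then have x0': "x0 \<in> top_layer I (proj_left ?R)" using top by simp
  then obtain y0 where y0: "pair_neg x0 y0 \<in> ?R" unfolding top_layer_def proj_left_pair_neg by blast
  show "\<exists>r\<le>q A. (A <+> {}, r) \<in> V"
  proof (rule ccontr)
    assume none: "\<not> ?thesis"
    have "finite {r. (A <+> {}, r) \<in> V}"
      using submodular_boundsD(1)[OF V] by (rule finite_subset[rotated, OF finite_imageI[of _ snd]]) force
    moreover have "\<forall>r\<in>{r. (A <+> {}, r) \<in> V}. q A < r"
      using none linorder_not_le by blast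
    ultimately obtain m where m: "m > q A" "\<And>r. (A <+> {}, r) \<in> V \<Longrightarrow> m \<le> r"
      using finite_real_gap[of "{r. (A <+> {}, r) \<in> V}" "q A"] by blast
    define L where "L = {({}, 0), (A <+> {}, - m), (I <+> {}, - q I), (I <+> J, - t)}"
    have L: "submodular_bounds (I <+> J) L"
    proof (rule submodular_bounds_chain)
      show "({}, 0) \<in> L" unfolding L_def by simp
      show "B \<subseteq> I <+> J" if "(B, r) \<in> L" for B r
        using that A unfolding L_def by (auto simp del: Plus_eq_empty_conv)
      show "B \<subseteq> C \<or> C \<subseteq> B" if "(B, r) \<in> L" "(C, s) \<in> L" for B r C s
        using that A unfolding L_def
        by (elim insertE emptyE; simp only: prod.inject) (simp_all add: Plus_subset_iff)
    qed (simp add: L_def)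
    have compat: "0 \<le> r + s" if Br: "(B, r) \<in> V" and Bs: "(B, s) \<in> L" for B r s
    proof -
      consider "B = {}" "s = 0" | "B = A <+> {}" "s = - m" | "B = I <+> {}" "s = - q I"
        | "B = I <+> J" "s = - t" using Bs unfolding L_def by blast
      then show ?thesis
      proof cases
        case 1 then show ?thesis using base_ofD(2)[OF y0 Br] by simp
      next
        case 2 then show ?thesis using m(2) Br by auto
      next
        case 3 then show ?thesis using le Br by auto
      next
        case 4 then show ?thesis using base_ofD(2)[OF y0 Br] base_ofD(3)[OF y0] by simp
      qed
    qed
    have "finite (I <+> J)" "(I <+> J, - t) \<in> L" using I J unfolding L_def by simp_all
    then have "\<exists>v\<in>?R. \<forall>B s. (B, s) \<in> L \<longrightarrow> - s \<le> sum v B"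
      using base_of_above[OF _ V L _ t] compat by blast
    then obtain v where v: "v \<in> ?R" "\<And>B s. (B, s) \<in> L \<Longrightarrow> - s \<le> sum v B" by blast
    define x where "x = (\<lambda>i. v (Inl i))"
    have sum_x: "sum x B = sum v (B <+> {})" if "finite B" for B
      unfolding x_def using sum_Plus_real[OF that, of "{}" v] by simp
    have x: "x \<in> proj_left ?R" unfolding x_def proj_left_def using v(1) by blast
    have "q I \<le> sum x I" using v(2)[of "I <+> {}" "- q I"] sum_x[OF I] unfolding L_def by simp
    moreover have "sum y I \<le> q I" if "y \<in> proj_left ?R" for y
      using x0' that base_polyhedronD(3)[OF x0] unfolding top_layer_def by auto
    ultimately have "x \<in> top_layer I (proj_left ?R)"
      using x unfolding top_layer_def by force
    then have "sum x A \<le> q A" using top base_polyhedronD(2)[of x I q A] A by simp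
    moreover have "m \<le> sum x A" using v(2)[of "A <+> {}" "- m"] sum_x[OF finA] unfolding L_def by simp
    ultimately show False using m(1) by simp
  qed
qed

lemma deletion_function:
  assumes "finite I" "finite J" "submodular_on (I <+> J) r" "submodular_on I p"
    and "top_layer I (proj_left (base_polyhedron (I <+> J) r)) = base_polyhedron I p" "A \<subseteq> I"
  shows "p A = r (A <+> {})"
proof -
  let ?V = "bounds_of (I <+> J) (\<lambda>S. ereal (r S))"
  have V: "submodular_bounds (I <+> J) ?V"
    using submodular_bounds_of[OF _ submodular_on_ereal[OF assms(3)]] assms(1,2) by simp
  have t: "(I <+> J, r (I <+> J)) \<in> ?V" unfolding bounds_of_def by simp
  note T = top_layer_proj_left_bounds[OF assms(1,2) V t assms(4)
      assms(5)[unfolded base_polyhedron_eq_base_of[of "I <+> J" r]] assms(6)]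
  have "(A <+> {}, r (A <+> {})) \<in> ?V" using assms(6) unfolding bounds_of_def by auto
  then have "p A \<le> r (A <+> {})" by (rule T(1))
  moreover have "r (A <+> {}) \<le> p A" using T(2) unfolding bounds_of_def by auto
  ultimately show ?thesis by simp
qed

text \<open>
  The bottom layer of the projection consists of the points whose second part is tight on
  \<open>J\<close>, which leaves \<open>r (A <+> J) - r ({} <+> J)\<close> as the bound on \<open>A\<close>.
\<close>

lemma contraction_function:
  assumes I: "finite I" and J: "finite J" and r: "submodular_on (I <+> J) r" and q: "submodular_on I q"
    and bot: "bottom_layer I (proj_left (base_polyhedron (I <+> J) r)) = base_polyhedron I q"
    and A: "A \<subseteq> I"
  shows "q A = r (A <+> J) - r ({} <+> J)"
proof (rule antisym)
  let ?R = "base_polyhedron (I <+> J) r"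
  have fin: "finite (I <+> J)" "finite A" using I J A by (auto intro: finite_subset)
  let ?C = "{{} <+> J, A <+> J}"
  have "\<exists>v\<in>?R. \<forall>S\<in>?C. sum v S = r S"
    using A by (intro base_polyhedron_tight_on_chain[OF fin(1) r]) (auto simp: Plus_subset_iff)
  then obtain v where v: "v \<in> ?R" "sum v ({} <+> J) = r ({} <+> J)" "sum v (A <+> J) = r (A <+> J)"
    by auto
  define x where "x = (\<lambda>i. v (Inl i))"
  have split: "sum w (B <+> J) = (\<Sum>i\<in>B. w (Inl i)) + sum w ({} <+> J)"
    if "finite B" for w :: "'a + 'b \<Rightarrow> real" and B
    using sum_Plus_real[OF that J, of w] sum_Plus_real[OF finite.emptyI J, of w] by simp
  have min: "r (I <+> J) - r ({} <+> J) \<le> (\<Sum>i\<in>I. w (Inl i))" if "w \<in> ?R" for w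
    using split[OF I, of w] base_polyhedronD(2)[OF that, of "{} <+> J"] base_polyhedronD(3)[OF that]
    by (auto simp: Plus_subset_iff)
  have x: "x \<in> proj_left ?R" unfolding x_def proj_left_def using v(1) by blast
  have xI: "sum x I = r (I <+> J) - r ({} <+> J)"
    unfolding x_def using split[OF I, of v] v(2) base_polyhedronD(3)[OF v(1)] by simp
  have "sum x I \<le> sum y I" if "y \<in> proj_left ?R" for y
    using that min unfolding xI proj_left_def by auto
  then have "x \<in> base_polyhedron I q" using x bot unfolding bottom_layer_def by blast
  then have "sum x A \<le> q A" using A by (rule base_polyhedronD(2))
  then show "r (A <+> J) - r ({} <+> J) \<le> q A"
    using split[OF fin(2), of v] v(2,3) unfolding x_def by simp
  obtain y where y: "y \<in> base_polyhedron I q" "sum y A = q A"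
    using base_polyhedron_attains[OF I q A] by blast
  then have y': "y \<in> bottom_layer I (proj_left ?R)" using bot by simp
  then obtain w where w: "w \<in> ?R" "y = (\<lambda>i. w (Inl i))"
    unfolding bottom_layer_def proj_left_def by blast
  have "sum y I \<le> sum x I" using y' x unfolding bottom_layer_def by blast
  then have "r ({} <+> J) \<le> sum w ({} <+> J)"
    using split[OF I, of w] base_polyhedronD(3)[OF w(1)] w(2) xI by simp
  moreover have "sum w (A <+> J) \<le> r (A <+> J)"
    using A by (intro base_polyhedronD(2)[OF w(1)]) (auto simp: Plus_subset_iff)
  ultimately show "q A \<le> r (A <+> J) - r ({} <+> J)"
    using split[OF fin(2), of w] w(2) y(2) by simp
qed

lemma deletion_contraction_imp_compliant:
  assumes "finite I" "finite J" and r: "submodular_on (I <+> J) r"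
    and "submodular_on I p" "submodular_on I q"
    and "base_polyhedron I p = deletion I (base_polyhedron (I <+> J) r)"
    and "base_polyhedron I q = contraction I (base_polyhedron (I <+> J) r)"
  shows "compliant I p q"
  unfolding compliant_def
proof (intro allI impI)
  fix X Y assume XY: "X \<subseteq> Y" "Y \<subseteq> I"
  have p: "p A = r (A <+> {})" if "A \<subseteq> I" for A
    using deletion_function[OF assms(1-4)] assms(6) that unfolding deletion_def by simp
  have q: "q A = r (A <+> J) - r ({} <+> J)" if "A \<subseteq> I" for A
    using contraction_function[OF assms(1-3,5)] assms(7) that unfolding contraction_def by simp
  have "r ((X <+> J) \<union> (Y <+> {})) + r ((X <+> J) \<inter> (Y <+> {})) \<le> r (X <+> J) + r (Y <+> {})"
    using XY by (intro submodular_onD(2)[OF r]) (auto simp: Plus_subset_iff)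
  moreover have "(X <+> J) \<union> (Y <+> {}) = Y <+> J" "(X <+> J) \<inter> (Y <+> {}) = X <+> {}"
    using XY by (auto simp: Plus_Un Plus_Int)
  ultimately show "q Y - q X \<le> p Y - p X" using p q XY by simp
qed

section \<open>Composition of submodular systems\<close>

text \<open>
  Adding \<open>x(A) - y(B) \<le> r\<close> and \<open>y(B) - z(C) \<le> s\<close> eliminates \<open>y\<close>.
\<close>

definition compose_bounds ::
    "(('i + 'j) set \<times> real) set \<Rightarrow> (('j + 'k) set \<times> real) set \<Rightarrow> (('i + 'k) set \<times> real) set" where
  "compose_bounds G X = {(A <+> C, r + s) | A B C r s. (A <+> B, r) \<in> G \<and> (B <+> C, s) \<in> X}"

lemma submodular_bounds_compose:
  assumes G: "submodular_bounds (I <+> J) G" and X: "submodular_bounds (J <+> K) X"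
  shows "submodular_bounds (I <+> K) (compose_bounds G X)"
  unfolding submodular_bounds_def
proof (intro conjI allI impI)
  have "compose_bounds G X \<subseteq> (\<lambda>((S, r), (T, s)). (Inl -` S <+> Inr -` T, r + s)) ` (G \<times> X)"
  proof
    fix u assume "u \<in> compose_bounds G X"
    then obtain A B C r s where "u = (A <+> C, r + s)" "(A <+> B, r) \<in> G" "(B <+> C, s) \<in> X"
      unfolding compose_bounds_def by blast
    then show "u \<in> (\<lambda>((S, r), (T, s)). (Inl -` S <+> Inr -` T, r + s)) ` (G \<times> X)"
      by (intro image_eqI[of _ _ "((A <+> B, r), (B <+> C, s))"]) (simp_all only: vimage_Plus prod.case SigmaI)
  qed
  then show "finite (compose_bounds G X)"
    by (rule finite_subset) (use submodular_boundsD(1)[OF G] submodular_boundsD(1)[OF X] in simp)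
  have empty: "{} <+> {} = {}" by simp
  have "({} <+> {}, 0 + 0) \<in> compose_bounds G X"
    unfolding compose_bounds_def
    using submodular_boundsD(2)[OF G, folded empty] submodular_boundsD(2)[OF X, folded empty] by blast
  then show "({}, 0) \<in> compose_bounds G X" unfolding empty by simp
  show "S \<subseteq> I <+> K" if S: "(S, u) \<in> compose_bounds G X" for S u
  proof -
    obtain A B C r s where "S = A <+> C" "(A <+> B, r) \<in> G" "(B <+> C, s) \<in> X"
      using S unfolding compose_bounds_def by blast
    then show ?thesis using submodular_boundsD(3)[OF G] submodular_boundsD(3)[OF X]
      by (simp add: Plus_subset_iff) blast
  qed
  fix S u T v assume "(S, u) \<in> compose_bounds G X" "(T, v) \<in> compose_bounds G X"
  then obtain A B C r s A' B' C' r' s' where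
    1: "S = A <+> C" "u = r + s" "(A <+> B, r) \<in> G" "(B <+> C, s) \<in> X" and
    2: "T = A' <+> C'" "v = r' + s'" "(A' <+> B', r') \<in> G" "(B' <+> C', s') \<in> X"
    unfolding compose_bounds_def by blast
  obtain r1 r2 where r: "((A \<union> A') <+> (B \<union> B'), r1) \<in> G" "((A \<inter> A') <+> (B \<inter> B'), r2) \<in> G" "r1 + r2 \<le> r + r'"
    using submodular_boundsD(4)[OF G 1(3) 2(3)] unfolding Plus_Un Plus_Int by blast
  obtain s1 s2 where s: "((B \<union> B') <+> (C \<union> C'), s1) \<in> X" "((B \<inter> B') <+> (C \<inter> C'), s2) \<in> X" "s1 + s2 \<le> s + s'"
    using submodular_boundsD(4)[OF X 1(4) 2(4)] unfolding Plus_Un Plus_Int by blast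
  have "(S \<union> T, r1 + s1) \<in> compose_bounds G X" "(S \<inter> T, r2 + s2) \<in> compose_bounds G X"
    unfolding 1(1) 2(1) Plus_Un Plus_Int compose_bounds_def using r s by blast+
  moreover have "(r1 + s1) + (r2 + s2) \<le> u + v" using 1(2) 2(2) r(3) s(3) by simp
  ultimately show "\<exists>r' s'. (S \<union> T, r') \<in> compose_bounds G X \<and> (S \<inter> T, s') \<in> compose_bounds G X \<and> r' + s' \<le> u + v"
    by blast
qed

text \<open>
  For given \<open>x\<close> and \<open>z\<close> the first system bounds \<open>y\<close> from below and the second from above. The
  composed bounds say exactly that the two are compatible, so the sandwich theorem supplies \<open>y\<close>.
\<close>

lemma base_of_compose_bounds:
  assumes I: "finite I" and J: "finite J" and K: "finite K"
    and G: "submodular_bounds (I <+> J) G" and X: "submodular_bounds (J <+> K) X"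
    and g: "(I <+> J, g) \<in> G" and h: "(J <+> K, h) \<in> X"
  shows "pair_neg x z \<in> base_of (I <+> K) (compose_bounds G X) (g + h) \<longleftrightarrow>
    x \<in> coord_space I \<and> z \<in> coord_space K \<and>
    (\<exists>y\<in>coord_space J. pair_neg x y \<in> base_of (I <+> J) G g \<and> pair_neg y z \<in> base_of (J <+> K) X h)"
proof -
  have finG: "finite A" "finite B" if "(A <+> B, r) \<in> G" for A B r
    using submodular_boundsD(3)[OF G that] I J by (auto simp: Plus_subset_iff intro: finite_subset)
  have finX: "finite A" "finite B" if "(A <+> B, r) \<in> X" for A B r
    using submodular_boundsD(3)[OF X that] J K by (auto simp: Plus_subset_iff intro: finite_subset)
  show ?thesis
  proof (intro iffI conjI)
    assume "x \<in> coord_space I \<and> z \<in> coord_space K \<and>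
      (\<exists>y\<in>coord_space J. pair_neg x y \<in> base_of (I <+> J) G g \<and> pair_neg y z \<in> base_of (J <+> K) X h)"
    then obtain y where xz: "x \<in> coord_space I" "z \<in> coord_space K"
      and xy: "pair_neg x y \<in> base_of (I <+> J) G g" and yz: "pair_neg y z \<in> base_of (J <+> K) X h"
      by blast
    have "sum (pair_neg x z) S \<le> u" if S: "(S, u) \<in> compose_bounds G X" for S u
    proof -
      obtain A B C r s where 1: "S = A <+> C" "u = r + s" "(A <+> B, r) \<in> G" "(B <+> C, s) \<in> X"
        using S unfolding compose_bounds_def by blast
      show ?thesis
        using base_ofD(2)[OF xy 1(3)] base_ofD(2)[OF yz 1(4)] finG[OF 1(3)] finX[OF 1(4)]
        by (simp add: 1(1,2) sum_pair_neg)
    qed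
    moreover have "sum (pair_neg x z) (I <+> K) = g + h"
      using base_ofD(3)[OF xy] base_ofD(3)[OF yz] I J K by (simp add: sum_pair_neg)
    ultimately show "pair_neg x z \<in> base_of (I <+> K) (compose_bounds G X) (g + h)"
      using xz unfolding base_of_def by (simp add: pair_neg_coord_space)
  next
    assume xz: "pair_neg x z \<in> base_of (I <+> K) (compose_bounds G X) (g + h)"
    show x: "x \<in> coord_space I" and z: "z \<in> coord_space K"
      using base_ofD(1)[OF xz] by (simp_all add: pair_neg_coord_space)
    define z' where "z' = case_sum (\<lambda>_ :: 'b. 0) z"
    define x' where "x' = case_sum (\<lambda>i. - x i) (\<lambda>_ :: 'b. 0)"
    have sum_z': "sum z' (B <+> C) = sum z C" if "finite B" "finite C" for B C
      using sum_Plus_real[OF that, of z'] unfolding z'_def by simp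
    have sum_x': "sum x' (A <+> B) = - sum x A" if "finite A" "finite B" for A B
      using sum_Plus_real[OF that, of x'] unfolding x'_def by (simp add: sum_negf)
    define U where "U = (\<lambda>(S, r). (Inl -` S, r + sum z' S)) ` X"
    define L where "L = (\<lambda>(S, r). (Inr -` S, r + sum x' S)) ` G"
    have U: "submodular_bounds J U" unfolding U_def
      by (rule submodular_bounds_image[OF X]) (use J K in auto)
    have L: "submodular_bounds J L" unfolding L_def
      by (rule submodular_bounds_image[OF G]) (use I J in auto)
    have memU: "(B, s + sum z C) \<in> U" if "(B <+> C, s) \<in> X" for B C s
      unfolding U_def using that sum_z'[OF finX[OF that]]
      by (intro image_eqI[OF _ that]) (simp add: vimage_Plus)
    have memL: "(B, r - sum x A) \<in> L" if "(A <+> B, r) \<in> G" for A B r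
      unfolding L_def using that sum_x'[OF finG[OF that]]
      by (intro image_eqI[OF _ that]) (simp add: vimage_Plus)
    have compat: "0 \<le> u + v" if u: "(B, u) \<in> U" and v: "(B, v) \<in> L" for B u v
    proof -
      obtain S s where S: "(S, s) \<in> X" "B = Inl -` S" "u = s + sum z' S" using u unfolding U_def by auto
      obtain T r where T: "(T, r) \<in> G" "B = Inr -` T" "v = r + sum x' T" using v unfolding L_def by auto
      define A C where "A = Inl -` T" and "C = Inr -` S"
      have ST: "S = B <+> C" "T = A <+> B"
        unfolding A_def C_def S(2) by (simp_all only: Plus_vimage, simp only: Plus_vimage S(2)[symmetric] T(2))
      have GX: "(A <+> B, r) \<in> G" "(B <+> C, s) \<in> X" using S(1) T(1) ST by simp_all
      then have "(A <+> C, r + s) \<in> compose_bounds G X" unfolding compose_bounds_def by blast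
      from base_ofD(2)[OF xz this] have "sum x A - sum z C \<le> r + s"
        using finG[OF GX(1)] finX[OF GX(2)] by (simp add: sum_pair_neg)
      moreover have "u = s + sum z C" "v = r - sum x A"
        using S(3) T(3) sum_z'[OF finX[OF GX(2)]] sum_x'[OF finG[OF GX(1)]] ST by simp_all
      ultimately show ?thesis by simp
    qed
    have "\<exists>y\<in>coord_space J. (\<forall>B u. (B, u) \<in> U \<longrightarrow> sum y B \<le> u) \<and> (\<forall>B v. (B, v) \<in> L \<longrightarrow> - v \<le> sum y B)"
      using submodular_sandwich[OF J U L] compat by blast
    then obtain y where y: "y \<in> coord_space J"
      "\<And>B u. (B, u) \<in> U \<Longrightarrow> sum y B \<le> u" "\<And>B v. (B, v) \<in> L \<Longrightarrow> - v \<le> sum y B" by blast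
    have yJ: "sum y J \<le> h + sum z K" "sum x I - g \<le> sum y J"
      using y(2)[OF memU[OF h]] y(3)[OF memL[OF g]] by simp_all
    have tot: "sum x I - sum z K = g + h" using base_ofD(3)[OF xz] I K by (simp add: sum_pair_neg)
    have "sum (pair_neg x y) T \<le> r" if T: "(T, r) \<in> G" for T r
    proof -
      have T': "(Inl -` T <+> Inr -` T, r) \<in> G" using T by (simp only: Plus_vimage)
      have "sum (pair_neg x y) (Inl -` T <+> Inr -` T) \<le> r"
        using y(3)[OF memL[OF T']] sum_pair_neg[OF finG[OF T'], of x y] by linarith
      then show ?thesis by (simp only: Plus_vimage)
    qed
    moreover have "sum (pair_neg x y) (I <+> J) = g"
      using sum_pair_neg[OF I J, of x y] yJ tot by linarith
    ultimately have xy: "pair_neg x y \<in> base_of (I <+> J) G g"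
      using x y(1) unfolding base_of_def by (simp add: pair_neg_coord_space)
    have "sum (pair_neg y z) S \<le> s" if S: "(S, s) \<in> X" for S s
    proof -
      have S': "(Inl -` S <+> Inr -` S, s) \<in> X" using S by (simp only: Plus_vimage)
      have "sum (pair_neg y z) (Inl -` S <+> Inr -` S) \<le> s"
        using y(2)[OF memU[OF S']] sum_pair_neg[OF finX[OF S'], of y z] by linarith
      then show ?thesis by (simp only: Plus_vimage)
    qed
    moreover have "sum (pair_neg y z) (J <+> K) = h"
      using sum_pair_neg[OF J K, of y z] yJ tot by linarith
    ultimately have "pair_neg y z \<in> base_of (J <+> K) X h"
      using z y(1) unfolding base_of_def by (simp add: pair_neg_coord_space)
    with xy y(1) show "\<exists>y\<in>coord_space J. pair_neg x y \<in> base_of (I <+> J) G g \<and>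
        pair_neg y z \<in> base_of (J <+> K) X h" by blast
  qed
qed

text \<open>
  A bound \<open>u \<le> q A\<close> comes from bounds \<open>s\<close> on \<open>(A, B)\<close> and \<open>t\<close> on \<open>B\<close>. Submodularity applied to
  \<open>(A, B)\<close> and \<open>(A', {})\<close> turns \<open>s\<close> into a bound on \<open>(A', B)\<close>, which together with \<open>t\<close> bounds \<open>q A'\<close>.
\<close>

lemma composition_imp_compliant:
  assumes I: "finite I" and J: "finite J" and K: "finite K"
    and G: "submodular_bounds (I <+> J) G" and X: "submodular_bounds (J <+> K) X"
    and g: "(I <+> J, g) \<in> G" and h: "(J <+> K, h) \<in> X"
    and p: "submodular_on I p" and q: "submodular_on I q"
    and P: "top_layer I (proj_left (base_of (I <+> J) G g)) = base_polyhedron I p"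
    and Q: "top_layer I (proj_left (base_of (I <+> K) (compose_bounds G X) (g + h))) = base_polyhedron I q"
  shows "compliant I p q"
  unfolding compliant_def
proof (intro allI impI)
  fix A A' assume A: "A \<subseteq> A'" "A' \<subseteq> I"
  then have AI: "A \<subseteq> I" by blast
  note GX = submodular_bounds_compose[OF G X]
  have tot: "(I <+> K, g + h) \<in> compose_bounds G X" unfolding compose_bounds_def using g h by blast
  obtain r where r: "(A' <+> {}, r) \<in> G" "r \<le> p A'"
    using top_layer_proj_left_bounds(2)[OF I J G g p P A(2)] by blast
  obtain u where u: "(A <+> {}, u) \<in> compose_bounds G X" "u \<le> q A"
    using top_layer_proj_left_bounds(2)[OF I K GX tot q Q AI] by blast
  then obtain A0 B C s t where 0: "A <+> ({} :: 'c set) = A0 <+> C" "u = s + t" "(A0 <+> B, s) \<in> G" "(B <+> C, t) \<in> X"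
    unfolding compose_bounds_def by blast
  have "A0 = A" "C = {}" using arg_cong[OF 0(1), of "(-`) Inl"] arg_cong[OF 0(1), of "(-`) Inr"]
    by (simp_all only: vimage_Plus)
  then have s: "(A <+> B, s) \<in> G" and t: "(B <+> {}, t) \<in> X" using 0 by simp_all
  have sets: "(A <+> B) \<union> (A' <+> {}) = A' <+> B" "(A <+> B) \<inter> (A' <+> {}) = A <+> {}"
    using A(1) by (auto simp: Plus_Un Plus_Int)
  obtain r' s' where rs: "(A' <+> B, r') \<in> G" "(A <+> {}, s') \<in> G" "r' + s' \<le> s + r"
    using submodular_boundsD(4)[OF G s r(1)] unfolding sets by blast
  have "(A' <+> {}, r' + t) \<in> compose_bounds G X" unfolding compose_bounds_def using rs(1) t by blast
  then have "q A' \<le> r' + t" by (rule top_layer_proj_left_bounds(1)[OF I K GX tot q Q A(2)])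
  moreover have "p A \<le> s'" using rs(2) by (rule top_layer_proj_left_bounds(1)[OF I J G g p P AI])
  ultimately show "q A' - q A \<le> p A' - p A" using rs(3) r(2) u(2) 0(2) by linarith
qed

section \<open>A generalized permutohedron with given deletion and contraction\<close>

text \<open>
  Deleting the extra point \<open>e\<close> leaves \<open>p\<close> and contracting it leaves \<open>q\<close>. All other elements of
  the second summand are loops, so that the same formula serves for every index set containing \<open>e\<close>.
\<close>

definition lift_fun ::
    "'j \<Rightarrow> ('i set \<Rightarrow> real) \<Rightarrow> ('i set \<Rightarrow> real) \<Rightarrow> ('i + 'j) set \<Rightarrow> real" where
  "lift_fun e p q S = (if Inr e \<in> S then q (Inl -` S) else p (Inl -` S))"

lemma submodular_on_lift_fun:
  assumes p: "submodular_on I p" and q: "submodular_on I q" and c: "compliant I p q"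
  shows "submodular_on (I <+> J) (lift_fun e p q)"
  unfolding submodular_on_def
proof (intro conjI allI impI)
  show "lift_fun e p q {} = 0" unfolding lift_fun_def using submodular_onD(1)[OF p] by simp
  have mixed: "q (A \<union> B) + p (A \<inter> B) \<le> q A + p B" if "A \<subseteq> I" "B \<subseteq> I" for A B
    using compliantD[OF c, of A "A \<union> B"] submodular_onD(2)[OF p that] that by auto
  fix S T assume "S \<subseteq> I <+> J" "T \<subseteq> I <+> J"
  then have "Inl -` S \<subseteq> I" "Inl -` T \<subseteq> I" by auto
  then show "lift_fun e p q (S \<union> T) + lift_fun e p q (S \<inter> T) \<le> lift_fun e p q S + lift_fun e p q T"
    using mixed[of "Inl -` S" "Inl -` T"] mixed[of "Inl -` T" "Inl -` S"]
      submodular_onD(2)[OF p, of "Inl -` S" "Inl -` T"] submodular_onD(2)[OF q, of "Inl -` S" "Inl -` T"]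
    unfolding lift_fun_def by (auto simp: Un_commute Int_commute)
qed

lemma Inr_mem_Plus: "Inr b \<in> A <+> B \<longleftrightarrow> b \<in> B"
  by auto

text \<open>
  The total determines the coordinate at \<open>e\<close>. Substituting it turns the bounds for sets
  containing \<open>e\<close> into the lower bounds by the dual of \<open>q\<close>.
\<close>

lemma pair_neg_in_base_polyhedron_lift_fun:
  assumes I: "finite I" and J: "finite J" and e: "e \<in> J"
    and p0: "p {} = 0" and q0: "q {} = 0"
  shows "pair_neg x y \<in> base_polyhedron (I <+> J) (lift_fun e p q) \<longleftrightarrow>
    x \<in> G_polyhedron I p (dual_fun I q) \<and> y = (\<lambda>j. if j = e then sum x I - q I else 0)"
proof
  assume v: "pair_neg x y \<in> base_polyhedron (I <+> J) (lift_fun e p q)"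
  have xy: "x \<in> coord_space I" "y \<in> coord_space J"
    using base_polyhedronD(1)[OF v] by (simp_all add: pair_neg_coord_space)
  have le: "sum x A - sum y B \<le> (if e \<in> B then q A else p A)" if "A \<subseteq> I" "B \<subseteq> J" for A B
    using base_polyhedronD(2)[OF v, of "A <+> B"] that I J
      sum_pair_neg[of A B x y] unfolding lift_fun_def
    by (auto simp: Plus_subset_iff finite_subset vimage_Plus Inr_mem_Plus split: if_splits)
  have tot: "sum x I - sum y J = q I"
    using base_polyhedronD(3)[OF v] sum_pair_neg[OF I J, of x y] e
    unfolding lift_fun_def by (simp add: vimage_Plus Inr_mem_Plus)
  have split: "sum y J = y e + sum y (J - {e})" using J e by (rule sum.remove)
  have nonneg: "0 \<le> y j" if "j \<in> J - {e}" for j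
    using le[of "{}" "{j}"] that p0 by auto
  have "sum y (J - {e}) \<le> 0"
    using le[of I "{e}"] tot split e by simp
  then have "sum y (J - {e}) = 0" using sum_nonneg[of "J - {e}" y] nonneg by fastforce
  then have zero: "y j = 0" if "j \<in> J - {e}" for j
    using sum_nonneg_eq_0_iff[of "J - {e}" y] nonneg J that by auto
  have ye: "y e = sum x I - q I" using tot split \<open>sum y (J - {e}) = 0\<close> by simp
  have "y j = (if j = e then sum x I - q I else 0)" for j
    using ye zero[of j] xy(2) unfolding coord_space_def by auto
  moreover have "dual_fun I q A \<le> sum x A" if A: "A \<subseteq> I" for A
    using le[of "I - A" "{e}"] e ye sum_complement[OF I A, of x] by (auto simp: dual_fun_def)
  moreover have "sum x A \<le> p A" if A: "A \<subseteq> I" for A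
    using le[OF A, of "{}"] by simp
  ultimately show "x \<in> G_polyhedron I p (dual_fun I q) \<and> y = (\<lambda>j. if j = e then sum x I - q I else 0)"
    using xy(1) unfolding G_polyhedron_def by auto
next
  assume xy: "x \<in> G_polyhedron I p (dual_fun I q) \<and> y = (\<lambda>j. if j = e then sum x I - q I else 0)"
  then have x: "x \<in> coord_space I" and y: "y = (\<lambda>j. if j = e then sum x I - q I else 0)"
    and le: "\<And>A. A \<subseteq> I \<Longrightarrow> sum x A \<le> p A" and ge: "\<And>A. A \<subseteq> I \<Longrightarrow> q I - q (I - A) \<le> sum x A"
    unfolding G_polyhedron_def dual_fun_def by auto
  have sum_y: "sum y B = (if e \<in> B then sum x I - q I else 0)" if "finite B" for B
    unfolding y using that by simp
  show "pair_neg x y \<in> base_polyhedron (I <+> J) (lift_fun e p q)"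
  proof (rule base_polyhedronI)
    show "pair_neg x y \<in> coord_space (I <+> J)"
      using x e unfolding pair_neg_coord_space y by (auto simp: coord_space_def)
    show "sum (pair_neg x y) (I <+> J) = lift_fun e p q (I <+> J)"
      using sum_pair_neg[OF I J, of x y] sum_y[OF J] e unfolding lift_fun_def by (simp add: vimage_Plus Inr_mem_Plus)
    fix S assume "S \<subseteq> I <+> J"
    then have A: "Inl -` S \<subseteq> I" and B: "Inr -` S \<subseteq> J" by auto
    have fin: "finite (Inl -` S)" "finite (Inr -` S)"
      using A B I J by (auto intro: finite_subset)
    have "I - (I - Inl -` S) = Inl -` S" using A by auto
    then have "q I - q (Inl -` S) \<le> sum x I - sum x (Inl -` S)"
      using ge[of "I - Inl -` S"] sum_complement[OF I A, of x] by simp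
    moreover have "sum (pair_neg x y) S = sum x (Inl -` S) - sum y (Inr -` S)"
      using sum_pair_neg[OF fin, of x y] by (simp only: Plus_vimage)
    ultimately show "sum (pair_neg x y) S \<le> lift_fun e p q S"
      using le[OF A] sum_y[OF fin(2)] unfolding lift_fun_def by auto
  qed
qed

lemma proj_left_lift_fun:
  assumes "finite I" "finite J" "e \<in> J" "p {} = 0" "q {} = 0"
  shows "proj_left (base_polyhedron (I <+> J) (lift_fun e p q)) = G_polyhedron I p (dual_fun I q)"
  using pair_neg_in_base_polyhedron_lift_fun[of I J e p q, OF assms]
  by (auto simp: proj_left_pair_neg set_eq_iff)

lemma pair_neg_zero_in_base_polyhedron_lift_fun:
  assumes I: "finite I" and J: "finite J" "e \<in> J" and p: "submodular_on I p" and q: "submodular_on I q"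
    and c: "compliant I p q"
  shows "pair_neg x (\<lambda>_. 0) \<in> base_polyhedron (I <+> J) (lift_fun e p q) \<longleftrightarrow> x \<in> base_polyhedron I q"
proof -
  let ?G = "G_polyhedron I p (dual_fun I q)"
  have q0: "q {} = 0" using submodular_onD(1)[OF q] .
  have zero: "(\<lambda>_. 0) = (\<lambda>j. if j = e then sum x I - q I else 0) \<longleftrightarrow> sum x I = q I"
    by (auto simp: fun_eq_iff)
  have "x \<in> ?G \<and> sum x I = q I \<longleftrightarrow> x \<in> base_polyhedron I q"
  proof
    assume x: "x \<in> ?G \<and> sum x I = q I"
    have "sum x A \<le> q A" if A: "A \<subseteq> I" for A
    proof -
      have "dual_fun I q (I - A) \<le> sum x (I - A)" using x unfolding G_polyhedron_def by auto
      then show ?thesis using x sum_complement[OF I A, of x] A by (simp add: dual_fun_def double_diff)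
    qed
    then show "x \<in> base_polyhedron I q"
      using x by (intro base_polyhedronI) (auto simp: G_polyhedron_def)
  next
    assume x: "x \<in> base_polyhedron I q"
    then have "x \<in> bottom_layer I ?G" using compliant_layers(2)[OF I p q c] by simp
    then show "x \<in> ?G \<and> sum x I = q I" using base_polyhedronD(3)[OF x] unfolding bottom_layer_def by simp
  qed
  then show ?thesis
    using pair_neg_in_base_polyhedron_lift_fun[where p = p and q = q, OF I J submodular_onD(1)[OF p] q0] zero by simp
qed

lemma compliant_imp_deletion_contraction:
  assumes "finite I" "finite J" "e \<in> J" "submodular_on I p" "submodular_on I q" "compliant I p q"
  shows "base_polyhedron I p = deletion I (base_polyhedron (I <+> J) (lift_fun e p q))"
    and "base_polyhedron I q = contraction I (base_polyhedron (I <+> J) (lift_fun e p q))"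
  unfolding deletion_def contraction_def
  using proj_left_lift_fun[OF assms(1-3), of p q] submodular_onD(1)[OF assms(4)]
    submodular_onD(1)[OF assms(5)] compliant_layers[OF assms(1,4,5,6)] by simp_all

section \<open>Induction and linking permutohedra\<close>

lemma submodular_on_vimage_Inl:
  assumes "submodular_on I w"
  shows "submodular_on (I <+> J) (\<lambda>S. w (Inl -` S))"
  unfolding submodular_on_def
proof (intro conjI allI impI)
  fix S T assume "S \<subseteq> I <+> J" "T \<subseteq> I <+> J"
  then have "Inl -` S \<subseteq> I" "Inl -` T \<subseteq> I" by auto
  from submodular_onD(2)[OF assms this]
  show "w (Inl -` (S \<union> T)) + w (Inl -` (S \<inter> T)) \<le> w (Inl -` S) + w (Inl -` T)" by simp
qed (use submodular_onD(1)[OF assms] in simp)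

text \<open>
  Used with \<open>J\<close> empty to regard a polyhedron as a composable factor, and with \<open>J\<close> a copy of \<open>I\<close>
  for linking permutohedra of the form \<open>W \<times> {0}\<close>.
\<close>

lemma pair_neg_in_base_polyhedron_vimage_Inl:
  assumes I: "finite I" and J: "finite J" and w0: "w {} = 0"
  shows "pair_neg x y \<in> base_polyhedron (I <+> J) (\<lambda>S. w (Inl -` S)) \<longleftrightarrow>
    x \<in> base_polyhedron I w \<and> y = (\<lambda>_. 0)"
proof
  assume v: "pair_neg x y \<in> base_polyhedron (I <+> J) (\<lambda>S. w (Inl -` S))"
  have xy: "x \<in> coord_space I" "y \<in> coord_space J"
    using base_polyhedronD(1)[OF v] by (simp_all add: pair_neg_coord_space)
  have le: "sum x A - sum y B \<le> w A" if "A \<subseteq> I" "B \<subseteq> J" for A B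
    using base_polyhedronD(2)[OF v, of "A <+> B"] that I J sum_pair_neg[of A B x y]
    by (simp add: Plus_subset_iff finite_subset vimage_Plus)
  have tot: "sum x I - sum y J = w I"
    using base_polyhedronD(3)[OF v] sum_pair_neg[OF I J, of x y] by (simp add: vimage_Plus)
  have nonneg: "0 \<le> y j" if "j \<in> J" for j using le[of "{}" "{j}"] that w0 by auto
  have "sum y J \<le> 0" using le[of I "{}"] tot by simp
  then have yJ: "sum y J = 0" using sum_nonneg[of J y] nonneg by fastforce
  then have "y j = 0" for j
    using sum_nonneg_eq_0_iff[of J y] nonneg J xy(2) by (cases "j \<in> J") (auto simp: coord_space_def)
  then show "x \<in> base_polyhedron I w \<and> y = (\<lambda>_. 0)"
    using xy(1) tot yJ le[of _ "{}"] by (auto intro: base_polyhedronI)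
next
  assume xy: "x \<in> base_polyhedron I w \<and> y = (\<lambda>_. 0)"
  then have x: "x \<in> base_polyhedron I w" and y: "y = (\<lambda>_. 0)" by auto
  show "pair_neg x y \<in> base_polyhedron (I <+> J) (\<lambda>S. w (Inl -` S))"
  proof (rule base_polyhedronI)
    show "pair_neg x y \<in> coord_space (I <+> J)"
      using base_polyhedronD(1)[OF x] unfolding pair_neg_coord_space y by (auto simp: coord_space_def)
    show "sum (pair_neg x y) (I <+> J) = w (Inl -` (I <+> J))"
      using sum_pair_neg[OF I J, of x y] base_polyhedronD(3)[OF x] y by (simp add: vimage_Plus)
    fix S assume "S \<subseteq> I <+> J"
    then have A: "Inl -` S \<subseteq> I" and B: "Inr -` S \<subseteq> J" by auto
    have fin: "finite (Inl -` S)" "finite (Inr -` S)"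
      using A B I J by (auto intro: finite_subset)
    have "sum (pair_neg x y) S = sum x (Inl -` S)"
      using sum_pair_neg[OF fin, of x y] y by (simp add: Plus_vimage)
    then show "sum (pair_neg x y) S \<le> w (Inl -` S)" using base_polyhedronD(2)[OF x A] by simp
  qed
qed

lemma proj_left_vimage_Inl:
  assumes "finite I" "finite J" "w {} = 0"
  shows "proj_left (base_polyhedron (I <+> J) (\<lambda>S. w (Inl -` S))) = base_polyhedron I w"
  using pair_neg_in_base_polyhedron_vimage_Inl[of I J w, OF assms]
  by (auto simp: proj_left_pair_neg set_eq_iff)

lemma top_layer_base_polyhedron: "top_layer I (base_polyhedron I p) = base_polyhedron I p"
  unfolding top_layer_def base_polyhedron_def by auto

lemma base_polyhedron_zero:
  assumes "finite I"
  shows "base_polyhedron I (\<lambda>_. 0) = {\<lambda>_. 0}"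
proof (intro equalityI subsetI)
  fix x :: "'a \<Rightarrow> real" assume x: "x \<in> base_polyhedron I (\<lambda>_. 0)"
  have le: "x i \<le> 0" if "i \<in> I" for i using base_polyhedronD(2)[OF x, of "{i}"] that by simp
  have "sum x I = 0" using base_polyhedronD(3)[OF x] .
  then have "x i = 0" for i
    using sum_nonneg_eq_0_iff[OF assms, of "\<lambda>i. - x i"] le base_polyhedronD(1)[OF x]
    by (cases "i \<in> I") (auto simp: coord_space_def sum_negf)
  then show "x \<in> {\<lambda>_. 0}" by auto
qed (auto simp: base_polyhedron_def coord_space_def)

text \<open>
  Induction is composition with a second factor on \<open>J <+> {}\<close>. All points of the induced
  polyhedron have the same total, so it is its own top layer.
\<close>

lemma induction_imp_compliant:
  assumes I: "finite I" and J: "finite J"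
    and g: "submodular_on (I <+> J) g" and w: "submodular_on J w"
    and p: "submodular_on I p" and q: "submodular_on I q"
    and P: "base_polyhedron I p = top_layer I (proj_left (base_polyhedron (I <+> J) g))"
    and Q: "base_polyhedron I q = induction_by I (base_polyhedron (I <+> J) g) (base_polyhedron J w)"
  shows "compliant I p q"
proof -
  let ?K = "{} :: unit set"
  let ?G = "bounds_of (I <+> J) (\<lambda>S. ereal (g S))"
  let ?w = "\<lambda>S :: ('b + unit) set. w (Inl -` S)"
  let ?X = "bounds_of (J <+> ?K) (\<lambda>S. ereal (?w S))"
  have G: "submodular_bounds (I <+> J) ?G"
    using submodular_bounds_of[OF _ submodular_on_ereal[OF g]] I J by simp
  have X: "submodular_bounds (J <+> ?K) ?X"
    using submodular_bounds_of[OF _ submodular_on_ereal[OF submodular_on_vimage_Inl[OF w]], of ?K] J by simp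
  have tot: "(I <+> J, g (I <+> J)) \<in> ?G" "(J <+> ?K, ?w (J <+> ?K)) \<in> ?X"
    unfolding bounds_of_def by auto
  let ?C = "base_of (I <+> ?K) (compose_bounds ?G ?X) (g (I <+> J) + ?w (J <+> ?K))"
  note comp = base_of_compose_bounds[OF I J finite.emptyI G X tot]
  have X_base: "base_of (J <+> ?K) ?X (?w (J <+> ?K)) = base_polyhedron (J <+> ?K) ?w"
    by (rule base_polyhedron_eq_base_of[symmetric])
  have zero: "(\<lambda>_. 0) \<in> coord_space ?K" unfolding coord_space_def by simp
  have "proj_left ?C = base_polyhedron I q"
  proof (rule set_eqI)
    fix x
    have "x \<in> proj_left ?C \<longleftrightarrow> x \<in> coord_space I \<and>
      (\<exists>y\<in>coord_space J. pair_neg x y \<in> base_polyhedron (I <+> J) g \<and> y \<in> base_polyhedron J w)"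
      unfolding proj_left_pair_neg comp base_polyhedron_eq_base_of[symmetric] X_base
        pair_neg_in_base_polyhedron_vimage_Inl[where w = w, OF J finite.emptyI submodular_onD(1)[OF w]]
      using zero by blast
    also have "\<dots> \<longleftrightarrow> x \<in> base_polyhedron I q"
      unfolding Q induction_by_def using base_polyhedronD(1)[of _ J w] by blast
    finally show "x \<in> proj_left ?C \<longleftrightarrow> x \<in> base_polyhedron I q" .
  qed
  then have "top_layer I (proj_left ?C) = base_polyhedron I q"
    by (simp add: top_layer_base_polyhedron)
  then show ?thesis
    using composition_imp_compliant[OF I J finite.emptyI G X tot p q] P
    unfolding base_polyhedron_eq_base_of[of "I <+> J" g] by simp
qed

lemma compliant_imp_induction:
  assumes I: "finite I" and p: "submodular_on I p" and q: "submodular_on I q" and c: "compliant I p q"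
  shows "base_polyhedron I p = top_layer I (proj_left (base_polyhedron (I <+> {e}) (lift_fun e p q)))"
    and "base_polyhedron I q = induction_by I (base_polyhedron (I <+> {e}) (lift_fun e p q))
      (base_polyhedron {e} (\<lambda>_. 0))"
proof -
  have J: "finite {e}" "e \<in> {e}" by simp_all
  show "base_polyhedron I p = top_layer I (proj_left (base_polyhedron (I <+> {e}) (lift_fun e p q)))"
    using compliant_imp_deletion_contraction(1)[OF I J p q c] unfolding deletion_def .
  show "base_polyhedron I q = induction_by I (base_polyhedron (I <+> {e}) (lift_fun e p q))
      (base_polyhedron {e} (\<lambda>_. 0))"
    unfolding base_polyhedron_zero[OF J(1)] induction_by_def
    using pair_neg_zero_in_base_polyhedron_lift_fun[OF I J p q c] base_polyhedronD(1)[of _ I q] by auto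
qed

lemma link_mult_eq_compose:
  assumes E: "finite E" and G: "submodular_bounds (E <+> E) G" and X: "submodular_bounds (E <+> E) X"
    and g: "(E <+> E, g) \<in> G" and h: "(E <+> E, h) \<in> X"
  shows "link_mult E (base_of (E <+> E) G g) (base_of (E <+> E) X h) =
    base_of (E <+> E) (compose_bounds G X) (g + h)"
proof (rule set_eqI)
  fix v :: "'a + 'a \<Rightarrow> real"
  note comp = base_of_compose_bounds[OF E E E G X g h]
  obtain x z where v: "v = pair_neg x z" using pair_neg_surj by blast
  have inj: "pair_neg x z = pair_neg x' z' \<longleftrightarrow> x = x' \<and> z = z'" for x' z' :: "'a \<Rightarrow> real"
  proof
    assume eq: "pair_neg x z = pair_neg x' z'"
    have "x i = x' i" "z i = z' i" for i
      using fun_cong[OF eq, of "Inl i"] fun_cong[OF eq, of "Inr i"] by (simp_all add: pair_neg_def)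
    then show "x = x' \<and> z = z'" by auto
  qed simp
  show "v \<in> link_mult E (base_of (E <+> E) G g) (base_of (E <+> E) X h) \<longleftrightarrow>
    v \<in> base_of (E <+> E) (compose_bounds G X) (g + h)"
    unfolding v comp link_mult_def by (simp add: inj)
qed

lemma linking_permutohedron_bounds:
  assumes "finite E" "linking_permutohedron E \<Gamma>"
  shows "\<exists>G g. submodular_bounds (E <+> E) G \<and> (E <+> E, g) \<in> G \<and> \<Gamma> = base_of (E <+> E) G g"
proof -
  obtain f where f: "submodular_on (E <+> E) f" "\<forall>A\<subseteq>E <+> E. f A \<noteq> -\<infinity>" "f (E <+> E) \<noteq> \<infinity>"
    "\<Gamma> = ext_base_polyhedron (E <+> E) f"
    using assms(2) unfolding linking_permutohedron_def ext_gen_permutohedron_def by blast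
  obtain g where g: "f (E <+> E) = ereal g" using f(2,3) by (cases "f (E <+> E)") auto
  have fin: "finite (E <+> E)" using assms(1) by simp
  show ?thesis
  proof (intro exI conjI)
    show "submodular_bounds (E <+> E) (bounds_of (E <+> E) f)" by (rule submodular_bounds_of[OF fin f(1,2)])
    show "(E <+> E, g) \<in> bounds_of (E <+> E) f" using g unfolding bounds_of_def by simp
    show "\<Gamma> = base_of (E <+> E) (bounds_of (E <+> E) f) g"
      unfolding f(4) by (rule ext_base_polyhedron_eq_base_of[OF f(2) g])
  qed
qed

lemma green_R_imp_compliant:
  assumes E: "finite E" and p: "submodular_on E p" and q: "submodular_on E q"
    and \<Gamma>: "linking_permutohedron E \<Gamma>"
    and P: "base_polyhedron E p = top_layer E (proj_left \<Gamma>)"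
    and Q: "base_polyhedron E q = top_layer E (proj_left \<Delta>)" and R: "green_R E \<Gamma> \<Delta>"
  shows "compliant E p q"
proof -
  obtain \<Xi> where \<Xi>: "linking_permutohedron E \<Xi>" "link_mult E \<Gamma> \<Xi> = \<Delta>"
    using R unfolding green_R_def by blast
  obtain G g where G: "submodular_bounds (E <+> E) G" "(E <+> E, g) \<in> G" "\<Gamma> = base_of (E <+> E) G g"
    using linking_permutohedron_bounds[OF E \<Gamma>] by blast
  obtain X h where X: "submodular_bounds (E <+> E) X" "(E <+> E, h) \<in> X" "\<Xi> = base_of (E <+> E) X h"
    using linking_permutohedron_bounds[OF E \<Xi>(1)] by blast
  have "\<Delta> = base_of (E <+> E) (compose_bounds G X) (g + h)"
    using \<Xi>(2) link_mult_eq_compose[OF E G(1) X(1) G(2) X(2)] unfolding G(3) X(3) by simp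
  then show ?thesis
    using composition_imp_compliant[OF E E E G(1) X(1) G(2) X(2) p q] P Q unfolding G(3) by simp
qed

text \<open>
  Multiplying by \<open>\<Xi> = {0}\<close> keeps the pairs \<open>(x, 0)\<close>. In the lift of a compliant pair these are
  the points of the contraction, so \<open>\<Delta>\<close> is the base polyhedron of \<open>q\<close> times \<open>{0}\<close>.
\<close>

lemma compliant_imp_green_R:
  assumes E: "finite E" and p: "submodular_on E p" and q: "submodular_on E q" and c: "compliant E p q"
  shows "\<exists>\<Gamma> \<Delta>. linking_permutohedron E \<Gamma> \<and> linking_permutohedron E \<Delta> \<and>
    base_polyhedron E p = top_layer E (proj_left \<Gamma>) \<and>
    base_polyhedron E q = top_layer E (proj_left \<Delta>) \<and> green_R E \<Gamma> \<Delta>"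
proof -
  have link: "linking_permutohedron E (base_polyhedron (E <+> E) r)" if "submodular_on (E <+> E) r" for r
    unfolding linking_permutohedron_def
    using that by (intro gen_permutohedron_imp_ext) (auto simp: gen_permutohedron_def)
  have p0: "p {} = 0" and q0: "q {} = 0" using submodular_onD(1) p q by blast+
  define \<Delta> where "\<Delta> = base_polyhedron (E <+> E) (\<lambda>S. q (Inl -` S))"
  define \<Xi> :: "('a + 'a \<Rightarrow> real) set" where "\<Xi> = base_polyhedron (E <+> E) (\<lambda>S. 0)"
  have mem_\<Delta>: "pair_neg x z \<in> \<Delta> \<longleftrightarrow> x \<in> base_polyhedron E q \<and> z = (\<lambda>_. 0)" for x z
    unfolding \<Delta>_def by (rule pair_neg_in_base_polyhedron_vimage_Inl[where w = q, OF E E q0])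
  have mem_\<Xi>: "pair_neg y z \<in> \<Xi> \<longleftrightarrow> y = (\<lambda>_. 0) \<and> z = (\<lambda>_. 0)" for y z
    unfolding \<Xi>_def using pair_neg_in_base_polyhedron_vimage_Inl[where w = "\<lambda>_. 0", OF E E refl]
      base_polyhedron_zero[OF E] by simp
  obtain \<Gamma> where \<Gamma>: "linking_permutohedron E \<Gamma>" "base_polyhedron E p = top_layer E (proj_left \<Gamma>)"
    "\<And>x. pair_neg x (\<lambda>_. 0) \<in> \<Gamma> \<longleftrightarrow> x \<in> base_polyhedron E q"
  \<comment> \<open>the lift needs an element of \<open>E\<close> as its extra point\<close>
  proof (cases "E = {}")
    case True
    then have "base_polyhedron E p = base_polyhedron E q"
      using p0 q0 by (intro base_polyhedron_cong) simp
    then show ?thesis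
      using that[of \<Delta>] link[OF submodular_on_vimage_Inl[OF q]] mem_\<Delta>
        proj_left_vimage_Inl[of E E q, OF E E q0] top_layer_base_polyhedron[of E q]
      unfolding \<Delta>_def by simp
  next
    case False
    then obtain e where e: "e \<in> E" by blast
    show ?thesis
      using that[of "base_polyhedron (E <+> E) (lift_fun e p q)"]
        link[OF submodular_on_lift_fun[OF p q c]]
        compliant_imp_deletion_contraction(1)[OF E E e p q c, unfolded deletion_def]
        pair_neg_zero_in_base_polyhedron_lift_fun[OF E E e p q c] by blast
  qed
  have "base_polyhedron E q = top_layer E (proj_left \<Delta>)"
    unfolding \<Delta>_def proj_left_vimage_Inl[of E E q, OF E E q0] top_layer_base_polyhedron ..
  moreover have "link_mult E \<Gamma> \<Xi> = \<Delta>"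
  proof (rule set_eqI)
    fix v :: "'a + 'a \<Rightarrow> real"
    have zero_coord: "(\<lambda>_. 0) \<in> coord_space E" unfolding coord_space_def by simp
    have "v \<in> link_mult E \<Gamma> \<Xi> \<longleftrightarrow> (\<exists>x. v = pair_neg x (\<lambda>_. 0) \<and> x \<in> base_polyhedron E q)"
      unfolding link_mult_def mem_\<Xi> using \<Gamma>(3) zero_coord base_polyhedronD(1)[of _ E q] by blast
    also have "\<dots> \<longleftrightarrow> v \<in> \<Delta>"
      using mem_\<Delta> pair_neg_surj[of v] by metis
    finally show "v \<in> link_mult E \<Gamma> \<Xi> \<longleftrightarrow> v \<in> \<Delta>" .
  qed
  moreover have "linking_permutohedron E \<Xi>" unfolding \<Xi>_def
    by (rule link) (simp add: submodular_on_def)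
  moreover have "linking_permutohedron E \<Delta>" unfolding \<Delta>_def
    by (rule link[OF submodular_on_vimage_Inl[OF q]])
  ultimately show ?thesis using \<Gamma>(1,2) unfolding green_R_def by blast
qed

section \<open>Edges of polytopes and linear functionals\<close>

text \<open>
  By induction on the dimension it suffices to find a facet on which \<open>g\<close> is not constant. If
  \<open>g\<close> were constant on every facet, leave a relative interior point \<open>x\<close> in a direction orthogonal
  to \<open>g\<close>. The facet met there spans the hyperplane \<open>g = g x\<close> inside the affine hull, by
  dimension, and thus contains \<open>x\<close> in its affine hull.
\<close>

lemma polytope_has_edge_not_orthogonal:
  fixes F :: "'a::euclidean_space set"
  assumes "polytope F" "a \<in> F" "b \<in> F" "g \<bullet> a \<noteq> g \<bullet> b"
  shows "\<exists>e. e edge_of F \<and> (\<exists>a\<in>e. \<exists>b\<in>e. g \<bullet> a \<noteq> g \<bullet> b)"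
  using assms
proof (induction "nat (aff_dim F)" arbitrary: F a b rule: less_induct)
  case less
  have "a \<noteq> b" using less.prems(4) by auto
  then have "1 \<le> aff_dim F"
    using aff_dim_subset[of "{a, b}" F] less.prems by simp
  then consider "aff_dim F = 1" | "2 \<le> aff_dim F" by linarith
  then show ?case
  proof cases
    case 1
    have "F edge_of F"
      using 1 polytope_imp_convex[OF less.prems(1)] by (simp add: edge_of_def face_of_refl)
    then show ?thesis using less.prems by blast
  next
    case 2
    have cvx: "convex F" and bdd: "bounded F" and poly: "polyhedron F"
      using less.prems(1) by (auto simp: polytope_imp_convex polytope_imp_bounded polytope_imp_polyhedron)
    have "\<exists>G a b. G facet_of F \<and> a \<in> G \<and> b \<in> G \<and> g \<bullet> a \<noteq> g \<bullet> b"
    proof (rule ccontr)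
      assume none: "\<not> ?thesis"
      have "rel_interior F \<noteq> {}" using rel_interior_eq_empty[OF cvx] less.prems(2) by blast
      then obtain x where x: "x \<in> rel_interior F" by blast
      then have xF: "x \<in> affine hull F" using subsetD[OF rel_interior_subset] hull_inc by metis
      define H where "H = affine hull F \<inter> {y. g \<bullet> y = g \<bullet> x}"
      have affH: "affine H" unfolding H_def by (simp add: affine_Int affine_hyperplane)
      have "\<not> affine hull F \<subseteq> {y. g \<bullet> y = g \<bullet> x}"
      proof
        assume "affine hull F \<subseteq> {y. g \<bullet> y = g \<bullet> x}"
        then have "a \<in> {y. g \<bullet> y = g \<bullet> x}" "b \<in> {y. g \<bullet> y = g \<bullet> x}"
          using hull_inc[OF less.prems(2)] hull_inc[OF less.prems(3)] by (metis subsetD)+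
        then show False using less.prems(4) by simp
      qed
      then have dimH: "aff_dim H = aff_dim F - 1"
        unfolding H_def using xF aff_dim_affine_Int_hyperplane[of "affine hull F" g "g \<bullet> x"] by auto
      have "H \<noteq> {x}" using dimH 2 by force
      moreover have "x \<in> H" unfolding H_def using xF by simp
      ultimately obtain y where y: "y \<in> H" "y \<noteq> x" by blast
      have "x + (y - x) \<in> affine hull F" "y - x \<noteq> 0" using y unfolding H_def by auto
      then obtain d where d: "x + d *\<^sub>R (y - x) \<in> rel_frontier F"
        using ray_to_rel_frontier[OF bdd x] by metis
      then obtain G where G: "G facet_of F" "x + d *\<^sub>R (y - x) \<in> G"
        unfolding rel_frontier_of_polyhedron[OF poly] by blast
      have "g \<bullet> (x + d *\<^sub>R (y - x)) = g \<bullet> x"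
        using y(1) unfolding H_def by (simp add: inner_add_right inner_diff_right)
      then have "g \<bullet> z = g \<bullet> x" if "z \<in> G" for z using none G that by metis
      then have "G \<subseteq> {y. g \<bullet> y = g \<bullet> x}" by blast
      moreover have "G \<subseteq> affine hull F" using subset_trans[OF facet_of_imp_subset[OF G(1)] hull_subset] .
      ultimately have "G \<subseteq> H" unfolding H_def by blast
      then have "affine hull G \<subseteq> H" using affH by (simp add: hull_minimal)
      moreover have "aff_dim (affine hull G) = aff_dim H"
        using G(1) dimH by (simp add: facet_of_def)
      moreover have "affine hull G \<noteq> {}" using hull_inc[OF G(2), of affine] by auto
      ultimately have "affine hull G = H"
        using affine_dim_equal[OF affine_affine_hull affH] by blast
      then have "x \<in> affine hull G" using \<open>x \<in> H\<close> by simp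
      moreover have "G face_of F" "G \<noteq> F" using G(1) by (auto simp: facet_of_def)
      then have "affine hull G \<inter> rel_interior F = {}"
        by (rule affine_hull_face_of_disjoint_rel_interior[OF cvx])
      ultimately show False using x by blast
    qed
    then obtain G u v where G: "G facet_of F" "u \<in> G" "v \<in> G" "g \<bullet> u \<noteq> g \<bullet> v" by blast
    have face: "G face_of F" and dim: "aff_dim G = aff_dim F - 1" using G(1) by (auto simp: facet_of_def)
    have "polytope G" using face_of_polytope_polytope[OF less.prems(1) face] .
    moreover have "nat (aff_dim G) < nat (aff_dim F)" using dim 2 by simp
    ultimately obtain e where "e edge_of G" "\<exists>a\<in>e. \<exists>b\<in>e. g \<bullet> a \<noteq> g \<bullet> b"
      using less.hyps[of G u v] G by blast
    then show ?thesis using face_of_trans face unfolding edge_of_def by blast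
  qed
qed

text \<open>
  Among the generators of the polytope that increase \<open>g\<close>, one minimizes the loss of \<open>f\<close> per gain of \<open>g\<close>. With this
  slope \<open>\<tau>\<close>, the functional \<open>f + \<tau> g\<close> is still maximal at \<open>v\<close>, and its maximal face contains
  this generator too. Along the edges of the face, \<open>f\<close> does not increase when \<open>g\<close> does.
\<close>

lemma polytope_improving_edge:
  fixes S :: "'a::euclidean_space set"
  assumes S: "polytope S" and v: "v \<in> S" "\<And>x. x \<in> S \<Longrightarrow> f \<bullet> x \<le> f \<bullet> v"
    and w: "w \<in> S" "g \<bullet> v < g \<bullet> w"
  shows "\<exists>e. e edge_of S \<and> (\<exists>a\<in>e. \<exists>b\<in>e. g \<bullet> a < g \<bullet> b \<and> f \<bullet> b \<le> f \<bullet> a)"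
proof -
  obtain V where V: "finite V" "S = convex hull V" using S unfolding polytope_def by blast
  have sub: "V \<subseteq> S" unfolding V(2) by (rule hull_subset)
  define V' where "V' = {u \<in> V. g \<bullet> v < g \<bullet> u}"
  have "V' \<noteq> {}"
  proof
    assume "V' = {}"
    then have "V \<subseteq> {x. g \<bullet> x \<le> g \<bullet> v}" unfolding V'_def by force
    then have "S \<subseteq> {x. g \<bullet> x \<le> g \<bullet> v}" unfolding V(2) by (simp add: hull_minimal convex_halfspace_le)
    then show False using w by auto
  qed
  define slope where "slope u = (f \<bullet> v - f \<bullet> u) / (g \<bullet> u - g \<bullet> v)" for u
  have "finite V'" unfolding V'_def using V(1) by simp
  then obtain u0 where u0: "u0 \<in> V'" "\<And>u. u \<in> V' \<Longrightarrow> slope u0 \<le> slope u"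
    using \<open>V' \<noteq> {}\<close> ex_min_if_finite[of "slope ` V'"]
    by (metis (no_types, lifting) finite_imageI imageE image_is_empty image_eqI linorder_not_le)
  define \<tau> where "\<tau> = slope u0"
  have u0': "g \<bullet> v < g \<bullet> u0" "u0 \<in> S" using u0(1) sub unfolding V'_def by auto
  have "0 \<le> \<tau>" unfolding \<tau>_def slope_def using v(2)[of u0] u0' by simp
  define h where "h = f + \<tau> *\<^sub>R g"
  have inner_h: "h \<bullet> x = f \<bullet> x + \<tau> * (g \<bullet> x)" for x
    unfolding h_def by (simp add: inner_add_left)
  have "h \<bullet> u \<le> h \<bullet> v" if "u \<in> V" for u
  proof (cases "u \<in> V'")
    case True
    then have "\<tau> \<le> slope u" "0 < g \<bullet> u - g \<bullet> v" using u0(2) unfolding \<tau>_def V'_def by auto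
    then have "\<tau> * (g \<bullet> u - g \<bullet> v) \<le> f \<bullet> v - f \<bullet> u"
      unfolding slope_def by (simp add: pos_le_divide_eq)
    then show ?thesis unfolding inner_h by (simp add: algebra_simps)
  next
    case False
    then have "\<tau> * (g \<bullet> u) \<le> \<tau> * (g \<bullet> v)"
      using that \<open>0 \<le> \<tau>\<close> unfolding V'_def by (intro mult_left_mono) auto
    then show ?thesis unfolding inner_h using v(2)[of u] sub that by force
  qed
  then have "V \<subseteq> {x. h \<bullet> x \<le> h \<bullet> v}" by blast
  then have le: "S \<subseteq> {x. h \<bullet> x \<le> h \<bullet> v}" unfolding V(2) by (simp add: hull_minimal convex_halfspace_le)
  define F where "F = S \<inter> {x. h \<bullet> x = h \<bullet> v}"
  have face: "F face_of S" unfolding F_def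
    using le by (intro face_of_Int_supporting_hyperplane_le polytope_imp_convex[OF S]) auto
  have "\<tau> * (g \<bullet> u0 - g \<bullet> v) = f \<bullet> v - f \<bullet> u0"
    unfolding \<tau>_def slope_def using u0'(1) by simp
  then have "u0 \<in> F" unfolding F_def using u0'(2) by (simp add: inner_h algebra_simps)
  moreover have "v \<in> F" unfolding F_def using v(1) by simp
  ultimately obtain e a b where e: "e edge_of F" "a \<in> e" "b \<in> e" "g \<bullet> a \<noteq> g \<bullet> b"
    using polytope_has_edge_not_orthogonal[OF face_of_polytope_polytope[OF S face], of u0 v g] u0'(1) by auto
  have "e edge_of S" using e(1) face face_of_trans unfolding edge_of_def by blast
  moreover have along: "f \<bullet> y \<le> f \<bullet> x" if "x \<in> e" "y \<in> e" "g \<bullet> x < g \<bullet> y" for x y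
  proof -
    have "e \<subseteq> F" using e(1) face_of_imp_subset unfolding edge_of_def by blast
    then have "x \<in> F" "y \<in> F" using that(1,2) by (simp_all add: subsetD)
    then have "h \<bullet> x = h \<bullet> y" unfolding F_def by simp
    moreover have "\<tau> * (g \<bullet> x) \<le> \<tau> * (g \<bullet> y)"
      using that(3) \<open>0 \<le> \<tau>\<close> by (intro mult_left_mono) auto
    ultimately show ?thesis unfolding inner_h by linarith
  qed
  ultimately show ?thesis using e(2-4) by (metis linorder_neq_iff)
qed

lemma edge_differences_in_span:
  fixes F :: "'a::euclidean_space set"
  assumes "aff_dim F = 1" "a \<in> F" "b \<in> F" "b - a = c *\<^sub>R d" "c \<noteq> 0" "d \<noteq> 0"
    and "x \<in> F" "y \<in> F"
  shows "y - x \<in> span {d}"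
proof -
  have "collinear F" using assms(1) by (simp add: collinear_aff_dim)
  then obtain u where u: "\<forall>x\<in>F. \<forall>y\<in>F. \<exists>c. x - y = c *\<^sub>R u" unfolding collinear_def by blast
  obtain k where k: "b - a = k *\<^sub>R u" using u assms(2,3) by blast
  have "k \<noteq> 0" using k assms(4-6) by auto
  then have "u = (c / k) *\<^sub>R d" using k assms(4)
    by (metis divide_inverse_commute left_inverse scaleR_one scaleR_scaleR)
  moreover obtain l where "y - x = l *\<^sub>R u" using u assms(7,8) by blast
  ultimately have "y - x = (l * (c / k)) *\<^sub>R d" by simp
  then show ?thesis by (metis span_base span_mul singletonI)
qed

section \<open>Edge directions and compliance\<close>

text \<open>
  A point of the submodular polyhedron lies below a base: raise the lower bound given by the
  point to \<open>p E\<close> on the set \<open>E\<close>. The result is still supermodular, and a base lies in between.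
\<close>

lemma add_nonpos_base_polyhedron:
  assumes E: "finite E" and p: "submodular_on E p"
  shows "add_nonpos E (base_polyhedron E p) = submodular_polyhedron E p"
proof (intro equalityI subsetI)
  fix z assume "z \<in> add_nonpos E (base_polyhedron E p)"
  then obtain x u where z: "z = (\<lambda>i. x i + u i)" and x: "x \<in> base_polyhedron E p"
    and u: "u \<in> coord_space E" "\<And>i. u i \<le> 0" unfolding add_nonpos_def by blast
  have "sum z A \<le> p A" if "A \<subseteq> E" for A
    using base_polyhedronD(2)[OF x that] sum_nonpos[of A u] u(2) unfolding z
    by (simp add: sum.distrib add_decreasing2 order_trans)
  then show "z \<in> submodular_polyhedron E p"
    using base_polyhedronD(1)[OF x] u(1) unfolding submodular_polyhedron_def z coord_space_def by simp
next
  fix z assume "z \<in> submodular_polyhedron E p"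
  then have z: "z \<in> coord_space E" "\<And>A. A \<subseteq> E \<Longrightarrow> sum z A \<le> p A"
    unfolding submodular_polyhedron_def by auto
  let ?U = "bounds_of E (\<lambda>A. ereal (p A))"
  have U: "submodular_bounds E ?U"
    using submodular_bounds_of[OF E submodular_on_ereal[OF p]] by simp
  define f where "f A = (if A = E then - p E else - sum z A)" for A
  have p0: "p {} = 0" using submodular_onD(1)[OF p] .
  have f_le: "f A \<le> - sum z A" if "A \<subseteq> E" for A using z(2)[of E] unfolding f_def by simp
  have f: "submodular_on E f" unfolding submodular_on_def
  proof (intro conjI allI impI)
    show "f {} = 0" unfolding f_def using p0 by auto
    fix A B assume AB: "A \<subseteq> E" "B \<subseteq> E"
    have "finite A" "finite B" using AB E by (auto intro: finite_subset)
    then have "sum z (A \<union> B) + sum z (A \<inter> B) = sum z A + sum z B" by (rule sum.union_inter)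
    then show "f (A \<union> B) + f (A \<inter> B) \<le> f A + f B"
      using AB f_le[of "A \<union> B"] f_le[of "A \<inter> B"] unfolding f_def
      by (cases "A = E"; cases "B = E") (auto simp: Un_absorb1 Un_absorb2 Int_absorb1 Int_absorb2 split: if_splits)
  qed
  let ?L = "bounds_of E (\<lambda>A. ereal (f A))"
  have L: "submodular_bounds E ?L"
    using submodular_bounds_of[OF E submodular_on_ereal[OF f]] by simp
  have compat: "0 \<le> r + s" if "(A, r) \<in> ?U" "(A, s) \<in> ?L" for A r s
    using that z(2)[of A] unfolding bounds_of_def f_def by (auto split: if_splits)
  have "\<exists>x\<in>base_of E ?U (p E). \<forall>A s. (A, s) \<in> ?L \<longrightarrow> - s \<le> sum x A"
  proof (rule base_of_above[OF E U L])
    show "0 \<le> r + s" if "(A, r) \<in> ?U" "(A, s) \<in> ?L" for A r s using compat[OF that] .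
    show "(E, p E) \<in> ?U" "(E, - p E) \<in> ?L" unfolding bounds_of_def f_def by auto
  qed
  then obtain x where x: "x \<in> base_polyhedron E p" "\<And>A s. (A, s) \<in> ?L \<Longrightarrow> - s \<le> sum x A"
    unfolding base_polyhedron_eq_base_of by blast
  have "z i \<le> x i" for i
  proof (cases "i \<in> E")
    case True
    then have "({i}, f {i}) \<in> ?L" unfolding bounds_of_def by simp
    from x(2)[OF this] show ?thesis using f_le[of "{i}"] True by simp
  next
    case False
    then show ?thesis using z(1) base_polyhedronD(1)[OF x(1)] unfolding coord_space_def by simp
  qed
  moreover have "(\<lambda>i. z i - x i) \<in> coord_space E"
    using z(1) base_polyhedronD(1)[OF x(1)] unfolding coord_space_def by simp
  ultimately show "z \<in> add_nonpos E (base_polyhedron E p)"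
    unfolding add_nonpos_def using x(1)
    by (intro CollectI exI[of _ x] exI[of _ "\<lambda>i. z i - x i"]) simp
qed

lemma base_polyhedron_uminus:
  assumes E: "finite E" and q0: "q {} = 0"
  shows "(\<lambda>i. - x i) \<in> base_polyhedron E (\<lambda>A. q (E - A) - q E) \<longleftrightarrow> x \<in> base_polyhedron E q"
proof
  assume x: "(\<lambda>i. - x i) \<in> base_polyhedron E (\<lambda>A. q (E - A) - q E)"
  have xE: "sum x E = q E" using base_polyhedronD(3)[OF x] q0 by (simp add: sum_negf)
  have "sum x A \<le> q A" if A: "A \<subseteq> E" for A
    using base_polyhedronD(2)[OF x, of "E - A"] sum_complement[OF E A, of x] xE A
    by (simp add: sum_negf double_diff)
  then show "x \<in> base_polyhedron E q"
    using base_polyhedronD(1)[OF x] xE by (intro base_polyhedronI) (auto simp: coord_space_def)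
next
  assume x: "x \<in> base_polyhedron E q"
  have "sum (\<lambda>i. - x i) A \<le> q (E - A) - q E" if A: "A \<subseteq> E" for A
    using base_polyhedronD(2)[OF x, of "E - A"] sum_complement[OF E A, of x] base_polyhedronD(3)[OF x]
    by (simp add: sum_negf)
  then show "(\<lambda>i. - x i) \<in> base_polyhedron E (\<lambda>A. q (E - A) - q E)"
    using base_polyhedronD[OF x] q0 by (intro base_polyhedronI) (auto simp: coord_space_def sum_negf)
qed

text \<open>
  The reflection \<open>x \<mapsto> - x\<close> carries base polyhedra to base polyhedra and exchanges the two cones.
\<close>

lemma add_nonneg_base_polyhedron:
  assumes E: "finite E" and q: "submodular_on E q"
  shows "add_nonneg E (base_polyhedron E q) = {x \<in> coord_space E. \<forall>A\<subseteq>E. dual_fun E q A \<le> sum x A}"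
proof (rule set_eqI)
  fix z :: "'a \<Rightarrow> real"
  let ?q = "\<lambda>A. q (E - A) - q E"
  have q0: "q {} = 0" using submodular_onD(1)[OF q] .
  have q': "submodular_on E ?q" unfolding submodular_on_def
  proof (intro conjI allI impI)
    fix A B assume "A \<subseteq> E" "B \<subseteq> E"
    then show "q (E - (A \<union> B)) - q E + (q (E - A \<inter> B) - q E) \<le> q (E - A) - q E + (q (E - B) - q E)"
      using submodular_onD(2)[OF q, of "E - A" "E - B"] by (simp add: Diff_Un Diff_Int)
  qed simp
  have "z \<in> add_nonneg E (base_polyhedron E q) \<longleftrightarrow> (\<lambda>i. - z i) \<in> add_nonpos E (base_polyhedron E ?q)"
  proof
    assume "z \<in> add_nonneg E (base_polyhedron E q)"
    then obtain x u where z: "z = (\<lambda>i. x i + u i)" "x \<in> base_polyhedron E q"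
      "u \<in> coord_space E" "\<forall>i. 0 \<le> u i" unfolding add_nonneg_def by blast
    then show "(\<lambda>i. - z i) \<in> add_nonpos E (base_polyhedron E ?q)"
      unfolding add_nonpos_def using base_polyhedron_uminus[where q = q, OF E q0, of x]
      by (intro CollectI exI[of _ "\<lambda>i. - x i"] exI[of _ "\<lambda>i. - u i"]) (auto simp: coord_space_def)
  next
    assume "(\<lambda>i. - z i) \<in> add_nonpos E (base_polyhedron E ?q)"
    then obtain x u where z: "(\<lambda>i. - z i) = (\<lambda>i. x i + u i)" and x: "x \<in> base_polyhedron E ?q"
      and u: "u \<in> coord_space E" "\<forall>i. u i \<le> 0" unfolding add_nonpos_def by blast
    have "z i = - x i + - u i" for i using fun_cong[OF z, of i] by simp
    moreover have "(\<lambda>i. - x i) \<in> base_polyhedron E q"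
      using base_polyhedron_uminus[where q = q, OF E q0, of "\<lambda>i. - x i"] x by simp
    ultimately show "z \<in> add_nonneg E (base_polyhedron E q)"
      unfolding add_nonneg_def using u
      by (intro CollectI exI[of _ "\<lambda>i. - x i"] exI[of _ "\<lambda>i. - u i"]) (auto simp: coord_space_def)
  qed
  also have "\<dots> \<longleftrightarrow> (\<lambda>i. - z i) \<in> submodular_polyhedron E ?q"
    unfolding add_nonpos_base_polyhedron[OF E q'] ..
  also have "\<dots> \<longleftrightarrow> z \<in> {x \<in> coord_space E. \<forall>A\<subseteq>E. dual_fun E q A \<le> sum x A}"
    unfolding submodular_polyhedron_def dual_fun_def by (auto simp: coord_space_def sum_negf algebra_simps)
  finally show "z \<in> add_nonneg E (base_polyhedron E q) \<longleftrightarrow>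
    z \<in> {x \<in> coord_space E. \<forall>A\<subseteq>E. dual_fun E q A \<le> sum x A}" .
qed

lemma Int_add_cones_eq_G_polyhedron:
  assumes "finite E" "submodular_on E p" "submodular_on E q"
  shows "add_nonpos E (base_polyhedron E p) \<inter> add_nonneg E (base_polyhedron E q) =
    G_polyhedron E p (dual_fun E q)"
  unfolding add_nonpos_base_polyhedron[OF assms(1,2)] add_nonneg_base_polyhedron[OF assms(1,3)]
    submodular_polyhedron_def G_polyhedron_def by blast

definition indicator_vec :: "'e::finite set \<Rightarrow> real ^ 'e" where
  "indicator_vec A = (\<chi> i. if i \<in> A then 1 else 0)"

lemma inner_indicator_vec: "indicator_vec A \<bullet> vec_lambda x = sum x A"
proof -
  have "indicator_vec A \<bullet> vec_lambda x = (\<Sum>i\<in>UNIV. if i \<in> A then x i else 0)"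
    unfolding indicator_vec_def inner_vec_def by (intro sum.cong) auto
  then show ?thesis by (simp add: sum.If_cases)
qed

lemma inner_indicator_vec_nth: "indicator_vec A \<bullet> y = sum (($) y) A"
  using inner_indicator_vec[of A "($) y"] by (simp add: vec_lambda_eta)

lemma inner_indicator_vec_axis: "indicator_vec A \<bullet> axis i 1 = (if i \<in> A then 1 else 0)"
  by (simp add: inner_axis indicator_vec_def)

lemma polytope_G_polyhedron: "polytope (vec_lambda ` G_polyhedron E p q')" for E :: "'e::finite set"
proof -
  let ?S = "(\<Inter>i\<in>- E. {y. indicator_vec {i} \<bullet> y = 0}) \<inter>
    (\<Inter>A\<in>Pow E. {y. indicator_vec A \<bullet> y \<le> p A} \<inter> {y. indicator_vec A \<bullet> y \<ge> q' A})"
  have eq: "vec_lambda ` G_polyhedron E p q' = ?S"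
  proof (rule set_eqI)
    fix y :: "real ^ 'e"
    have "y \<in> vec_lambda ` G_polyhedron E p q' \<longleftrightarrow> ($) y \<in> G_polyhedron E p q'"
      by (metis image_iff vec_lambda_beta vec_lambda_eta ext)
    also have "\<dots> \<longleftrightarrow> y \<in> ?S"
      unfolding G_polyhedron_def coord_space_def by (auto simp: inner_indicator_vec_nth)
    finally show "y \<in> vec_lambda ` G_polyhedron E p q' \<longleftrightarrow> y \<in> ?S" .
  qed
  have "polyhedron ?S"
    by (intro polyhedron_Int polyhedron_Inter)
      (auto intro!: polyhedron_Int polyhedron_hyperplane polyhedron_halfspace_le polyhedron_halfspace_ge)
  moreover have "bounded (vec_lambda ` G_polyhedron E p q')"
  proof (rule bounded_subset[OF bounded_cbox])
    show "vec_lambda ` G_polyhedron E p q' \<subseteq>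
      cbox (\<chi> i. if i \<in> E then q' {i} else 0) (\<chi> i. if i \<in> E then p {i} else 0)"
    proof
      fix y assume "y \<in> vec_lambda ` G_polyhedron E p q'"
      then obtain x where x: "y = vec_lambda x" "x \<in> G_polyhedron E p q'" by blast
      have "q' {i} \<le> x i \<and> x i \<le> p {i}" if "i \<in> E" for i
        using x(2) that unfolding G_polyhedron_def by (auto dest: spec[of _ "{i}"])
      then show "y \<in> cbox (\<chi> i. if i \<in> E then q' {i} else 0) (\<chi> i. if i \<in> E then p {i} else 0)"
        using x unfolding G_polyhedron_def coord_space_def by (simp add: mem_box_cart)
    qed
  qed
  ultimately show ?thesis unfolding polytope_eq_bounded_polyhedron eq by blast
qed

text \<open>
  A direction \<open>e\<^sub>i - e\<^sub>j\<close> or \<open>e\<^sub>i\<close> has at most one positive and at most one negative coordinate,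
  so no multiple of it can increase the sums over two disjoint sets together.
\<close>

lemma polymatroidal_edge_disjoint_signs:
  assumes M: "polymatroidal_edges E M" and F: "F edge_of (vec_lambda ` M)" "a \<in> F" "b \<in> F"
    and AB: "A \<inter> B = {}" and pos: "indicator_vec A \<bullet> a < indicator_vec A \<bullet> b"
  shows "indicator_vec B \<bullet> b \<le> indicator_vec B \<bullet> a"
proof -
  consider i j where "has_direction F (axis i 1 - axis j 1)" | i where "has_direction F (axis i 1)"
    using M[unfolded polymatroidal_edges_def, rule_format, OF F(1)] by (elim disjE bexE conjE)
  then have "\<exists>d. has_direction F d \<and> ((\<exists>i j. d = axis i 1 - axis j 1) \<or> (\<exists>i. d = axis i 1))"
  proof cases
    case (1 i j)
    then show ?thesis by (intro exI[of _ "axis i 1 - axis j 1"]) auto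
  next
    case (2 i)
    then show ?thesis by (intro exI[of _ "axis i 1"]) auto
  qed
  then obtain d where d: "has_direction F d" "(\<exists>i j. d = axis i 1 - axis j 1) \<or> (\<exists>i. d = axis i 1)"
    by (elim exE conjE)
  then have "b - a \<in> span {d}" using F(2,3) unfolding has_direction_def by blast
  then obtain c where "b - a = c *\<^sub>R d" by (auto simp: span_singleton)
  then have diff: "indicator_vec C \<bullet> b - indicator_vec C \<bullet> a = c * (indicator_vec C \<bullet> d)" for C
    by (simp flip: inner_diff_right)
  have not_in_both: "\<not> (k \<in> A \<and> k \<in> B)" for k using AB by blast
  have "\<not> (0 < indicator_vec A \<bullet> d \<and> 0 < indicator_vec B \<bullet> d) \<and>
      \<not> (indicator_vec A \<bullet> d < 0 \<and> indicator_vec B \<bullet> d < 0)"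
    using d(2)
  proof (elim disjE exE conjE)
    fix i j assume "d = axis i 1 - axis j 1"
    then show ?thesis using not_in_both[of i] not_in_both[of j]
      by (simp add: inner_diff_right inner_indicator_vec_axis)
  next
    fix i assume "d = axis i 1"
    then show ?thesis using not_in_both[of i] by (simp add: inner_indicator_vec_axis)
  qed
  then have "\<not> (0 < c * (indicator_vec A \<bullet> d) \<and> 0 < c * (indicator_vec B \<bullet> d))"
    unfolding zero_less_mult_iff by linarith
  then show ?thesis using diff[of A] diff[of B] pos by linarith
qed

text \<open>
  Let \<open>v\<close> maximize \<open>v(X) - v(B)\<close> with \<open>B = E - Y\<close>. If \<open>v(X)\<close> were not maximal, or \<open>v(B)\<close> not minimal,
  an edge as in \<open>polytope_improving_edge\<close> would move the sums over \<open>X\<close> and \<open>B\<close> in the same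
  direction. The extreme values are \<open>p X\<close> and \<open>q E - q Y\<close>, because both base polyhedra lie in the
  polytope.
\<close>

lemma polymatroidal_edges_imp_compliant:
  fixes E :: "'e::finite set"
  assumes p: "submodular_on E p" and q: "submodular_on E q"
    and edges: "polymatroidal_edges E (G_polyhedron E p (dual_fun E q))"
    and P: "base_polyhedron E p \<subseteq> G_polyhedron E p (dual_fun E q)"
    and Q: "base_polyhedron E q \<subseteq> G_polyhedron E p (dual_fun E q)"
  shows "compliant E p q"
  unfolding compliant_def
proof (intro allI impI)
  fix X Y assume XY: "X \<subseteq> Y" "Y \<subseteq> E"
  let ?M = "G_polyhedron E p (dual_fun E q)" and ?S = "vec_lambda ` G_polyhedron E p (dual_fun E q)"
  define B where "B = E - Y"
  have E: "finite E" by simp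
  have disj: "X \<inter> B = {}" "B \<inter> X = {}" unfolding B_def using XY by auto
  obtain x where x: "x \<in> base_polyhedron E p" "sum x X = p X"
    using base_polyhedron_attains[OF E p, of X] XY by auto
  obtain y where y: "y \<in> base_polyhedron E q" "sum y Y = q Y"
    using base_polyhedron_attains[OF E q, of Y] XY by auto
  define f where "f = indicator_vec X - indicator_vec B"
  have inner_f: "f \<bullet> u = indicator_vec X \<bullet> u - indicator_vec B \<bullet> u" for u
    unfolding f_def by (simp add: inner_diff_left)
  have poly: "polytope ?S" by (rule polytope_G_polyhedron)
  have "compact ?S" using polytope_imp_compact[OF poly] .
  moreover have "?S \<noteq> {}" using x(1) P by blast
  moreover have "continuous_on ?S (\<lambda>u. f \<bullet> u)" by (intro continuous_intros)
  ultimately obtain v where v: "v \<in> ?S" "\<And>u. u \<in> ?S \<Longrightarrow> f \<bullet> u \<le> f \<bullet> v"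
    using continuous_attains_sup[of ?S "\<lambda>u. f \<bullet> u"] by blast
  have maxX: "indicator_vec X \<bullet> u \<le> indicator_vec X \<bullet> v" if u: "u \<in> ?S" for u
  proof (rule ccontr)
    assume "\<not> ?thesis"
    then obtain e a b where e: "e edge_of ?S" "a \<in> e" "b \<in> e"
      "indicator_vec X \<bullet> a < indicator_vec X \<bullet> b" "f \<bullet> b \<le> f \<bullet> a"
      using polytope_improving_edge[OF poly v u, of "indicator_vec X"] by force
    have "indicator_vec B \<bullet> b \<le> indicator_vec B \<bullet> a"
      by (rule polymatroidal_edge_disjoint_signs[OF edges e(1-3) disj(1) e(4)])
    then show False using e(4,5) unfolding inner_f by linarith
  qed
  have minB: "indicator_vec B \<bullet> v \<le> indicator_vec B \<bullet> u" if u: "u \<in> ?S" for u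
  proof (rule ccontr)
    assume "\<not> ?thesis"
    then have "(- indicator_vec B) \<bullet> v < (- indicator_vec B) \<bullet> u" by simp
    then obtain e a b where e: "e edge_of ?S" "a \<in> e" "b \<in> e"
      "(- indicator_vec B) \<bullet> a < (- indicator_vec B) \<bullet> b" "f \<bullet> b \<le> f \<bullet> a"
      using polytope_improving_edge[OF poly v u, of "- indicator_vec B"] by force
    then have less: "indicator_vec B \<bullet> b < indicator_vec B \<bullet> a" by simp
    have "indicator_vec X \<bullet> a \<le> indicator_vec X \<bullet> b"
      by (rule polymatroidal_edge_disjoint_signs[OF edges e(1) e(3,2) disj(2) less])
    then show False using less e(5) unfolding inner_f by linarith
  qed
  obtain z where z: "z \<in> ?M" "v = vec_lambda z" using v(1) by blast
  have zM: "sum z A \<le> p A" "dual_fun E q A \<le> sum z A" if "A \<subseteq> E" for A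
    using z(1) that unfolding G_polyhedron_def by auto
  have "p X \<le> sum z X"
    using maxX[of "vec_lambda x"] x P unfolding z(2) inner_indicator_vec by auto
  moreover have "sum z B \<le> sum y B"
    using minB[of "vec_lambda y"] y Q unfolding z(2) inner_indicator_vec by auto
  then have "sum z B \<le> q E - q Y"
    using sum_complement[OF E XY(2), of y] y(2) base_polyhedronD(3)[OF y(1)] unfolding B_def by simp
  moreover have "sum z B = sum z E - sum z Y" unfolding B_def by (rule sum_complement[OF E XY(2)])
  moreover have "E - (E - X) = X" "X \<subseteq> E" using XY by auto
  then have "q E - q X \<le> sum z E - sum z X"
    using zM(2)[of "E - X"] sum_complement[OF E, of X z] by (simp add: dual_fun_def)
  moreover have "sum z Y \<le> p Y" using zM(1)[OF XY(2)] .
  ultimately show "q Y - q X \<le> p Y - p X" by linarith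
qed

lemma base_polyhedron_exchange:
  assumes I: "finite I" and p: "submodular_on I p"
    and x: "x \<in> base_polyhedron I p" and y: "y \<in> base_polyhedron I p" and ne: "x \<noteq> y"
  shows "\<exists>i j. i \<in> I \<and> j \<in> I \<and> i \<noteq> j \<and> (\<exists>\<rho>>0.
      (\<lambda>k. x k - \<rho> * (unit_vec i k - unit_vec j k)) \<in> base_polyhedron I p \<and>
      (\<lambda>k. y k + \<rho> * (unit_vec i k - unit_vec j k)) \<in> base_polyhedron I p)"
proof -
  have c: "compliant I p p" unfolding compliant_def by simp
  have main: "\<exists>j. i \<in> I \<and> j \<in> I \<and> i \<noteq> j \<and> (\<exists>\<rho>>0.
      (\<lambda>k. x k - \<rho> * (unit_vec i k - unit_vec j k)) \<in> base_polyhedron I p \<and>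
      (\<lambda>k. y k + \<rho> * (unit_vec i k - unit_vec j k)) \<in> base_polyhedron I p)"
    if xy: "x \<in> base_polyhedron I p" "y \<in> base_polyhedron I p" "y i < x i" for x y i
  proof -
    have i: "i \<in> supp_plus x y" using xy(3) unfolding supp_plus_def by simp
    obtain j \<rho> where j: "j \<in> supp_minus x y" and \<rho>: "\<rho> > 0"
      "\<forall>\<rho>'\<in>{0..\<rho>}. (\<lambda>k. x k - \<rho>' * (unit_vec i k - unit_vec j k)) \<in> base_polyhedron I p \<and>
        (\<lambda>k. y k + \<rho>' * (unit_vec i k - unit_vec j k)) \<in> base_polyhedron I p"
      using compliant_imp_exchange[OF I p p c xy(1,2) i] by blast
    have "x j < y j" using j unfolding supp_minus_def supp_plus_def by simp
    then have "i \<noteq> j" using xy(3) by auto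
    moreover have "k \<in> I" if "x k \<noteq> y k" for k
      using that base_polyhedronD(1)[OF xy(1)] base_polyhedronD(1)[OF xy(2)]
      unfolding coord_space_def by (metis (mono_tags, lifting) mem_Collect_eq)
    then have "i \<in> I" "j \<in> I" using xy(3) \<open>x j < y j\<close> by auto
    moreover have "\<rho> \<in> {0..\<rho>}" using \<rho>(1) by simp
    ultimately show ?thesis using \<rho> by blast
  qed
  obtain i where "x i \<noteq> y i" using ne by blast
  then consider "y i < x i" | "x i < y i" by linarith
  then show ?thesis
  proof cases
    case 1
    then show ?thesis using main[OF x y] by blast
  next
    case 2
    from main[OF y x this] obtain j \<rho> where j: "i \<in> I" "j \<in> I" "i \<noteq> j" "\<rho> > 0"
      "(\<lambda>k. y k - \<rho> * (unit_vec i k - unit_vec j k)) \<in> base_polyhedron I p"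
      "(\<lambda>k. x k + \<rho> * (unit_vec i k - unit_vec j k)) \<in> base_polyhedron I p" by blast
    have "x k - \<rho> * (unit_vec j k - unit_vec i k) = x k + \<rho> * (unit_vec i k - unit_vec j k)"
      "y k + \<rho> * (unit_vec j k - unit_vec i k) = y k - \<rho> * (unit_vec i k - unit_vec j k)" for k
      by (simp_all add: algebra_simps)
    then show ?thesis using j by (intro exI[of _ j] exI[of _ i]) auto
  qed
qed

text \<open>
  The two exchanged points have the same midpoint as \<open>a\<close> and \<open>b\<close>, so they lie in the face \<open>F\<close>.
\<close>

lemma edge_direction_from_exchange:
  fixes S :: "'a::euclidean_space set"
  assumes F: "F edge_of S" "a \<in> F" "b \<in> F" and \<rho>: "\<rho> > 0" and d: "d \<noteq> 0"
    and S: "a - \<rho> *\<^sub>R d \<in> S" "b + \<rho> *\<^sub>R d \<in> S" and "x \<in> F" "y \<in> F"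
  shows "y - x \<in> span {d}"
proof -
  have face: "F face_of S" and dim: "aff_dim F = 1" using F(1) unfolding edge_of_def by auto
  let ?m = "midpoint a b"
  have "?m \<in> F" using closed_segment_subset[OF F(2,3) face_of_imp_convex[OF face]] by auto
  have m: "midpoint (a - \<rho> *\<^sub>R d) (b + \<rho> *\<^sub>R d) = ?m" unfolding midpoint_def by simp
  have "a - \<rho> *\<^sub>R d \<in> F"
  proof (cases "a - \<rho> *\<^sub>R d = b + \<rho> *\<^sub>R d")
    case True
    then have "a - \<rho> *\<^sub>R d = ?m" using m by (metis midpoint_idem)
    then show ?thesis using \<open>?m \<in> F\<close> by simp
  next
    case False
    then have "?m \<in> open_segment (a - \<rho> *\<^sub>R d) (b + \<rho> *\<^sub>R d)"
      unfolding m[symmetric] by (simp add: open_segment_def midpoint_eq_endpoint)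
    then show ?thesis using face_ofD[OF face _ S \<open>?m \<in> F\<close>] by blast
  qed
  moreover have "a - \<rho> *\<^sub>R d - a = (- \<rho>) *\<^sub>R d" by simp
  ultimately show ?thesis
    using edge_differences_in_span[OF dim F(2) _ _ _ d] \<rho> assms(8,9) by (metis less_irrefl neg_equal_0_iff_equal)
qed

text \<open>
  Exchange in the lifted base polyhedron moves along \<open>e\<^sub>i - e\<^sub>j\<close>; projecting away the extra point
  leaves \<open>e\<^sub>i - e\<^sub>j\<close>, \<open>e\<^sub>i\<close> or \<open>- e\<^sub>j\<close>.
\<close>

lemma compliant_imp_polymatroidal_edges:
  fixes E :: "'e::finite set"
  assumes p: "submodular_on E p" and q: "submodular_on E q" and c: "compliant E p q"
  shows "polymatroidal_edges E (G_polyhedron E p (dual_fun E q))"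
  unfolding polymatroidal_edges_def
proof (intro allI impI)
  let ?G = "G_polyhedron E p (dual_fun E q)"
  let ?r = "lift_fun () p q" and ?I = "E <+> {()}"
  fix F assume F: "F edge_of (vec_lambda ` ?G)"
  have fin: "finite E" "finite ?I" "finite {()}" by simp_all
  have r: "submodular_on ?I ?r" using submodular_on_lift_fun[OF p q c] .
  have proj: "proj_left (base_polyhedron ?I ?r) = ?G"
    by (rule proj_left_lift_fun[OF fin(1,3)]) (use submodular_onD(1)[OF p] submodular_onD(1)[OF q] in auto)
  have FG: "F \<subseteq> vec_lambda ` ?G" and dim: "aff_dim F = 1"
    using F face_of_imp_subset unfolding edge_of_def by auto
  have "\<exists>a\<in>F. \<exists>b\<in>F. a \<noteq> b"
  proof (rule ccontr)
    assume none: "\<not> ?thesis"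
    have "F \<noteq> {}" using dim by auto
    then obtain a where "F = {a}" using none by blast
    then show False using dim by simp
  qed
  then obtain a b where ab: "a \<in> F" "b \<in> F" "a \<noteq> b" by blast
  obtain u where u: "u \<in> base_polyhedron ?I ?r" "a = (\<chi> i. u (Inl i))"
    using ab(1) FG unfolding proj[symmetric] proj_left_def by blast
  obtain v where v: "v \<in> base_polyhedron ?I ?r" "b = (\<chi> i. v (Inl i))"
    using ab(2) FG unfolding proj[symmetric] proj_left_def by blast
  have "u \<noteq> v" using ab(3) u(2) v(2) by auto
  then obtain i j \<rho> where ij: "i \<in> ?I" "j \<in> ?I" "i \<noteq> j" and \<rho>: "\<rho> > 0"
    and u': "(\<lambda>k. u k - \<rho> * (unit_vec i k - unit_vec j k)) \<in> base_polyhedron ?I ?r"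
    and v': "(\<lambda>k. v k + \<rho> * (unit_vec i k - unit_vec j k)) \<in> base_polyhedron ?I ?r"
    using base_polyhedron_exchange[OF fin(2) r u(1) v(1)] by blast
  define d :: "real ^ 'e" where "d = (\<chi> k. unit_vec i (Inl k) - unit_vec j (Inl k))"
  have mem: "vec_lambda (\<lambda>k. w (Inl k)) \<in> vec_lambda ` ?G" if "w \<in> base_polyhedron ?I ?r" for w
    unfolding proj[symmetric] proj_left_def using that by blast
  have "a - \<rho> *\<^sub>R d = vec_lambda (\<lambda>k. u (Inl k) - \<rho> * (unit_vec i (Inl k) - unit_vec j (Inl k)))"
    "b + \<rho> *\<^sub>R d = vec_lambda (\<lambda>k. v (Inl k) + \<rho> * (unit_vec i (Inl k) - unit_vec j (Inl k)))"
    unfolding u(2) v(2) d_def by (simp_all add: vec_eq_iff)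
  then have S: "a - \<rho> *\<^sub>R d \<in> vec_lambda ` ?G" "b + \<rho> *\<^sub>R d \<in> vec_lambda ` ?G"
    using mem[OF u'] mem[OF v'] by simp_all
  have direction: "has_direction F d" if "d \<noteq> 0"
    unfolding has_direction_def
    using edge_direction_from_exchange[OF F ab(1,2) \<rho> that S] that by blast
  have axis: "unit_vec (Inl k) (Inl l) = axis k 1 $ l" "unit_vec (Inr m) (Inl l) = 0" for k l :: 'e and m :: unit
    unfolding unit_vec_def axis_def by auto
  show "(\<exists>i\<in>E. \<exists>j\<in>E. i \<noteq> j \<and> has_direction F (axis i 1 - axis j 1)) \<or> (\<exists>i\<in>E. has_direction F (axis i 1))"
  proof (cases i)
    case i: (Inl k)
    show ?thesis
    proof (cases j)
      case j: (Inl l)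
      have "d = axis k 1 - axis l 1" unfolding d_def i j axis by (simp add: vec_eq_iff)
      moreover have "k \<noteq> l" "k \<in> E" "l \<in> E" using ij i j by auto
      moreover have "axis k (1::real) - axis l 1 \<noteq> 0" using \<open>k \<noteq> l\<close> by (simp add: axis_eq_axis)
      ultimately show ?thesis using direction by metis
    next
      case j: (Inr m)
      have "d = axis k 1" unfolding d_def i j axis by (simp add: vec_eq_iff)
      moreover have "k \<in> E" using ij i by auto
      ultimately show ?thesis using direction by (metis axis_eq_0_iff zero_neq_one)
    qed
  next
    case i: (Inr m)
    show ?thesis
    proof (cases j)
      case j: (Inl l)
      have d: "d = - axis l 1" unfolding d_def i j axis by (simp add: vec_eq_iff)
      have "l \<in> E" using ij j by auto
      have "d \<noteq> 0" unfolding d by (simp add: axis_eq_0_iff)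
      then have "has_direction F d" by (rule direction)
      moreover have "span {- axis l (1::real)} \<subseteq> span {axis l 1}"
        by (intro span_minimal) (auto intro: span_neg span_base)
      ultimately have "has_direction F (axis l 1)"
        unfolding has_direction_def d by auto
      then show ?thesis using \<open>l \<in> E\<close> by blast
    next
      case j: (Inr m')
      then show ?thesis using ij(3) i by simp
    qed
  qed
qed

section \<open>The equivalence\<close>

lemma all_equivalentI:
  assumes "\<forall>b\<in>set bs. b = c"
  shows "all_equivalent bs"
  using assms unfolding all_equivalent_def by blast

theorem theorem6p1:
  fixes E :: "'e::finite set"
    and P Q :: "('e \<Rightarrow> real) set"
    and p q :: "'e set \<Rightarrow> real"
  assumes "submodular_on E p" and "P = base_polyhedron E p"
    and "submodular_on E q" and "Q = base_polyhedron E q"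
  shows "all_equivalent [
    \<comment> \<open>(1) compliant functions\<close>
    \<forall>X Y. X \<subseteq> Y \<longrightarrow> Y \<subseteq> E \<longrightarrow> q Y - q X \<le> p Y - p X,
    \<comment> \<open>(2) containment of bases\<close>
    \<forall>\<sigma>. bij_betw \<sigma> {1..card E} E \<longrightarrow>
      (\<forall>i\<in>E. perm_vertex E P \<sigma> i \<ge> perm_vertex E Q \<sigma> i),
    \<comment> \<open>(3) submodular polyhedron containment\<close>
    \<forall>X\<subseteq>E. submodular_polyhedron (E - X) (contract_fun q X)
           \<subseteq> submodular_polyhedron (E - X) (contract_fun p X),
    \<comment> \<open>(4) top and bottom\<close>
    (let R = G_polyhedron E p (dual_fun E q)
     in gen_polymatroid E R \<and> P = top_layer E R \<and> Q = bottom_layer E R),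
    \<comment> \<open>(5) deletion-contraction\<close>
    \<exists>(X :: nat set) R. finite X \<and> gen_permutohedron (E <+> X) R \<and>
      P = deletion E R \<and> Q = contraction E R,
    \<comment> \<open>(5), with a singleton\<close>
    \<exists>(X :: nat set) R. is_singleton X \<and> gen_permutohedron (E <+> X) R \<and>
      P = deletion E R \<and> Q = contraction E R,
    \<comment> \<open>(6) exchange property\<close>
    \<forall>x\<in>Q. \<forall>y\<in>P. \<forall>i\<in>supp_plus x y. \<exists>j\<in>supp_minus x y. \<exists>\<rho>0>0. \<forall>\<rho>\<in>{0..\<rho>0}.
      (\<lambda>k. x k - \<rho> * (unit_vec i k - unit_vec j k)) \<in> Q \<and>
      (\<lambda>k. y k + \<rho> * (unit_vec i k - unit_vec j k)) \<in> P,
    \<comment> \<open>(7) edge directions of a polyhedron which contains P and Q\<close>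
    (let M = add_nonpos E (base_polyhedron E p) \<inter> add_nonneg E (base_polyhedron E q)
     in polymatroidal_edges E M \<and> P \<subseteq> M \<and> Q \<subseteq> M),
    \<comment> \<open>(8) induction\<close>
    \<exists>(E' :: nat set) \<Gamma> W. finite E' \<and> gen_permutohedron (E <+> E') \<Gamma> \<and>
      gen_permutohedron E' W \<and> P = top_layer E (proj_left \<Gamma>) \<and> Q = induction_by E \<Gamma> W,
    \<comment> \<open>(9) R-ordered linking permutohedra\<close>
    \<exists>\<Gamma> \<Delta>. linking_permutohedron E \<Gamma> \<and> linking_permutohedron E \<Delta> \<and>
      P = top_layer E (proj_left \<Gamma>) \<and> Q = top_layer E (proj_left \<Delta>) \<and> green_R E \<Gamma> \<Delta>]"
proof -
  have E: "finite E" by simp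
  note p = assms(1) and P = assms(2) and q = assms(3) and Q = assms(4)
  let ?R = "\<lambda>J :: nat set. base_polyhedron (E <+> J) (lift_fun 0 p q)"
  have lift: "gen_permutohedron (E <+> {0 :: nat}) (?R {0})" if "compliant E p q"
    unfolding gen_permutohedron_def
    by (intro exI conjI, rule submodular_on_lift_fun[OF p q that], rule refl)
  have set_funs: "(\<forall>X Y. X \<subseteq> Y \<longrightarrow> Y \<subseteq> E \<longrightarrow> q Y - q X \<le> p Y - p X) = compliant E p q"
    unfolding compliant_def ..
  have vertices: "(\<forall>\<sigma>. bij_betw \<sigma> {1..card E} E \<longrightarrow>
      (\<forall>i\<in>E. perm_vertex E P \<sigma> i \<ge> perm_vertex E Q \<sigma> i)) = compliant E p q"
    unfolding P Q compliant_iff_vertices[OF E p q] ..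
  have polyhedra: "(\<forall>X\<subseteq>E. submodular_polyhedron (E - X) (contract_fun q X)
      \<subseteq> submodular_polyhedron (E - X) (contract_fun p X)) = compliant E p q"
    unfolding compliant_iff_submodular_polyhedra[OF E q] ..
  have layers: "(let R = G_polyhedron E p (dual_fun E q)
      in gen_polymatroid E R \<and> P = top_layer E R \<and> Q = bottom_layer E R) = compliant E p q"
    unfolding P Q Let_def compliant_iff_gen_polymatroid[OF E p q] ..
  have imp: "compliant E p q" if X: "finite X" and R: "gen_permutohedron (E <+> X) R"
    and PR: "P = deletion E R" and QR: "Q = contraction E R" for X :: "nat set" and R
  proof -
    obtain r where r: "submodular_on (E <+> X) r" "R = base_polyhedron (E <+> X) r"
      using R unfolding gen_permutohedron_def by (elim exE conjE)
    show ?thesis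
      by (rule deletion_contraction_imp_compliant[OF E X r(1) p q])
        (use PR QR in \<open>simp_all add: P Q r(2)\<close>)
  qed
  have single: "\<exists>(X :: nat set) R. is_singleton X \<and> gen_permutohedron (E <+> X) R \<and>
      P = deletion E R \<and> Q = contraction E R" if c: "compliant E p q"
    using compliant_imp_deletion_contraction[OF E _ _ p q c, of "{0}" 0] lift[OF c]
    unfolding P Q by (intro exI[of _ "{0}"] exI[of _ "?R {0}"]) simp
  have fin: "finite X" if "is_singleton X" for X :: "nat set"
    using that by (auto simp: is_singleton_def)
  have minors: "(\<exists>(X :: nat set) R. finite X \<and> gen_permutohedron (E <+> X) R \<and>
      P = deletion E R \<and> Q = contraction E R) = compliant E p q"
    using imp single fin by blast
  have single_minor: "(\<exists>(X :: nat set) R. is_singleton X \<and> gen_permutohedron (E <+> X) R \<and>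
      P = deletion E R \<and> Q = contraction E R) = compliant E p q"
    using imp single fin by blast
  have exchange: "(\<forall>x\<in>Q. \<forall>y\<in>P. \<forall>i\<in>supp_plus x y. \<exists>j\<in>supp_minus x y. \<exists>\<rho>0>0. \<forall>\<rho>\<in>{0..\<rho>0}.
      (\<lambda>k. x k - \<rho> * (unit_vec i k - unit_vec j k)) \<in> Q \<and>
      (\<lambda>k. y k + \<rho> * (unit_vec i k - unit_vec j k)) \<in> P) = compliant E p q"
    unfolding P Q
  proof (intro iffI ballI)
    show "compliant E p q" if "\<forall>x\<in>base_polyhedron E q. \<forall>y\<in>base_polyhedron E p. \<forall>i\<in>supp_plus x y.
      \<exists>j\<in>supp_minus x y. \<exists>\<rho>0>0. \<forall>\<rho>\<in>{0..\<rho>0}.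
      (\<lambda>k. x k - \<rho> * (unit_vec i k - unit_vec j k)) \<in> base_polyhedron E q \<and>
      (\<lambda>k. y k + \<rho> * (unit_vec i k - unit_vec j k)) \<in> base_polyhedron E p"
      using exchange_imp_compliant[OF E p q that] .
  qed (rule compliant_imp_exchange[OF E p q])
  have edges: "(let M = add_nonpos E (base_polyhedron E p) \<inter> add_nonneg E (base_polyhedron E q)
      in polymatroidal_edges E M \<and> P \<subseteq> M \<and> Q \<subseteq> M) = compliant E p q"
    unfolding P Q Let_def Int_add_cones_eq_G_polyhedron[OF E p q]
  proof (intro iffI conjI)
    assume c: "compliant E p q"
    show "polymatroidal_edges E (G_polyhedron E p (dual_fun E q))"
      by (rule compliant_imp_polymatroidal_edges[OF p q c])
    show "base_polyhedron E p \<subseteq> G_polyhedron E p (dual_fun E q)"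
      "base_polyhedron E q \<subseteq> G_polyhedron E p (dual_fun E q)"
      using compliant_layers[OF E p q c] unfolding top_layer_def bottom_layer_def by blast+
  qed (use polymatroidal_edges_imp_compliant[OF p q] in blast)
  have induction: "(\<exists>(E' :: nat set) \<Gamma> W. finite E' \<and> gen_permutohedron (E <+> E') \<Gamma> \<and>
      gen_permutohedron E' W \<and> P = top_layer E (proj_left \<Gamma>) \<and> Q = induction_by E \<Gamma> W) = compliant E p q"
  proof
    assume "\<exists>(E' :: nat set) \<Gamma> W. finite E' \<and> gen_permutohedron (E <+> E') \<Gamma> \<and>
      gen_permutohedron E' W \<and> P = top_layer E (proj_left \<Gamma>) \<and> Q = induction_by E \<Gamma> W"
    then obtain E' :: "nat set" and g w where "finite E'" "submodular_on (E <+> E') g" "submodular_on E' w"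
      "P = top_layer E (proj_left (base_polyhedron (E <+> E') g))"
      "Q = induction_by E (base_polyhedron (E <+> E') g) (base_polyhedron E' w)"
      unfolding gen_permutohedron_def by blast
    then show "compliant E p q"
      using induction_imp_compliant[OF E _ _ _ p q] unfolding P Q by blast
  next
    assume c: "compliant E p q"
    have "gen_permutohedron {0 :: nat} (base_polyhedron {0} (\<lambda>_. 0))"
      unfolding gen_permutohedron_def submodular_on_def by (intro exI[of _ "\<lambda>_. 0"]) simp
    then show "\<exists>(E' :: nat set) \<Gamma> W. finite E' \<and> gen_permutohedron (E <+> E') \<Gamma> \<and>
      gen_permutohedron E' W \<and> P = top_layer E (proj_left \<Gamma>) \<and> Q = induction_by E \<Gamma> W"
      using lift[OF c] compliant_imp_induction[OF E p q c, of "0 :: nat"] unfolding P Q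
      by (intro exI[of _ "{0}"] exI[of _ "?R {0}"] exI[of _ "base_polyhedron {0} (\<lambda>_. 0)"]) simp
  qed
  have green: "(\<exists>\<Gamma> \<Delta>. linking_permutohedron E \<Gamma> \<and> linking_permutohedron E \<Delta> \<and>
      P = top_layer E (proj_left \<Gamma>) \<and> Q = top_layer E (proj_left \<Delta>) \<and> green_R E \<Gamma> \<Delta>) = compliant E p q"
    using green_R_imp_compliant[OF E p q] compliant_imp_green_R[OF E p q] unfolding P Q by blast
  show ?thesis
    by (rule all_equivalentI[of _ "compliant E p q"])
      (simp only: list.set ball_simps set_funs vertices polyhedra layers minors single_minor
        exchange edges induction green simp_thms)
qed

end
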